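(* Let $C$ be an elliptic curve over $\mathbb{C}$, let $P,Q\in C$ be closed points, let $a,b$ be integers with $2\le a\le b$, and let $E=\mathcal{O}_C(aP)\oplus\mathcal{O}_C(bQ)$. Then $\mathbf{G}(E)$ is irreducible if and only if $a=b$, $a\in\{2,3\}$ and $aP\sim aQ$.
   Context: We work over $\mathbb{C}$. An elliptic curve is a smooth projective (irreducible) curve of genus $1$; $\sim$ denotes linear equivalence of divisors. For a vector bundle $E$ of rank at least two on a smooth projective curve $C$, let $d_2:\bigwedge^2H^0(C,E)\to H^0(C,\bigwedge^2E)$ be the second determinant map, $s\wedge t\mapsto (x\mapsto s(x)\wedge t(x))$. Let $\mathrm{Gr}(2,H^0(C,E))\subseteq\mathbb{P}(\bigwedge^2H^0(C,E))$ be the Grassmannian of two-dimensional subspaces in its Plücker embedding ($\mathbb{P}$ denotes the space of one-dimensional subspaces), and set $$\mathbf{G}(E)=\mathrm{Gr}(2,H^0(C,E))\cap\mathbb{P}(\ker d_2).$$ Thus $\mathbf{G}(E)$ consists of those two-dimensional subspaces of $H^0(C,E)$ that generate a rank-one subsheaf of $E$. *)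

theory Defs
  imports
    "HOL-Analysis.Analysis"
    "HOL-Library.Function_Algebras"
    "HOL-Library.Poly_Mapping"
begin

section \<open>Complex vector spaces\<close>

class complex_vector = ab_group_add +
  fixes scaleC :: "complex \<Rightarrow> 'a \<Rightarrow> 'a"  (infixr "*\<^sub>C" 75)
  assumes scaleC_add_right: "c *\<^sub>C (x + y) = c *\<^sub>C x + c *\<^sub>C y"
    and scaleC_add_left: "(c + d) *\<^sub>C x = c *\<^sub>C x + d *\<^sub>C x"
    and scaleC_scaleC: "c *\<^sub>C d *\<^sub>C x = (c * d) *\<^sub>C x"
    and scaleC_one: "1 *\<^sub>C x = x"

global_interpretation cvec: vector_space "scaleC :: complex \<Rightarrow> 'a \<Rightarrow> 'a::complex_vector"
  by standard (simp_all add: scaleC_add_right scaleC_add_left scaleC_scaleC scaleC_one)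

abbreviation clinear :: "('a::complex_vector \<Rightarrow> 'b::complex_vector) \<Rightarrow> bool" where
  "clinear \<equiv> Vector_Spaces.linear (*\<^sub>C) (*\<^sub>C)"

instantiation complex :: complex_vector
begin
definition scaleC_complex :: "complex \<Rightarrow> complex \<Rightarrow> complex" where
  "scaleC_complex c x = c * x"
instance by standard (simp_all add: scaleC_complex_def algebra_simps)
end

instantiation "fun" :: (type, complex_vector) complex_vector
begin
definition scaleC_fun :: "complex \<Rightarrow> ('a \<Rightarrow> 'b) \<Rightarrow> 'a \<Rightarrow> 'b" where
  "scaleC_fun c f = (\<lambda>x. c *\<^sub>C f x)"
instance
  by standard (simp_all add: scaleC_fun_def fun_eq_iff scaleC_add_right scaleC_add_left
      scaleC_scaleC scaleC_one)
end

instantiation prod :: (complex_vector, complex_vector) complex_vector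
begin
definition scaleC_prod :: "complex \<Rightarrow> 'a \<times> 'b \<Rightarrow> 'a \<times> 'b" where
  "scaleC_prod c z = (c *\<^sub>C fst z, c *\<^sub>C snd z)"
instance
  by standard (simp_all add: scaleC_prod_def prod_eq_iff scaleC_add_right scaleC_add_left
      scaleC_scaleC scaleC_one)
end

instantiation vec :: (complex_vector, finite) complex_vector
begin
definition scaleC_vec :: "complex \<Rightarrow> 'a ^ 'b \<Rightarrow> 'a ^ 'b" where
  "scaleC_vec c x = (\<chi> i. c *\<^sub>C (x $ i))"
instance
  by standard (simp_all add: scaleC_vec_def vec_eq_iff scaleC_add_right scaleC_add_left
      scaleC_scaleC scaleC_one)
end


section \<open>Projective spaces and the Zariski topology\<close>

text \<open>The homogeneous polynomial functions of degree \<open>d\<close> are the linear combinations of products of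
  \<open>d\<close> linear functionals.\<close>

inductive hom_poly :: "nat \<Rightarrow> ('v::complex_vector \<Rightarrow> complex) \<Rightarrow> bool" where
  const: "hom_poly 0 (\<lambda>x. c)"
| mult: "clinear \<phi> \<Longrightarrow> hom_poly d f \<Longrightarrow> hom_poly (Suc d) (\<lambda>x. \<phi> x * f x)"
| add: "hom_poly d f \<Longrightarrow> hom_poly d g \<Longrightarrow> hom_poly d (\<lambda>x. f x + g x)"

lemma hom_poly_scale:
  assumes "hom_poly d f" shows "f (c *\<^sub>C x) = c ^ d * f x"
  using assms
proof induction
  case (mult \<phi> d f)
  have "\<phi> (c *\<^sub>C x) = c * \<phi> x"
    using mult(1) by (simp add: linear_iff Vector_Spaces.linear_iff scaleC_complex_def)
  then show ?case using mult by simp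
qed (simp_all add: algebra_simps)

lemma hom_poly_prod:
  assumes "hom_poly d f" "hom_poly e g" shows "hom_poly (d + e) (\<lambda>x. f x * g x)"
  using assms
proof (induction arbitrary: rule: hom_poly.induct)
  case (const c)
  from \<open>hom_poly e g\<close> have "hom_poly e (\<lambda>x. c * g x)"
  proof induction
    case (const c') show ?case by (rule hom_poly.const)
  next
    case (mult \<phi> d f)
    have "hom_poly (Suc d) (\<lambda>x. \<phi> x * (c * f x))" using mult by (intro hom_poly.mult)
    then show ?case by (simp add: mult.left_commute)
  next
    case (add d f g)
    then show ?case using hom_poly.add[OF add.IH] by (simp add: distrib_left)
  qed
  then show ?case by simp
next
  case (mult \<phi> d f)
  then show ?case using hom_poly.mult[OF mult(1) mult.IH[OF mult.prems]] by (simp add: mult.assoc)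
next
  case (add d f1 f2)
  then show ?case using hom_poly.add[of "d + e" "\<lambda>x. f1 x * g x" "\<lambda>x. f2 x * g x"]
    by (simp add: distrib_right)
qed

definition proj :: "'v::complex_vector set \<Rightarrow> 'v set set" where
  "proj W = {L. \<exists>v\<in>W. v \<noteq> 0 \<and> L = cvec.span {v}}"

definition nonzero_locus :: "('v::complex_vector \<Rightarrow> complex) set \<Rightarrow> 'v set set" where
  "nonzero_locus F = {L \<in> proj UNIV. \<exists>f\<in>F. \<exists>x\<in>L. f x \<noteq> 0}"

text \<open>For a finite-dimensional subspace \<open>W\<close>, every linear functional on \<open>W\<close> extends to the ambient space,
  so the topology induced on \<^term>\<open>proj W\<close> is the usual Zariski topology.\<close>

definition zariski :: "'v::complex_vector set topology" where
  "zariski = topology (\<lambda>U. \<exists>F. (\<forall>f\<in>F. \<exists>d. hom_poly d f) \<and> U = nonzero_locus F)"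

lemma line_nonzero_iff:
  assumes "hom_poly d f"
  shows "(\<exists>x\<in>cvec.span {v}. f x \<noteq> 0) \<longleftrightarrow> f v \<noteq> 0"
  using hom_poly_scale[OF assms] by (auto simp: cvec.span_singleton intro: exI[of _ 1])

lemma nonzero_locus_alt:
  assumes "\<forall>f\<in>F. \<exists>d. hom_poly d f"
  shows "nonzero_locus F = {cvec.span {v} | v. v \<noteq> 0 \<and> (\<exists>f\<in>F. f v \<noteq> 0)}"
proof -
  have "(\<exists>f\<in>F. \<exists>x\<in>cvec.span {v}. f x \<noteq> 0) \<longleftrightarrow> (\<exists>f\<in>F. f v \<noteq> 0)" for v
    using assms line_nonzero_iff by (intro bex_cong refl) blast
  then show ?thesis unfolding nonzero_locus_def proj_def by auto
qed

lemma istopology_zariski: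
  "istopology (\<lambda>U :: 'v::complex_vector set set.
     \<exists>F. (\<forall>f\<in>F. \<exists>d. hom_poly d f) \<and> U = nonzero_locus F)"
proof -
  have inter: "\<exists>F. (\<forall>f\<in>F. \<exists>d. hom_poly d f) \<and> S \<inter> T = nonzero_locus F"
    if F: "\<forall>f\<in>F. \<exists>d. hom_poly d f" and S: "S = nonzero_locus F"
      and G: "\<forall>f\<in>G. \<exists>d. hom_poly d f" and T: "T = nonzero_locus G"
    for S T :: "'v set set" and F G
  proof -
    define H where "H = (\<lambda>(f, g) x. f x * g x) ` (F \<times> G)"
    have H: "\<forall>h\<in>H. \<exists>d. hom_poly d h"
    proof
      fix h assume "h \<in> H"
      then obtain f g where h: "f \<in> F" "g \<in> G" "h = (\<lambda>x. f x * g x)" by (auto simp: H_def)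
      obtain d e where "hom_poly d f" "hom_poly e g" using F G h by blast
      then have "hom_poly (d + e) h" unfolding h(3) by (rule hom_poly_prod)
      then show "\<exists>d. hom_poly d h" ..
    qed
    have "S \<inter> T = nonzero_locus H"
    proof (intro equalityI subsetI)
      fix L assume L: "L \<in> S \<inter> T"
      then obtain f x where 1: "f \<in> F" "x \<in> L" "f x \<noteq> 0" and P: "L \<in> proj UNIV"
        unfolding S nonzero_locus_def by auto
      from L obtain g y where 2: "g \<in> G" "y \<in> L" "g y \<noteq> 0"
        unfolding T nonzero_locus_def by auto
      from P obtain v where v: "v \<noteq> 0" "L = cvec.span {v}" by (auto simp: proj_def)
      obtain d e where "hom_poly d f" "hom_poly e g" using F G 1 2 by blast
      then have "f v \<noteq> 0" "g v \<noteq> 0"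
        using line_nonzero_iff[of d f v] line_nonzero_iff[of e g v] 1 2 v(2) by auto
      then have "f v * g v \<noteq> 0" by simp
      moreover have "(\<lambda>x. f x * g x) \<in> H" using 1 2 by (auto simp: H_def)
      ultimately have "\<exists>h\<in>H. h v \<noteq> 0" by (rule rev_bexI[rotated])
      then show "L \<in> nonzero_locus H"
        unfolding nonzero_locus_alt[OF H] using v by (intro CollectI exI[of _ v]) simp
    next
      fix L assume "L \<in> nonzero_locus H"
      then obtain f g x where "L \<in> proj UNIV" "f \<in> F" "g \<in> G" "x \<in> L" "f x \<noteq> 0" "g x \<noteq> 0"
        by (auto simp: nonzero_locus_def H_def)
      then show "L \<in> S \<inter> T" unfolding S T nonzero_locus_def by blast
    qed
    with H show ?thesis by blast
  qed
  have union: "\<exists>F. (\<forall>f\<in>F. \<exists>d. hom_poly d f) \<and> \<Union>\<K> = nonzero_locus F"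
    if "\<forall>K\<in>\<K>. \<exists>F. (\<forall>f\<in>F. \<exists>d. hom_poly d f) \<and> K = nonzero_locus F"
    for \<K> :: "'v set set set"
  proof -
    from bchoice[OF that] obtain F
      where F: "\<forall>K\<in>\<K>. (\<forall>f\<in>F K. \<exists>d. hom_poly d f) \<and> K = nonzero_locus (F K)" ..
    have "\<Union>\<K> = (\<Union>K\<in>\<K>. nonzero_locus (F K))" using F by auto
    also have "\<dots> = nonzero_locus (\<Union>K\<in>\<K>. F K)" unfolding nonzero_locus_def by auto
    finally have "\<Union>\<K> = nonzero_locus (\<Union>K\<in>\<K>. F K)" .
    moreover have "\<forall>f\<in>(\<Union>K\<in>\<K>. F K). \<exists>d. hom_poly d f" using F by blast
    ultimately show ?thesis by blast
  qed
  show ?thesis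
    unfolding istopology_def
  proof (intro conjI allI impI, goal_cases)
    case (1 S T)
    then show ?case by (elim exE conjE) (rule inter)
  next
    case (2 K)
    then show ?case by (rule union)
  qed
qed

lemma openin_zariski:
  "openin zariski U \<longleftrightarrow> (\<exists>F. (\<forall>f\<in>F. \<exists>d. hom_poly d f) \<and> U = nonzero_locus F)"
  unfolding zariski_def by (subst topology_inverse'[OF istopology_zariski]) (rule refl)

lemma topspace_zariski: "topspace (zariski :: 'v::complex_vector set topology) = proj UNIV"
proof -
  have "openin zariski (nonzero_locus {\<lambda>x::'v. 1})"
    unfolding openin_zariski using hom_poly.const by blast
  moreover have "nonzero_locus {\<lambda>x::'v. 1} = proj UNIV"
    by (auto simp: nonzero_locus_def proj_def intro: cvec.span_base)
  moreover have "U \<subseteq> proj UNIV" if "openin zariski U" for U :: "'v set set"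
    using that by (auto simp: openin_zariski nonzero_locus_def)
  ultimately show ?thesis unfolding topspace_def by fastforce
qed

definition irreducible_space :: "'a topology \<Rightarrow> bool" where
  "irreducible_space X \<longleftrightarrow> topspace X \<noteq> {} \<and>
     (\<forall>A B. closedin X A \<and> closedin X B \<and> topspace X = A \<union> B \<longrightarrow> A = topspace X \<or> B = topspace X)"

definition irreducible_chain :: "'a topology \<Rightarrow> nat \<Rightarrow> (nat \<Rightarrow> 'a set) \<Rightarrow> bool" where
  "irreducible_chain X m Z \<longleftrightarrow>
     (\<forall>i\<le>m. closedin X (Z i) \<and> irreducible_space (subtopology X (Z i))) \<and> (\<forall>i<m. Z i \<subset> Z (Suc i))"

definition has_krull_dim :: "'a topology \<Rightarrow> nat \<Rightarrow> bool" where
  "has_krull_dim X m \<longleftrightarrow> (\<exists>Z. irreducible_chain X m Z) \<and> (\<forall>k Z. irreducible_chain X k Z \<longrightarrow> k \<le> m)"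


section \<open>Smooth projective curves\<close>

text \<open>Curves are embedded in some projective space \<open>\<complex>P\<^sup>n\<close>, with homogeneous coordinates indexed by a
  finite type of \<open>n + 1\<close> elements.\<close>

type_synonym 'n pt = "(complex ^ 'n) set"

abbreviation zariski_on :: "'n pt set \<Rightarrow> 'n::finite pt topology" where
  "zariski_on C \<equiv> subtopology zariski C"

definition vanishing_poly :: "'n::finite pt set \<Rightarrow> nat \<Rightarrow> (complex ^ 'n \<Rightarrow> complex) \<Rightarrow> bool" where
  "vanishing_poly C d f \<longleftrightarrow> hom_poly d f \<and> (\<forall>q\<in>C. \<forall>x\<in>q. f x = 0)"

text \<open>The kernel of the Jacobian matrix at \<open>x\<close>: the tangent space at \<open>x\<close> of the affine cone over \<open>C\<close>.\<close>

definition cone_tangent_space :: "'n::finite pt set \<Rightarrow> complex ^ 'n \<Rightarrow> (complex ^ 'n) set" where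
  "cone_tangent_space C x = {v. \<forall>d f. vanishing_poly C d f \<longrightarrow>
     ((\<lambda>t::complex. f (x + t *\<^sub>C v)) has_field_derivative 0) (at 0)}"

text \<open>The Jacobian criterion; the affine cone over a curve has dimension 2.\<close>

definition smooth_projective_curve :: "'n::finite pt set \<Rightarrow> bool" where
  "smooth_projective_curve C \<longleftrightarrow>
     closedin zariski C \<and> irreducible_space (zariski_on C) \<and> has_krull_dim (zariski_on C) 1 \<and>
     (\<forall>x. x \<noteq> 0 \<and> cvec.span {x} \<in> C \<longrightarrow> cvec.dim (cone_tangent_space C x) = 2)"

definition regular_at :: "'n::finite pt set \<Rightarrow> 'n pt \<Rightarrow> ('n pt \<Rightarrow> complex) \<Rightarrow> bool" where
  "regular_at C p f \<longleftrightarrow> (\<exists>U d F G. openin (zariski_on C) U \<and> p \<in> U \<and> hom_poly d F \<and> hom_poly d G \<and>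
     (\<forall>q\<in>U. \<forall>x\<in>q - {0}. G x \<noteq> 0 \<and> f q = F x / G x))"

text \<open>A nonzero rational function is represented by any function that is regular on a nonempty open
  set and not identically zero there; its values at the remaining points are irrelevant.\<close>

definition nonzero_rational :: "'n::finite pt set \<Rightarrow> ('n pt \<Rightarrow> complex) \<Rightarrow> bool" where
  "nonzero_rational C f \<longleftrightarrow> (\<exists>U. openin (zariski_on C) U \<and> (\<forall>p\<in>U. regular_at C p f) \<and> (\<exists>p\<in>U. f p \<noteq> 0))"

text \<open>A generator of the maximal ideal of the local ring at \<open>p\<close>, a discrete valuation ring for smooth \<open>C\<close>.
  For nonzero rational \<open>f\<close>, the order \<open>n\<close> is determined by \<open>f = t\<^sup>n u\<close> with a unit \<open>u\<close>.\<close>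

definition uniformizer :: "'n::finite pt set \<Rightarrow> 'n pt \<Rightarrow> ('n pt \<Rightarrow> complex) \<Rightarrow> bool" where
  "uniformizer C p t \<longleftrightarrow> regular_at C p t \<and> t p = 0 \<and>
     (\<forall>h. regular_at C p h \<and> h p = 0 \<longrightarrow>
        (\<exists>k. regular_at C p k \<and> (\<forall>\<^sub>F q in nhdsin (zariski_on C) p. h q = t q * k q)))"

definition ord_at :: "'n::finite pt set \<Rightarrow> 'n pt \<Rightarrow> ('n pt \<Rightarrow> complex) \<Rightarrow> int" where
  "ord_at C p f = (THE n. \<exists>t u. uniformizer C p t \<and> regular_at C p u \<and> u p \<noteq> 0 \<and>
     (\<forall>\<^sub>F q in atin (zariski_on C) p. f q = t q powi n * u q))"

definition divisors :: "'n::finite pt set \<Rightarrow> ('n pt \<Rightarrow>\<^sub>0 int) set" where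
  "divisors C = {D. Poly_Mapping.keys D \<subseteq> C}"

definition deg :: "('n::finite pt \<Rightarrow>\<^sub>0 int) \<Rightarrow> int" where
  "deg D = (\<Sum>p\<in>Poly_Mapping.keys D. Poly_Mapping.lookup D p)"

definition lin_equiv :: "'n::finite pt set \<Rightarrow> ('n pt \<Rightarrow>\<^sub>0 int) \<Rightarrow> ('n pt \<Rightarrow>\<^sub>0 int) \<Rightarrow> bool" where
  "lin_equiv C D D' \<longleftrightarrow> (\<exists>f. nonzero_rational C f \<and>
     (\<forall>p\<in>C. Poly_Mapping.lookup (D - D') p = ord_at C p f))"

text \<open>The global sections of \<open>\<O>\<^sub>C(D)\<close>. They are regular on the open set where \<open>D \<le> 0\<close>, so each of them is
  represented by a unique function that is regular there and is set to \<open>0\<close> everywhere else. In this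
  way \<open>H\<^sup>0(C, \<O>\<^sub>C(D))\<close> is a space of functions with pointwise operations.\<close>

definition sections :: "'n::finite pt set \<Rightarrow> ('n pt \<Rightarrow>\<^sub>0 int) \<Rightarrow> ('n pt \<Rightarrow> complex) set" where
  "sections C D = {f.
     (\<forall>p. p \<notin> C \<or> Poly_Mapping.lookup D p > 0 \<longrightarrow> f p = 0) \<and>
     (\<forall>p\<in>C. Poly_Mapping.lookup D p \<le> 0 \<longrightarrow> regular_at C p f) \<and>
     (f = 0 \<or> (\<forall>p\<in>C. ord_at C p f \<ge> - Poly_Mapping.lookup D p))}"

text \<open>The genus as in the theorem of Riemann: the least \<open>g\<close> with \<open>dim H\<^sup>0(C, \<O>\<^sub>C(D)) \<ge> deg D + 1 - g\<close> for all \<open>D\<close>.\<close>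

definition has_genus :: "'n::finite pt set \<Rightarrow> int \<Rightarrow> bool" where
  "has_genus C g \<longleftrightarrow>
     (\<forall>D\<in>divisors C. int (cvec.dim (sections C D)) \<ge> deg D + 1 - g) \<and>
     (\<exists>D\<in>divisors C. int (cvec.dim (sections C D)) = deg D + 1 - g)"

definition elliptic_curve :: "'n::finite pt set \<Rightarrow> bool" where
  "elliptic_curve C \<longleftrightarrow> smooth_projective_curve C \<and> has_genus C 1"


section \<open>Exterior squares and the second determinant map\<close>

text \<open>A bivector is represented by the alternating bilinear form it induces on the dual space; this
  embeds the exterior square of a vector space into a space of functions.\<close>

type_synonym 'v bivector = "('v \<Rightarrow> complex) \<times> ('v \<Rightarrow> complex) \<Rightarrow> complex"

definition wedge :: "'v::complex_vector \<Rightarrow> 'v \<Rightarrow> 'v bivector" where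
  "wedge s t = (\<lambda>(\<phi>, \<psi>). if clinear \<phi> \<and> clinear \<psi> then \<phi> s * \<psi> t - \<phi> t * \<psi> s else 0)"

definition exterior_square :: "'v::complex_vector set \<Rightarrow> 'v bivector set" where
  "exterior_square V = cvec.span {wedge s t | s t. s \<in> V \<and> t \<in> V}"

text \<open>The Pluecker point of the two-dimensional subspace with basis \<open>s\<close>, \<open>t\<close> is the line spanned by
  \<open>s \<and> t\<close>.\<close>

definition Gr2 :: "'v::complex_vector set \<Rightarrow> 'v bivector set set" where
  "Gr2 V = {cvec.span {wedge s t} | s t. s \<in> V \<and> t \<in> V \<and> s \<noteq> t \<and> cvec.independent {s, t}}"

text \<open>The global sections of \<open>E = \<O>\<^sub>C(D\<^sub>1) \<oplus> \<O>\<^sub>C(D\<^sub>2)\<close>. In the fibre over \<open>q\<close>, \<open>s(q) \<and> t(q)\<close> is the determinant of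
  the components, so that \<open>d\<^sub>2\<close> evaluates a bivector at the two coordinate functionals over \<open>q\<close>; see
  \<open>second_det_wedge\<close> below.
  For effective \<open>D\<^sub>1\<close>, \<open>D\<^sub>2\<close> the result satisfies the normalisation used in \<^const>\<open>sections\<close> for the line
  bundle \<open>\<O>\<^sub>C(D\<^sub>1 + D\<^sub>2)\<close>, the exterior square of \<open>E\<close>.\<close>

definition sections2 ::
  "'n::finite pt set \<Rightarrow> ('n pt \<Rightarrow>\<^sub>0 int) \<Rightarrow> ('n pt \<Rightarrow>\<^sub>0 int) \<Rightarrow>
     (('n pt \<Rightarrow> complex) \<times> ('n pt \<Rightarrow> complex)) set" where
  "sections2 C D1 D2 = sections C D1 \<times> sections C D2"

definition second_det :: "(('a \<Rightarrow> complex) \<times> ('a \<Rightarrow> complex)) bivector \<Rightarrow> 'a \<Rightarrow> complex" where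
  "second_det \<omega> = (\<lambda>q. \<omega> (\<lambda>s. fst s q, \<lambda>s. snd s q))"

lemma second_det_linear: "clinear second_det"
  by (rule Vector_Spaces.linear_iff[THEN iffD2])
    (auto simp: second_det_def scaleC_fun_def fun_eq_iff cvec.vector_space_axioms)

lemma second_det_wedge: "second_det (wedge s t) = fst s * snd t - fst t * snd s"
proof -
  have "clinear (\<lambda>s::('a \<Rightarrow> complex) \<times> ('a \<Rightarrow> complex). fst s q)"
    and "clinear (\<lambda>s::('a \<Rightarrow> complex) \<times> ('a \<Rightarrow> complex). snd s q)" for q
    by (auto simp: Vector_Spaces.linear_iff scaleC_prod_def scaleC_fun_def cvec.vector_space_axioms)
  then show ?thesis by (simp add: second_det_def wedge_def fun_eq_iff)
qed

text \<open>\<open>\<^bold>G(E)\<close>, for \<open>E = \<O>\<^sub>C(D\<^sub>1) \<oplus> \<O>\<^sub>C(D\<^sub>2)\<close>.\<close>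

definition rank_one_pencils ::
  "'n::finite pt set \<Rightarrow> ('n pt \<Rightarrow>\<^sub>0 int) \<Rightarrow> ('n pt \<Rightarrow>\<^sub>0 int) \<Rightarrow>
     (('n pt \<Rightarrow> complex) \<times> ('n pt \<Rightarrow> complex)) bivector set set" where
  "rank_one_pencils C D1 D2 = Gr2 (sections2 C D1 D2) \<inter>
     proj {\<omega> \<in> exterior_square (sections2 C D1 D2). second_det \<omega> = 0}"

end

theory Submission
  imports Defs "Jordan_Normal_Form.Determinant"
begin

text \<open>The components of a pencil \<open>\<langle>(s\<^sub>1, s\<^sub>2), (t\<^sub>1, t\<^sub>2)\<rangle>\<close> in \<open>\<^bold>G(E)\<close> have a common ratio
  \<open>\<psi> = s\<^sub>1/s\<^sub>2 = t\<^sub>1/t\<^sub>2\<close>. If \<open>s\<^sub>2\<close>, \<open>t\<^sub>2\<close> generate \<open>\<O>(bQ)\<close>, then \<open>\<psi>\<close> is a section of \<open>\<O>(aP - bQ)\<close>. Hence \<open>\<psi> = 0\<close>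
  unless \<open>a = b\<close> and \<open>aP \<sim> aQ\<close>, and in the latter case \<open>\<psi>\<close> is constant after identifying the two line
  bundles. A resultant \<open>F\<close> vanishes on the pencils for which \<open>s\<^sub>2\<close>, \<open>t\<^sub>2\<close> have a common zero, and another form
  \<open>H\<close> vanishes on those with \<open>\<psi> = 0\<close>, respectively \<open>\<psi>\<close> constant. So \<open>FH = 0\<close> on \<open>\<^bold>G(E)\<close>, which is therefore
  reducible if neither \<open>F\<close> nor \<open>H\<close> vanishes on all of it. The only exception is \<open>aP \<sim> aQ\<close> with \<open>a = b \<le> 3\<close>:
  by Riemann--Roch a nonconstant \<open>\<psi>\<close> would need common zeros of total degree at least \<open>2\<close>, which leaves only
  a space of sections of dimension at most \<open>1\<close>. Then \<open>\<^bold>G(E)\<close> is parametrised by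
  \<open>((\<lambda>, \<mu>), u, w) \<mapsto> (\<lambda>u, \<mu>u) \<and> (\<lambda>w, \<mu>w)\<close>, and restricting forms to lines of parameters shows that it is
  irreducible. Riemann--Roch itself is extracted from the definition of the genus, which
  also yields the existence of uniformizers.\<close>

no_notation vec_index (infixl "$" 100)

section \<open>Noetherian rings of functions\<close>

text \<open>Dimensions and orders carry default values: \<open>cvec.dim\<close> is 0 for a space
  without a finite basis, and \<open>ord_at\<close> is one fixed value at a point without
  uniformizers. Riemann's inequality rules out both, since it makes dimensions positive and
  unbounded. Noetherian rings serve two purposes: proper closed subsets of the curve become finite,
  so that functions can be compared outside finite sets, and nonzero functions have finite order.
  The resultant is not written as a Sylvester matrix. If two sections of \<open>\<O>(b Q)\<close>
  have no common zero, their products with sections of \<open>\<O>((b + 1) Q)\<close> span the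
  sections of \<open>\<O>((2 b + 1) Q)\<close>; \<open>b + 1\<close> is the least multiplier degree
  for which this happens. A determinant of coordinates of such products, written in contractions of
  the bivector, is the form \<open>F\<close>. The bound between 3 and 4 comes from a function
  \<open>x\<close> with a double pole at \<open>P\<close>: the sections \<open>(1, x)\<close> and
  \<open>(x, x^2)\<close>, with second components moved to \<open>\<O>(a Q)\<close>, have ratio
  \<open>1/x\<close>, and \<open>x^2\<close> has pole order 4.\<close>

inductive_set gen_ideal :: "'a::comm_ring_1 set \<Rightarrow> 'a set \<Rightarrow> 'a set" for R X where
  zero: "0 \<in> gen_ideal R X"
| step: "r \<in> R \<Longrightarrow> x \<in> X \<Longrightarrow> y \<in> gen_ideal R X \<Longrightarrow> r * x + y \<in> gen_ideal R X"

definition is_subring :: "'a::comm_ring_1 set \<Rightarrow> bool" where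
  "is_subring R \<longleftrightarrow> 0 \<in> R \<and> 1 \<in> R \<and> (\<forall>x\<in>R. -x \<in> R) \<and> (\<forall>x\<in>R. \<forall>y\<in>R. x + y \<in> R \<and> x * y \<in> R)"

text \<open>Finite generation of ideals in the form used later: no sequence keeps leaving the ideal
  of its earlier terms. Rings are subsets of a type, so that adjoining a generator stays inside the
  type and can be iterated.\<close>

definition noeth_ring :: "'a::comm_ring_1 set \<Rightarrow> bool" where
  "noeth_ring R \<longleftrightarrow> (\<forall>f::nat \<Rightarrow> 'a. range f \<subseteq> R \<longrightarrow> (\<exists>n. f n \<in> gen_ideal R (f ` {..<n})))"

lemma is_subringD:
  assumes "is_subring R"
  shows "0 \<in> R" "1 \<in> R" "x \<in> R \<Longrightarrow> -x \<in> R" "x \<in> R \<Longrightarrow> y \<in> R \<Longrightarrow> x + y \<in> R"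
    "x \<in> R \<Longrightarrow> y \<in> R \<Longrightarrow> x * y \<in> R"
  using assms by (auto simp: is_subring_def)

lemma is_subring_sum:
  assumes "is_subring R" "\<And>i. i \<in> A \<Longrightarrow> f i \<in> R"
  shows "sum f A \<in> R"
  using assms(2) by (induction A rule: infinite_finite_induct) (auto simp: is_subringD[OF assms(1)])

lemma is_subring_power:
  assumes "is_subring R" "x \<in> R"
  shows "x ^ n \<in> R"
  by (induction n) (auto simp: is_subringD[OF assms(1)] assms(2))

lemma gen_ideal_add:
  assumes "x \<in> gen_ideal R X" "y \<in> gen_ideal R X"
  shows "x + y \<in> gen_ideal R X"
  using assms by induction (auto simp: add.assoc intro: gen_ideal.step)

lemma gen_ideal_mult:
  assumes "is_subring R" "x \<in> gen_ideal R X" "r \<in> R"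
  shows "r * x \<in> gen_ideal R X"
  using assms(2)
proof induction
  case (step s x y)
  have "(r * s) * x + r * y \<in> gen_ideal R X"
    using step assms by (intro gen_ideal.step) (auto simp: is_subringD)
  then show ?case by (simp add: algebra_simps)
qed (auto intro: gen_ideal.zero)

lemma gen_ideal_uminus:
  assumes "is_subring R" "x \<in> gen_ideal R X"
  shows "- x \<in> gen_ideal R X"
  using gen_ideal_mult[OF assms, of "-1"] by (simp add: is_subringD[OF assms(1)])

lemma gen_ideal_base:
  assumes "is_subring R" "x \<in> X"
  shows "x \<in> gen_ideal R X"
  using gen_ideal.step[of 1 R x X 0] assms by (auto simp: is_subringD intro: gen_ideal.zero)

lemma gen_ideal_least:
  assumes "is_subring R" "X \<subseteq> gen_ideal R Y"
  shows "gen_ideal R X \<subseteq> gen_ideal R Y"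
proof
  fix x assume "x \<in> gen_ideal R X"
  then show "x \<in> gen_ideal R Y"
    by induction (use assms in \<open>auto intro: gen_ideal.zero gen_ideal_add gen_ideal_mult\<close>)
qed

lemma gen_ideal_mono: "is_subring R \<Longrightarrow> X \<subseteq> Y \<Longrightarrow> gen_ideal R X \<subseteq> gen_ideal R Y"
  by (rule gen_ideal_least) (auto intro: gen_ideal_base)

lemma gen_ideal_sequence:
  assumes R: "is_subring R" and x: "x \<in> gen_ideal R (range (f :: nat \<Rightarrow> 'a::comm_ring_1))"
  shows "\<exists>n. x \<in> gen_ideal R (f ` {..<n})"
  using x
proof induction
  case (step r x y)
  then obtain n m where n: "y \<in> gen_ideal R (f ` {..<n})" and m: "x = f m" by auto
  have "y \<in> gen_ideal R (f ` {..<max n (Suc m)})"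
    using n gen_ideal_mono[OF R, of "f ` {..<n}" "f ` {..<max n (Suc m)}"] by fastforce
  then have "r * x + y \<in> gen_ideal R (f ` {..<max n (Suc m)})"
    using step m by (intro gen_ideal.step) auto
  then show ?case ..
qed (auto intro: gen_ideal.zero)

text \<open>The leading coefficient argument for \<open>S = R[g]\<close>, which is only a quotient
  of the polynomial ring: degrees belong to representing polynomials, while membership in ideals is
  tested on the values at \<open>g\<close>.\<close>

theorem hilbert_basis:
  fixes g :: "'a::comm_ring_1"
  assumes R: "is_subring R" and noeth: "noeth_ring R" and S: "is_subring S"
    and S_eq: "S = {poly p g | p. \<forall>i. coeff p i \<in> R}"
  shows "noeth_ring S"
  unfolding noeth_ring_def
proof (intro allI impI, rule ccontr)
  fix f :: "nat \<Rightarrow> 'a"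
  assume f: "range f \<subseteq> S" and bad: "\<nexists>n. f n \<in> gen_ideal S (f ` {..<n})"
  define J where "J = gen_ideal S (range f)"
  have not_fg: "\<exists>h\<in>J. h \<notin> gen_ideal S X" if X: "finite X" "X \<subseteq> J" for X
  proof -
    have "\<forall>x\<in>X. \<exists>n. x \<in> gen_ideal S (f ` {..<n})"
      using X gen_ideal_sequence[OF S] by (auto simp: J_def)
    then obtain n where n: "\<And>x. x \<in> X \<Longrightarrow> x \<in> gen_ideal S (f ` {..<n x})" by metis
    obtain N where N: "\<forall>x\<in>X. n x \<le> N"
      using finite_nat_set_iff_bounded_le[of "n ` X"] X by auto
    have "X \<subseteq> gen_ideal S (f ` {..<N})"
    proof
      fix x assume "x \<in> X"
      then show "x \<in> gen_ideal S (f ` {..<N})"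
        using n[of x] N gen_ideal_mono[OF S, of "f ` {..<n x}" "f ` {..<N}"] by fastforce
    qed
    then have "gen_ideal S X \<subseteq> gen_ideal S (f ` {..<N})" by (rule gen_ideal_least[OF S])
    then have "f N \<notin> gen_ideal S X" using bad by auto
    moreover have "f N \<in> J" unfolding J_def by (rule gen_ideal_base[OF S]) simp
    ultimately show ?thesis by blast
  qed
  \<comment> \<open>\<open>F n\<close> is to have least degree among the polynomials whose value
    lies in \<open>J\<close> but outside the ideal of the values chosen before.\<close>
  define ok where "ok F n p \<longleftrightarrow> (\<forall>i. coeff p i \<in> R) \<and>
      poly p g \<in> J - gen_ideal S ((\<lambda>i. poly (F i) g) ` {..<n})" for F :: "nat \<Rightarrow> 'a poly" and n :: nat and p
  define good where "good F n p \<longleftrightarrow> ok F n p \<and> (\<forall>q. ok F n q \<longrightarrow> degree p \<le> degree q)" for F n p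
  have "\<exists>F. \<forall>n. good F n (F n)"
  proof (rule dependent_wellorder_choice)
    fix p F G and n :: nat assume "\<And>m. m < n \<Longrightarrow> F m = (G m :: 'a poly)"
    then have "(\<lambda>i. poly (F i) g) ` {..<n} = (\<lambda>i. poly (G i) g) ` {..<n}" by auto
    then show "good F n p = good G n p" unfolding good_def ok_def by simp
  next
    fix n :: nat and F assume *: "\<And>m. m < n \<Longrightarrow> good F m (F m)"
    have "(\<lambda>i. poly (F i) g) ` {..<n} \<subseteq> J" using * by (auto simp: good_def ok_def)
    from not_fg[OF _ this] obtain h where h: "h \<in> J" "h \<notin> gen_ideal S ((\<lambda>i. poly (F i) g) ` {..<n})"
      by auto
    have "J \<subseteq> S"
    proof
      fix x assume "x \<in> J"
      then show "x \<in> S" unfolding J_def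
        by induction (use f in \<open>auto simp: is_subringD[OF S]\<close>)
    qed
    then obtain p where "ok F n p" using h S_eq by (auto simp: ok_def)
    from ex_has_least_nat[of "ok F n", OF this] obtain q
      where "ok F n q" "\<forall>r. ok F n r \<longrightarrow> degree q \<le> degree r" by blast
    then show "\<exists>p. good F n p" unfolding good_def by blast
  qed
  then obtain F where good: "\<And>n. good F n (F n)" by blast
  define I where "I n = gen_ideal S ((\<lambda>i. poly (F i) g) ` {..<n})" for n
  have FR: "coeff (F n) i \<in> R" and FJ: "poly (F n) g \<in> J" and FI: "poly (F n) g \<notin> I n" for n i
    using good[of n] by (auto simp: good_def ok_def I_def)
  have I_mono: "I m \<subseteq> I n" if "m \<le> n" for m n
    unfolding I_def by (rule gen_ideal_mono[OF S]) (use that in auto)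
  have min: "degree (F n) \<le> degree q" if "\<forall>i. coeff q i \<in> R" "poly q g \<in> J" "poly q g \<notin> I n" for n q
    using good[of n] that by (auto simp: good_def ok_def I_def)
  have deg_mono: "degree (F m) \<le> degree (F n)" if "m \<le> n" for m n
    using min[of "F n" m] FR FJ FI I_mono[OF that] by blast
  obtain n where n: "lead_coeff (F n) \<in> gen_ideal R ((\<lambda>i. lead_coeff (F i)) ` {..<n})"
    using noeth FR unfolding noeth_ring_def
    by (metis (no_types, lifting) image_subset_iff)
  define d where "d = degree (F n)"
  \<comment> \<open>A combination of the earlier leading coefficients lifts to a value in
    \<open>I n\<close>: each \<open>F i\<close> is multiplied by the power of the variable that
    brings it to degree \<open>d\<close>, which exists because the degrees increase.\<close>
  have "\<exists>q. (\<forall>i. coeff q i \<in> R) \<and> poly q g \<in> I n \<and> degree q \<le> d \<and> coeff q d = y"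
    if "y \<in> gen_ideal R ((\<lambda>i. lead_coeff (F i)) ` {..<n})" for y
    using that
  proof induction
    case zero
    show ?case by (rule exI[of _ 0]) (auto simp: is_subringD[OF R] I_def intro: gen_ideal.zero)
  next
    case (step r x y)
    then obtain q i where q: "\<forall>i. coeff q i \<in> R" "poly q g \<in> I n" "degree q \<le> d" "coeff q d = y"
      and i: "i < n" "x = lead_coeff (F i)" by auto
    define k where "k = d - degree (F i)"
    have k: "k + degree (F i) = d" using deg_mono[of i n] i by (simp add: k_def d_def)
    define m where "m = monom r k * F i"
    have mR: "\<forall>j. coeff m j \<in> R"
      using step FR by (auto simp: m_def coeff_monom_mult is_subringD[OF R])
    have "degree m \<le> d"
      using degree_mult_le[of "monom r k" "F i"] degree_monom_le[of r k] k by (simp add: m_def)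
    moreover have "coeff m d = r * x" using k i by (auto simp: m_def coeff_monom_mult k_def)
    moreover have "poly m g \<in> I n"
    proof -
      have "poly (monom r k) g \<in> S"
        unfolding S_eq using step by (auto simp: is_subringD[OF R] intro!: exI[of _ "monom r k"])
      then have "poly (monom r k) g * poly (F i) g \<in> I n" unfolding I_def
        by (intro gen_ideal_mult[OF S] gen_ideal_base[OF S]) (use i in auto)
      then show ?thesis by (simp add: m_def)
    qed
    ultimately show ?case
      using q mR by (intro exI[of _ "m + q"])
        (auto simp: is_subringD[OF R] degree_add_le I_def intro: gen_ideal_add)
  qed
  from this[OF n] obtain q where q: "\<forall>i. coeff q i \<in> R" "poly q g \<in> I n" "degree q \<le> d"
    "coeff q d = lead_coeff (F n)" by blast
  \<comment> \<open>The difference loses the leading term but stays outside \<open>I n\<close>,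
    against the minimality of the degree.\<close>
  define p where "p = F n - q"
  have "I n \<subseteq> J" unfolding I_def J_def
    by (rule gen_ideal_least[OF S]) (use FJ in \<open>auto simp: J_def\<close>)
  have neg: "- poly q g \<in> J" "- poly q g \<in> I n"
    using q(2) gen_ideal_uminus[OF S, of "poly q g" "(\<lambda>i. poly (F i) g) ` {..<n}"] \<open>I n \<subseteq> J\<close>
    by (auto simp: I_def)
  have pR: "\<forall>i. coeff p i \<in> R"
    using FR q is_subringD(3,4)[OF R] unfolding p_def coeff_diff by (metis diff_conv_add_uminus)
  have pJ: "poly p g \<in> J"
    using gen_ideal_add[of "poly (F n) g" S _ "- poly q g"] FJ neg by (simp add: p_def J_def)
  have pI: "poly p g \<notin> I n"
  proof
    assume "poly p g \<in> I n"
    then have "poly p g + poly q g \<in> I n" using q(2) unfolding I_def by (rule gen_ideal_add)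
    then show False using FI[of n] by (simp add: p_def)
  qed
  \<comment> \<open>Needed for \<open>d = 0\<close>, where a vanishing top coefficient does not
    lower the degree.\<close>
  have "p \<noteq> 0" using pI by (auto simp: I_def intro: gen_ideal.zero)
  moreover have "degree p \<le> d" using q(3) by (auto simp: p_def d_def intro: degree_diff_le)
  moreover have "coeff p d = 0" using q(4) by (simp add: p_def d_def)
  ultimately have "degree p < d"
    by (metis le_neq_implies_less leading_coeff_0_iff)
  then show False using min[OF pR pJ pI] by (simp add: d_def)
qed

section \<open>Finitely generated algebras of functions\<close>

inductive_set fun_alg :: "('x \<Rightarrow> complex) set \<Rightarrow> ('x \<Rightarrow> complex) set" for X where
  const: "(\<lambda>_. c) \<in> fun_alg X"
| gen: "f \<in> X \<Longrightarrow> f \<in> fun_alg X"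
| add: "f \<in> fun_alg X \<Longrightarrow> g \<in> fun_alg X \<Longrightarrow> (\<lambda>x. f x + g x) \<in> fun_alg X"
| mult: "f \<in> fun_alg X \<Longrightarrow> g \<in> fun_alg X \<Longrightarrow> (\<lambda>x. f x * g x) \<in> fun_alg X"

lemma fun_alg_sum:
  assumes "finite A" "\<And>i. i \<in> A \<Longrightarrow> f i \<in> fun_alg X"
  shows "(\<lambda>x. \<Sum>i\<in>A. f i x) \<in> fun_alg X"
  using assms by (induction A rule: finite_induct) (auto intro: fun_alg.intros)

lemma is_subring_fun_alg: "is_subring (fun_alg X)"
  unfolding is_subring_def
proof (intro conjI ballI)
  show "0 \<in> fun_alg X" "1 \<in> fun_alg X"
    using fun_alg.const[of 0 X] fun_alg.const[of 1 X] by (auto simp: zero_fun_def one_fun_def)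
  fix f assume f: "f \<in> fun_alg X"
  show "- f \<in> fun_alg X"
    using fun_alg.mult[OF fun_alg.const[of "-1"] f] by (simp add: fun_Compl_def)
  fix g assume "g \<in> fun_alg X"
  then show "f + g \<in> fun_alg X" "f * g \<in> fun_alg X"
    using fun_alg.add[OF f, of g] fun_alg.mult[OF f, of g] by (auto simp: plus_fun_def times_fun_def)
qed

lemma fun_alg_mono: "X \<subseteq> Y \<Longrightarrow> fun_alg X \<subseteq> fun_alg Y"
proof
  fix f assume "X \<subseteq> Y" and "f \<in> fun_alg X"
  from this(2,1) show "f \<in> fun_alg Y" by induction (auto intro: fun_alg.intros)
qed

text \<open>Generators are adjoined one at a time, starting from the constants. These form a field,
  so in any sequence the first term either is 0 or generates the second.\<close>

theorem noeth_fun_alg: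
  assumes "finite (X :: ('x \<Rightarrow> complex) set)"
  shows "noeth_ring (fun_alg X)"
  using assms
proof (induction X rule: finite_induct)
  case empty
  have alg: "\<exists>c. f = (\<lambda>_. c)" if "f \<in> fun_alg {}" for f :: "'x \<Rightarrow> complex"
    using that by induction auto
  show ?case unfolding noeth_ring_def
  proof (intro allI impI)
    fix f :: "nat \<Rightarrow> 'x \<Rightarrow> complex" assume f: "range f \<subseteq> fun_alg {}"
    then have "f 0 \<in> fun_alg {}" "f 1 \<in> fun_alg {}" by blast+
    then obtain c c' where c: "f 0 = (\<lambda>_. c)" "f 1 = (\<lambda>_. c')"
      using alg by metis
    show "\<exists>n. f n \<in> gen_ideal (fun_alg {}) (f ` {..<n})"
    proof (cases "c = 0")
      case True
      then have "f 0 = 0" using c by (simp add: zero_fun_def)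
      then show ?thesis by (intro exI[of _ 0]) (auto intro: gen_ideal.zero)
    next
      case False
      then have "f 1 = (\<lambda>_. c' / c) * f 0 + 0" using c by (auto simp: fun_eq_iff)
      moreover have "(\<lambda>_. c' / c) * f 0 + 0 \<in> gen_ideal (fun_alg {}) (f ` {..<1})"
        by (intro gen_ideal.intros fun_alg.const) auto
      ultimately show ?thesis by metis
    qed
  qed
next
  case (insert g X)
  let ?S = "{poly p g | p. \<forall>i. coeff p i \<in> fun_alg X}"
  note R = is_subring_fun_alg[of X]
  have "fun_alg (insert g X) = ?S"
  proof (intro equalityI subsetI)
    fix f assume "f \<in> fun_alg (insert g X)"
    then show "f \<in> ?S"
    proof induction
      case (const c)
      show ?case
        by (intro CollectI exI[of _ "[:\<lambda>_. c:]"])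
          (auto simp: coeff_pCons is_subringD[OF R] fun_alg.const split: nat.split)
    next
      case (gen f)
      have "g = poly [:0, 1:] g" "f = poly [:f:] g" by auto
      moreover have "\<forall>i. coeff [:0, 1:] i \<in> fun_alg X"
        by (auto simp: coeff_pCons is_subringD[OF R] split: nat.split)
      moreover have "\<forall>i. coeff [:f:] i \<in> fun_alg X" if "f \<in> X"
        using that by (auto simp: coeff_pCons is_subringD[OF R] fun_alg.gen split: nat.split)
      ultimately show ?case using gen by (cases "f = g") blast+
    next
      case (add f h)
      then obtain p q where p: "f = poly p g" "\<forall>i. coeff p i \<in> fun_alg X"
        and q: "h = poly q g" "\<forall>i. coeff q i \<in> fun_alg X" by auto
      then have "(\<lambda>x. f x + h x) = poly (p + q) g" by (auto simp: fun_eq_iff)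
      moreover have "\<forall>i. coeff (p + q) i \<in> fun_alg X" using p q by (auto simp: is_subringD[OF R])
      ultimately show ?case by blast
    next
      case (mult f h)
      then obtain p q where p: "f = poly p g" "\<forall>i. coeff p i \<in> fun_alg X"
        and q: "h = poly q g" "\<forall>i. coeff q i \<in> fun_alg X" by auto
      then have "(\<lambda>x. f x * h x) = poly (p * q) g" by (auto simp: fun_eq_iff)
      moreover have "\<forall>i. coeff (p * q) i \<in> fun_alg X"
        using p q by (auto simp: coeff_mult is_subringD[OF R] intro!: is_subring_sum[OF R])
      ultimately show ?case by blast
    qed
  next
    fix f assume "f \<in> ?S"
    then obtain p where p: "f = poly p g" "\<forall>i. coeff p i \<in> fun_alg X" by auto
    have "g \<in> fun_alg (insert g X)" by (rule fun_alg.gen) simp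
    moreover have "coeff p i \<in> fun_alg (insert g X)" for i
      using p fun_alg_mono[of X "insert g X"] by auto
    ultimately show "f \<in> fun_alg (insert g X)"
      unfolding p poly_altdef
      by (intro is_subring_sum is_subringD(5) is_subring_power is_subring_fun_alg)
  qed
  then show ?case
    by (intro hilbert_basis[OF R insert.IH is_subring_fun_alg]) simp
qed

section \<open>Homogeneous polynomial functions\<close>

global_interpretation cvec_pair: vector_space_pair
  "scaleC :: complex \<Rightarrow> 'a \<Rightarrow> 'a::complex_vector" "scaleC :: complex \<Rightarrow> 'b \<Rightarrow> 'b::complex_vector"
  by unfold_locales

lemma clinear_iff:
  "clinear f \<longleftrightarrow> (\<forall>x y. f (x + y) = f x + f y) \<and> (\<forall>c x. f (c *\<^sub>C x) = c *\<^sub>C f x)"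
  by (auto simp: Vector_Spaces.linear_iff cvec.vector_space_axioms)

lemma scaleC_complex_eq [simp]: "c *\<^sub>C (x::complex) = c * x"
  by (simp add: scaleC_complex_def)

lemma scaleC_fun_apply [simp]: "(c *\<^sub>C f) x = c *\<^sub>C f x"
  by (simp add: scaleC_fun_def)

lemma clinear_zero: "clinear (\<lambda>x. 0)"
  by (simp add: clinear_iff)

lemma clinear_eval: "clinear (\<lambda>f. f x)"
  by (simp add: clinear_iff)

lemma hom_poly_zero: "hom_poly d (\<lambda>x::'v::complex_vector. 0)"
proof (induction d)
  case (Suc d)
  then show ?case using hom_poly.mult[OF clinear_zero Suc] by simp
qed (rule hom_poly.const)

lemma hom_poly_cmult: "hom_poly d f \<Longrightarrow> hom_poly d (\<lambda>x. c * f x)"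
  using hom_poly_prod[OF hom_poly.const[of c], of d f] by simp

lemma hom_poly_clinear: "clinear f \<Longrightarrow> hom_poly 1 f"
  using hom_poly.mult[OF _ hom_poly.const[of 1], of f] by simp

lemma hom_poly_sum:
  assumes "\<And>i. i \<in> A \<Longrightarrow> hom_poly d (f i)"
  shows "hom_poly d (\<lambda>x. \<Sum>i\<in>A. f i x)"
  using assms
  by (induction A rule: infinite_finite_induct) (auto intro: hom_poly_zero hom_poly.add)

lemma hom_poly_power: "hom_poly d f \<Longrightarrow> hom_poly (n * d) (\<lambda>x. f x ^ n)"
  by (induction n) (auto intro: hom_poly.const hom_poly_prod)

text \<open>Leibniz' formula. Since \<open>hom_poly\<close> takes in one linear factor at a time,
  the products are built over initial segments. The resultant will be such a determinant.\<close>

lemma hom_poly_det: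
  assumes "\<And>i j. i < n \<Longrightarrow> j < n \<Longrightarrow> clinear (M i j)"
  shows "hom_poly n (\<lambda>x. det (mat n n (\<lambda>(i, j). M i j x)))"
proof -
  have prod: "hom_poly m (\<lambda>x. \<Prod>i=0..<m. M i (p i) x)"
    if "p permutes {0..<n}" "m \<le> n" for p m
    using that(2)
  proof (induction m)
    case 0
    show ?case by (simp add: hom_poly.const)
  next
    case (Suc m)
    have "p m < n" using permutes_in_image[OF that(1), of m] Suc by simp
    then have "hom_poly (Suc m) (\<lambda>x. M m (p m) x * (\<Prod>i=0..<m. M i (p i) x))"
      using Suc by (intro hom_poly.mult assms) auto
    then show ?case by (simp add: mult.commute)
  qed
  have "(\<lambda>x. det (mat n n (\<lambda>(i, j). M i j x))) =
      (\<lambda>x. \<Sum>p | p permutes {0..<n}. signof p * (\<Prod>i=0..<n. M i (p i) x))"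
  proof
    fix x
    have "p i < n" if "p permutes {0..<n}" "i < n" for p i
      using permutes_in_image[OF that(1), of i] that by simp
    then show "det (mat n n (\<lambda>(i, j). M i j x)) =
      (\<Sum>p | p permutes {0..<n}. signof p * (\<Prod>i=0..<n. M i (p i) x))"
      by (subst det_def'[of _ n]) (auto intro!: sum.cong prod.cong)
  qed
  then show ?thesis using prod by (auto intro!: hom_poly_sum hom_poly_cmult)
qed

lemma det_eq_0_if_row_relation:
  fixes M :: "nat \<Rightarrow> nat \<Rightarrow> complex"
  assumes "\<And>j. j < n \<Longrightarrow> (\<Sum>i<n. c i * M i j) = 0" "i < n" "c i \<noteq> 0"
  shows "det (mat n n (\<lambda>(i, j). M i j)) = 0"
proof -
  let ?A = "mat n n (\<lambda>(i, j). M i j)"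
  have "det (transpose_mat ?A) = 0"
  proof (subst det_0_iff_vec_prod_zero_field[of _ n])
    have "transpose_mat ?A *\<^sub>v Matrix.vec n c = 0\<^sub>v n"
      by (rule eq_vecI) (auto simp: scalar_prod_def assms(1) lessThan_atLeast0 mult.commute
          simp flip: assms(1)[unfolded lessThan_atLeast0])
    moreover have "Matrix.vec n c \<noteq> 0\<^sub>v n" using assms(2,3) by (metis index_vec index_zero_vec(1))
    ultimately show "\<exists>v. v \<in> carrier_vec n \<and> v \<noteq> 0\<^sub>v n \<and> transpose_mat ?A *\<^sub>v v = 0\<^sub>v n"
      by (intro exI[of _ "Matrix.vec n c"]) auto
  qed auto
  then show ?thesis by (subst (asm) det_transpose) auto
qed

section \<open>Closed subsets of a projective curve\<close>

text \<open>Vanishing of a form, and the quotient of two forms of equal degree, do not depend on the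
  vector chosen on a line; a fixed choice lets points be inserted into forms.\<close>

definition rep :: "'v::complex_vector set \<Rightarrow> 'v" where
  "rep q = (SOME x. x \<noteq> 0 \<and> q = cvec.span {x})"

lemma rep:
  assumes "q \<in> proj UNIV"
  shows "rep q \<noteq> 0" "q = cvec.span {rep q}" "rep q \<in> q"
proof -
  have "\<exists>x. x \<noteq> 0 \<and> q = cvec.span {x}" using assms by (auto simp: proj_def)
  from someI_ex[OF this] show *: "rep q \<noteq> 0" "q = cvec.span {rep q}" by (auto simp: rep_def)
  show "rep q \<in> q" by (subst (2) *(2)) (simp add: cvec.span_base)
qed

lemma multiple_of_rep:
  assumes "q \<in> proj UNIV" "x \<in> q" "x \<noteq> 0"
  obtains c where "c \<noteq> 0" "x = c *\<^sub>C rep q"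
proof -
  have "x \<in> cvec.span {rep q}" using assms rep by metis
  then obtain c where "x = c *\<^sub>C rep q" by (auto simp: cvec.span_singleton)
  moreover have "c \<noteq> 0" using calculation assms(3) by auto
  ultimately show ?thesis using that by blast
qed

lemma rep_nonzero_iff:
  assumes "hom_poly d f" "q \<in> proj UNIV"
  shows "(\<exists>x\<in>q. f x \<noteq> 0) \<longleftrightarrow> f (rep q) \<noteq> 0"
  by (rule line_nonzero_iff[OF assms(1), of "rep q", folded rep(2)[OF assms(2)]])

lemma nonzero_locus_rep:
  assumes "\<forall>f\<in>F. \<exists>d. hom_poly d f"
  shows "nonzero_locus F = {q \<in> proj UNIV. \<exists>f\<in>F. f (rep q) \<noteq> 0}"
proof -
  have "(\<exists>f\<in>F. \<exists>x\<in>q. f x \<noteq> 0) \<longleftrightarrow> (\<exists>f\<in>F. f (rep q) \<noteq> 0)" if "q \<in> proj UNIV" for q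
  proof (intro bex_cong refl)
    fix f assume "f \<in> F"
    then obtain d where "hom_poly d f" using assms by auto
    from rep_nonzero_iff[OF this that] show "(\<exists>x\<in>q. f x \<noteq> 0) \<longleftrightarrow> f (rep q) \<noteq> 0" .
  qed
  then show ?thesis unfolding nonzero_locus_def by (intro Collect_cong) auto
qed

lemma closedin_zariski:
  "closedin zariski Z \<longleftrightarrow>
    (\<exists>F. (\<forall>f\<in>F. \<exists>d. hom_poly d f) \<and> Z = {q \<in> proj UNIV. \<forall>f\<in>F. f (rep q) = 0})"
proof
  assume "closedin zariski Z"
  then obtain F where F: "\<forall>f\<in>F. \<exists>d. hom_poly d f" and Z: "Z \<subseteq> proj UNIV" "proj UNIV - Z = nonzero_locus F"
    unfolding closedin_def topspace_zariski openin_zariski by metis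
  have "q \<in> Z \<longleftrightarrow> q \<in> proj UNIV \<and> (\<forall>f\<in>F. f (rep q) = 0)" for q
  proof -
    have "q \<in> proj UNIV - Z \<longleftrightarrow> q \<in> proj UNIV \<and> (\<exists>f\<in>F. f (rep q) \<noteq> 0)"
      unfolding Z(2) nonzero_locus_rep[OF F] by simp
    then show ?thesis using Z(1) by auto
  qed
  then have "Z = {q \<in> proj UNIV. \<forall>f\<in>F. f (rep q) = 0}" by auto
  then show "\<exists>F. (\<forall>f\<in>F. \<exists>d. hom_poly d f) \<and> Z = {q \<in> proj UNIV. \<forall>f\<in>F. f (rep q) = 0}"
    using F by blast
next
  assume "\<exists>F. (\<forall>f\<in>F. \<exists>d. hom_poly d f) \<and> Z = {q \<in> proj UNIV. \<forall>f\<in>F. f (rep q) = 0}"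
  then obtain F where F: "\<forall>f\<in>F. \<exists>d. hom_poly d f" and Z: "Z = {q \<in> proj UNIV. \<forall>f\<in>F. f (rep q) = 0}"
    by auto
  then have "proj UNIV - Z = nonzero_locus F" unfolding nonzero_locus_rep[OF F] by auto
  then show "closedin zariski Z"
    using F Z unfolding closedin_def topspace_zariski openin_zariski by (intro conjI exI[of _ F]) auto
qed

lemma closedin_zero_locus: "hom_poly d f \<Longrightarrow> closedin zariski {q \<in> proj UNIV. f (rep q) = 0}"
  unfolding closedin_zariski by (intro exI[of _ "{f}"]) auto

lemma separating_functional:
  fixes v w :: "'v::complex_vector"
  assumes "w \<noteq> 0" "v \<notin> cvec.span {w}"
  obtains \<phi> :: "'v \<Rightarrow> complex" where "clinear \<phi>" "\<phi> w = 0" "\<phi> v = 1"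
proof -
  have "cvec.independent {v, w}" using assms by (intro cvec.independent_insertI cvec.independent_empty) simp_all
  from cvec_pair.linear_independent_extend[OF this, of "\<lambda>x. if x = v then 1 else (0::complex)"]
  obtain \<phi> :: "'v \<Rightarrow> complex" where "clinear \<phi>" "\<forall>x\<in>{v, w}. \<phi> x = (if x = v then 1 else 0)" by auto
  moreover have "v \<noteq> w" using assms by (auto intro: cvec.span_base)
  ultimately show ?thesis using that by auto
qed

lemma nonzero_functional:
  fixes v :: "'v::complex_vector"
  assumes "v \<noteq> 0"
  obtains \<phi> :: "'v \<Rightarrow> complex" where "clinear \<phi>" "\<phi> v = 1"
proof -
  have "cvec.independent {v}" using assms by simp
  from cvec_pair.linear_independent_extend[OF this, of "\<lambda>x. 1 :: complex"]
  show ?thesis using that by auto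
qed

lemma points_separated:
  fixes p q :: "'v::complex_vector set"
  assumes "p \<in> proj UNIV" "q \<in> proj UNIV" "p \<noteq> q"
  obtains \<phi> :: "'v \<Rightarrow> complex" where "clinear \<phi>" "\<phi> (rep p) = 0" "\<phi> (rep q) = 1"
proof -
  have "rep q \<notin> cvec.span {rep p}"
  proof
    assume "rep q \<in> cvec.span {rep p}"
    then obtain c where c: "rep q = c *\<^sub>C rep p" by (auto simp: cvec.span_singleton)
    then have "c \<noteq> 0" using rep(1)[OF assms(2)] by auto
    then have "rep p = inverse c *\<^sub>C rep q" by (simp add: c)
    then have "rep p \<in> cvec.span {rep q}" by (auto simp: cvec.span_singleton)
    then have "cvec.span {rep p} = cvec.span {rep q}"
      using \<open>rep q \<in> cvec.span {rep p}\<close>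
      by (simp add: cvec.span_eq)
    then show False using assms rep(2)[OF assms(1)] rep(2)[OF assms(2)] by argo
  qed
  then show ?thesis using separating_functional rep(1)[OF assms(1)] that by blast
qed

text \<open>The linear forms vanishing on the line of \<open>p\<close> cut out \<open>p\<close>,
  because one of them separates it from any given other point.\<close>

lemma closedin_point:
  assumes "p \<in> proj (UNIV :: 'v::complex_vector set)"
  shows "closedin zariski {p}"
  unfolding closedin_zariski
proof (intro exI conjI)
  let ?F = "{\<phi> :: 'v \<Rightarrow> complex. clinear \<phi> \<and> \<phi> (rep p) = 0}"
  show "\<forall>f\<in>?F. \<exists>d. hom_poly d f" using hom_poly_clinear by blast
  show "{p} = {q \<in> proj UNIV. \<forall>f\<in>?F. f (rep q) = 0}"
  proof (intro equalityI subsetI)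
    fix q assume q: "q \<in> {q \<in> proj UNIV. \<forall>f\<in>?F. f (rep q) = 0}"
    show "q \<in> {p}"
    proof (rule ccontr)
      assume "q \<notin> {p}"
      then have "p \<noteq> q" by auto
      moreover have "q \<in> proj UNIV" using q by simp
      ultimately obtain \<phi> :: "'v \<Rightarrow> complex" where "clinear \<phi>" "\<phi> (rep p) = 0" "\<phi> (rep q) = 1"
        using points_separated[OF assms] by blast
      then show False using q by auto
    qed
  qed (use assms in auto)
qed

lemma vec_expansion: "(x :: complex ^ 'n::finite) = (\<Sum>i\<in>UNIV. x $ i *\<^sub>C axis i 1)"
proof -
  have "(\<Sum>i\<in>UNIV. x $ i *\<^sub>C axis i 1) $ j = (\<Sum>i\<in>UNIV. if i = j then x $ i else 0)" for j
    unfolding sum_component by (rule sum.cong) (auto simp: scaleC_vec_def axis_def)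
  then have "\<forall>j. x $ j = (\<Sum>i\<in>UNIV. x $ i *\<^sub>C axis i 1) $ j" by simp
  then show ?thesis by (rule iffD2[OF Finite_Cartesian_Product.vec_eq_iff])
qed

lemma clinear_coordinates:
  fixes \<phi> :: "complex ^ 'n::finite \<Rightarrow> complex"
  assumes "clinear \<phi>"
  shows "\<phi> x = (\<Sum>i\<in>UNIV. x $ i * \<phi> (axis i 1))"
proof -
  have "\<phi> x = \<phi> (\<Sum>i\<in>UNIV. x $ i *\<^sub>C axis i 1)" using vec_expansion[of x] by simp
  also have "\<dots> = (\<Sum>i\<in>UNIV. \<phi> (x $ i *\<^sub>C axis i 1))" by (rule cvec_pair.linear_sum[OF assms])
  also have "\<dots> = (\<Sum>i\<in>UNIV. x $ i * \<phi> (axis i 1))" using assms by (simp add: clinear_iff)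
  finally show ?thesis .
qed

lemma hom_poly_fun_alg:
  assumes "hom_poly d (f :: complex ^ 'n::finite \<Rightarrow> complex)"
  shows "f \<in> fun_alg (range (\<lambda>i x. x $ i))"
  using assms
proof induction
  case (mult \<phi> d f)
  have "\<phi> = (\<lambda>x. \<Sum>i\<in>UNIV. x $ i * \<phi> (axis i 1))" using clinear_coordinates[OF mult(1)] by blast
  also have "\<dots> \<in> fun_alg (range (\<lambda>i x. x $ i))"
    by (intro fun_alg_sum fun_alg.mult fun_alg.const fun_alg.gen) auto
  finally show ?case using mult by (intro fun_alg.mult)
qed (auto intro: fun_alg.intros)

text \<open>Dehomogenisation by the linear form \<open>L\<close>. The expansions stay valid where
  \<open>L\<close> vanishes, since division by 0 yields 0.\<close>

lemma hom_poly_quotient_fun_alg: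
  assumes "hom_poly d (f :: complex ^ 'n::finite \<Rightarrow> complex)"
  shows "(\<lambda>x. f x / L x ^ d) \<in> fun_alg (range (\<lambda>i x. x $ i / L x))"
  using assms
proof induction
  case (const c)
  then show ?case using fun_alg.const by simp
next
  case (mult \<phi> d f)
  have "(\<lambda>x. \<phi> x / L x) = (\<lambda>x. \<Sum>i\<in>UNIV. (x $ i / L x) * \<phi> (axis i 1))"
    by (subst clinear_coordinates[OF mult(1)]) (simp add: sum_divide_distrib)
  also have "\<dots> \<in> fun_alg (range (\<lambda>i x. x $ i / L x))"
    by (intro fun_alg_sum fun_alg.mult fun_alg.const fun_alg.gen) auto
  finally have "(\<lambda>x. (\<phi> x / L x) * (f x / L x ^ d)) \<in> fun_alg (range (\<lambda>i x. x $ i / L x))"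
    using mult by (intro fun_alg.mult)
  then show ?case by simp
next
  case (add d f g)
  then have "(\<lambda>x. f x / L x ^ d + g x / L x ^ d) \<in> fun_alg (range (\<lambda>i x. x $ i / L x))"
    by (intro fun_alg.add)
  then show ?case by (simp add: add_divide_distrib)
qed

text \<open>Each strict inclusion provides a form \<open>f n\<close> that vanishes on the smaller
  set but not on \<open>Z n\<close>. Some \<open>f n\<close> lies in the ideal of its predecessors,
  and these all vanish on \<open>Z n\<close>.\<close>

lemma zariski_descending_chain:
  fixes Z :: "nat \<Rightarrow> 'n::finite pt set"
  assumes closed: "\<And>n. closedin zariski (Z n)"
  shows "\<exists>n. \<not> Z (Suc n) \<subset> Z n"
proof (rule ccontr)
  assume "\<nexists>n. \<not> Z (Suc n) \<subset> Z n"
  then have desc: "Z (Suc n) \<subset> Z n" for n by blast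
  have "\<exists>f. (\<exists>d. hom_poly d f) \<and> (\<forall>q\<in>Z (Suc n). f (rep q) = 0) \<and> (\<exists>q\<in>Z n. f (rep q) \<noteq> 0)" for n
  proof -
    obtain q where q: "q \<in> Z n" "q \<notin> Z (Suc n)" using desc by blast
    obtain F where F: "\<forall>f\<in>F. \<exists>d. hom_poly d f" "Z (Suc n) = {q \<in> proj UNIV. \<forall>f\<in>F. f (rep q) = 0}"
      using closed[of "Suc n"] by (auto simp: closedin_zariski)
    have "q \<in> proj UNIV" using closed[of n] q closedin_subset topspace_zariski by blast
    then obtain f where "f \<in> F" "f (rep q) \<noteq> 0" using q F by auto
    then show ?thesis using F q by (intro exI[of _ f]) auto
  qed
  then obtain f where f: "\<And>n. \<exists>d. hom_poly d (f n)" "\<And>n q. q \<in> Z (Suc n) \<Longrightarrow> f n (rep q) = 0"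
    "\<And>n. \<exists>q\<in>Z n. f n (rep q) \<noteq> 0" by metis
  let ?R = "fun_alg (range (\<lambda>i (x :: complex ^ 'n). x $ i))"
  have "range f \<subseteq> ?R" using f(1) hom_poly_fun_alg by blast
  then obtain n where n: "f n \<in> gen_ideal ?R (f ` {..<n})"
    using noeth_fun_alg[of "range (\<lambda>i (x :: complex ^ 'n). x $ i)"] unfolding noeth_ring_def by auto
  obtain q where q: "q \<in> Z n" "f n (rep q) \<noteq> 0" using f(3) by blast
  have "q \<in> Z (Suc i)" if "i < n" for i
    using lift_Suc_antimono_le[of Z "Suc i" n] desc that q by auto
  then have fi: "f i (rep q) = 0" if "i < n" for i using f(2) that by blast
  have "g (rep q) = 0" if "g \<in> gen_ideal ?R (f ` {..<n})" for g
    using that by induction (auto simp: fi)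
  then show False using n q by blast
qed

text \<open>The nonempty open subsets of the curve will turn out to be the cofinite ones, so this
  filter plays the role of the generic point.\<close>

definition ae :: "'a set \<Rightarrow> 'a filter" where
  "ae C = inf cofinite (principal C)"

lemma eventually_ae: "eventually P (ae C) \<longleftrightarrow> finite {q \<in> C. \<not> P q}"
  unfolding ae_def eventually_inf_principal eventually_cofinite by simp

type_synonym 'n cfun = "'n pt \<Rightarrow> complex"

section \<open>The cofinite topology of a projective curve\<close>

locale projective_curve =
  fixes C :: "'n::finite pt set"
  assumes closed: "closedin zariski C"
    and irreducible: "irreducible_space (zariski_on C)"
    and krull_dim: "has_krull_dim (zariski_on C) 1"
begin

lemma C_proj: "q \<in> C \<Longrightarrow> q \<in> proj UNIV"
  using closedin_subset[OF closed] unfolding topspace_zariski by (rule subsetD)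

lemma topspace_C: "topspace (zariski_on C) = C"
  by (rule topspace_subtopology_subset[OF closedin_subset[OF closed]])

lemma closedin_C_iff: "closedin (zariski_on C) Z \<longleftrightarrow> closedin zariski Z \<and> Z \<subseteq> C"
  by (rule closedin_closed_subtopology[OF closed])

lemma irreducible_point:
  assumes "q \<in> C"
  shows "irreducible_space (subtopology (zariski_on C) {q})"
proof -
  have "topspace (subtopology (zariski_on C) {q}) = {q}"
    by (rule topspace_subtopology_subset) (use assms topspace_C in simp)
  then show ?thesis unfolding irreducible_space_def \<open>topspace _ = {q}\<close> by blast
qed

lemma subtopology_C: "subtopology (zariski_on C) C = zariski_on C"
  unfolding subtopology_subtopology Int_absorb ..

text \<open>A minimal infinite closed proper subset \<open>Y\<close> is irreducible, because one of
  two closed sets covering it is infinite. A point of \<open>Y\<close>, \<open>Y\<close> and the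
  curve would then form a chain of length 2.\<close>

lemma finite_closed:
  assumes "closedin zariski Z" "Z \<subset> C"
  shows "finite Z"
proof (rule ccontr)
  assume "infinite Z"
  let ?R = "{(A, B). closedin (zariski :: 'n pt topology) A \<and> closedin zariski B \<and> A \<subset> B}"
  have "wf ?R"
    unfolding wf_iff_no_infinite_down_chain
  proof
    assume "\<exists>f. \<forall>i. (f (Suc i), f i) \<in> ?R"
    then obtain f :: "nat \<Rightarrow> 'n pt set" where "\<forall>i. (f (Suc i), f i) \<in> ?R" ..
    then have "closedin zariski (f i)" "f (Suc i) \<subset> f i" for i by auto
    then show False using zariski_descending_chain[of f] by blast
  qed
  then obtain Y where Y: "closedin zariski Y" "Y \<subset> C" "infinite Y"
    and min: "\<And>A. closedin zariski A \<Longrightarrow> A \<subset> Y \<Longrightarrow> finite A"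
  proof (rule wfE_min[of _ Z "{A. closedin zariski A \<and> A \<subset> C \<and> infinite A}"])
    fix Y assume "Y \<in> {A. closedin zariski A \<and> A \<subset> C \<and> infinite A}"
      and "\<And>A. (A, Y) \<in> ?R \<Longrightarrow> A \<notin> {A. closedin zariski A \<and> A \<subset> C \<and> infinite A}"
    then show thesis by (intro that[of Y]) auto
  qed (use assms \<open>infinite Z\<close> in auto)
  have topY: "topspace (subtopology (zariski_on C) Y) = Y"
    by (rule topspace_subtopology_subset) (use Y topspace_C in simp)
  have "irreducible_space (subtopology (zariski_on C) Y)"
    unfolding irreducible_space_def topY
  proof (intro conjI allI impI)
    fix A B
    assume AB: "closedin (subtopology (zariski_on C) Y) A \<and> closedin (subtopology (zariski_on C) Y) B
        \<and> Y = A \<union> B"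
    then have "closedin zariski A" "closedin zariski B"
      using Y closedin_closed_subtopology[of "zariski_on C" Y] closedin_C_iff by auto
    moreover have "infinite A \<or> infinite B" using Y AB by auto
    ultimately show "A = Y \<or> B = Y" using min[of A] min[of B] AB by blast
  qed (use Y in auto)
  moreover obtain q where q: "q \<in> Y" using Y by (metis finite.emptyI ex_in_conv)
  have "Y \<noteq> {q}" using Y by auto
  define W where "W = (\<lambda>i::nat. if i = 0 then {q} else if i = 1 then Y else C)"
  have "irreducible_chain (zariski_on C) 2 W"
    unfolding irreducible_chain_def
  proof (intro conjI allI impI)
    fix i :: nat assume "i \<le> 2"
    show "closedin (zariski_on C) (W i)"
      using Y q closed closedin_point[OF C_proj, of q] by (auto simp: W_def closedin_C_iff)
    show "irreducible_space (subtopology (zariski_on C) (W i))"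
      using calculation irreducible_point[of q] irreducible subtopology_C q Y by (auto simp: W_def)
  next
    fix i :: nat assume "i < 2"
    then show "W i \<subset> W (Suc i)" using q Y \<open>Y \<noteq> {q}\<close> by (auto simp: W_def)
  qed
  then show False using krull_dim by (fastforce simp: has_krull_dim_def)
qed

lemma irreducible_closed:
  assumes "closedin zariski A" "closedin zariski B" "C \<subseteq> A \<union> B"
  shows "C \<subseteq> A \<or> C \<subseteq> B"
proof -
  have "closedin (zariski_on C) (C \<inter> A)" "closedin (zariski_on C) (C \<inter> B)"
    using assms closed by (auto simp: closedin_C_iff)
  moreover have "C = C \<inter> A \<union> C \<inter> B" using assms by blast
  ultimately have "C \<inter> A = C \<or> C \<inter> B = C"
    using irreducible topspace_C unfolding irreducible_space_def by metis
  then show ?thesis by blast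
qed

lemma closedin_finite: "finite A \<Longrightarrow> A \<subseteq> C \<Longrightarrow> closedin zariski A"
proof (induction A rule: finite_induct)
  case (insert x A)
  then have "closedin zariski ({x} \<union> A)" using C_proj by (intro closedin_Un closedin_point) auto
  then show ?case by simp
qed auto

text \<open>A chain of length 1 provides two distinct points, and a finite closed set with two
  points splits into one of them and the rest.\<close>

lemma infinite_C: "infinite C"
proof
  assume fin: "finite C"
  obtain W where W: "irreducible_chain (zariski_on C) 1 W" using krull_dim by (auto simp: has_krull_dim_def)
  have irr: "irreducible_space (subtopology (zariski_on C) (W 0))" and W0: "W 0 \<subset> W 1" "W 1 \<subseteq> C"
    using W closedin_subset[of "zariski_on C" "W 1"] unfolding irreducible_chain_def topspace_C by auto
  have "topspace (subtopology (zariski_on C) (W 0)) = W 0"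
    by (rule topspace_subtopology_subset) (use W0 topspace_C in simp)
  then obtain p where p: "p \<in> W 0" using irr unfolding irreducible_space_def by force
  obtain q where q: "q \<in> C" "q \<noteq> p" using p W0 by blast
  have "C \<subseteq> {p} \<union> (C - {p})" by blast
  then have "C \<subseteq> {p} \<or> C \<subseteq> C - {p}"
    using fin p W0 by (intro irreducible_closed closedin_finite) auto
  then show False using q p W0 by blast
qed

lemma openin_C_iff: "openin (zariski_on C) U \<longleftrightarrow> U \<subseteq> C \<and> (U = {} \<or> finite (C - U))"
proof
  assume U: "openin (zariski_on C) U"
  then have "U \<subseteq> C" using openin_subset topspace_C by metis
  moreover have "closedin (zariski_on C) (C - U)" using U topspace_C by (metis openin_closedin_eq)
  then have "U \<noteq> {} \<Longrightarrow> finite (C - U)" using \<open>U \<subseteq> C\<close> by (intro finite_closed) (auto simp: closedin_C_iff)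
  ultimately show "U \<subseteq> C \<and> (U = {} \<or> finite (C - U))" by blast
next
  assume U: "U \<subseteq> C \<and> (U = {} \<or> finite (C - U))"
  then have "U = {} \<or> closedin (zariski_on C) (C - U)"
    using closedin_finite by (auto simp: closedin_C_iff)
  then show "openin (zariski_on C) U" using U topspace_C
    by (metis openin_closedin_eq openin_empty)
qed

abbreviation \<eta> :: "'n pt filter" where "\<eta> \<equiv> ae C"

lemma eventually_atin_C: "p \<in> C \<Longrightarrow> eventually P (atin (zariski_on C) p) \<longleftrightarrow> eventually P \<eta>"
proof -
  assume p: "p \<in> C"
  show ?thesis
  proof
    assume "eventually P (atin (zariski_on C) p)"
    then obtain U where U: "openin (zariski_on C) U" "p \<in> U" "\<forall>q\<in>U - {p}. P q"
      using p topspace_C by (auto simp: eventually_atin)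
    then have "finite (C - U)" by (auto simp: openin_C_iff)
    then have "finite (insert p (C - U))" by simp
    then show "eventually P \<eta>" unfolding eventually_ae by (rule rev_finite_subset) (use U in auto)
  next
    assume "eventually P \<eta>"
    then have "finite {q \<in> C. \<not> P q}" by (simp add: eventually_ae)
    then have "finite (C - insert p {q \<in> C. P q})" by (rule rev_finite_subset) auto
    then have "openin (zariski_on C) (insert p {q \<in> C. P q})"
      using p unfolding openin_C_iff by auto
    then show "eventually P (atin (zariski_on C) p)" unfolding eventually_atin
      by (intro disjI2 exI[of _ "insert p {q \<in> C. P q}"]) auto
  qed
qed

lemma eventually_nhdsin_C:
  assumes p: "p \<in> C"
  shows "eventually P (nhdsin (zariski_on C) p) \<longleftrightarrow> P p \<and> eventually P \<eta>"
proof
  assume "eventually P (nhdsin (zariski_on C) p)"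
  then obtain U where U: "openin (zariski_on C) U" "p \<in> U" "\<forall>q\<in>U. P q"
    using p topspace_C by (auto simp: eventually_nhdsin)
  then have "finite (C - U)" by (auto simp: openin_C_iff)
  then have "eventually P \<eta>" unfolding eventually_ae by (rule rev_finite_subset) (use U in auto)
  then show "P p \<and> eventually P \<eta>" using U by blast
next
  assume *: "P p \<and> eventually P \<eta>"
  then have "finite {q \<in> C. \<not> P q}" by (simp add: eventually_ae)
  then have "finite (C - {q \<in> C. P q})" by (rule rev_finite_subset) auto
  then have "openin (zariski_on C) {q \<in> C. P q}"
    using p unfolding openin_C_iff by auto
  then show "eventually P (nhdsin (zariski_on C) p)" unfolding eventually_nhdsin
    using * p by (intro disjI2 exI[of _ "{q \<in> C. P q}"]) auto
qed

lemma eventually_ex: "eventually P \<eta> \<Longrightarrow> \<exists>q\<in>C. P q"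
proof (rule ccontr)
  assume "eventually P \<eta>" and no: "\<not> (\<exists>q\<in>C. P q)"
  then have "finite {q \<in> C. \<not> P q}" by (simp add: eventually_ae)
  moreover have "{q \<in> C. \<not> P q} = C" using no by blast
  ultimately show False using infinite_C by simp
qed

lemma hom_poly_ae_nonzero:
  assumes "hom_poly d G" "q \<in> C" "G (rep q) \<noteq> 0"
  shows "\<forall>\<^sub>F q in \<eta>. G (rep q) \<noteq> 0"
proof -
  have "closedin zariski (C \<inter> {q \<in> proj UNIV. G (rep q) = 0})"
    by (intro closedin_Int closed closedin_zero_locus[OF assms(1)])
  then have "finite (C \<inter> {q \<in> proj UNIV. G (rep q) = 0})"
    by (rule finite_closed) (use assms C_proj in auto)
  then show ?thesis unfolding eventually_ae by (rule rev_finite_subset) (use C_proj in auto)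
qed

lemma hom_poly_ae_zero:
  assumes "hom_poly d G" "\<forall>\<^sub>F q in \<eta>. G (rep q) = 0" "q \<in> C"
  shows "G (rep q) = 0"
proof (rule ccontr)
  assume "G (rep q) \<noteq> 0"
  from eventually_conj[OF hom_poly_ae_nonzero[OF assms(1,3) this] assms(2)]
  show False using eventually_ex by blast
qed

text \<open>In the cofinite topology a neighbourhood of \<open>p\<close> is \<open>p\<close>
  together with almost all points, so regularity splits into the value at \<open>p\<close> and a
  generic identity.\<close>

lemma regular_at_iff:
  "regular_at C p f \<longleftrightarrow> p \<in> C \<and> (\<exists>d F G. hom_poly d F \<and> hom_poly d G \<and> G (rep p) \<noteq> 0 \<and>
     f p = F (rep p) / G (rep p) \<and> (\<forall>\<^sub>F q in \<eta>. f q = F (rep q) / G (rep q)))"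
proof
  assume "regular_at C p f"
  then obtain U d F G where U: "openin (zariski_on C) U" "p \<in> U" "hom_poly d F" "hom_poly d G"
    and eq: "\<forall>q\<in>U. \<forall>x\<in>q - {0}. G x \<noteq> 0 \<and> f q = F x / G x" by (auto simp: regular_at_def)
  have UC: "U \<subseteq> C" "finite (C - U)" using U by (auto simp: openin_C_iff)
  have "G (rep q) \<noteq> 0 \<and> f q = F (rep q) / G (rep q)" if "q \<in> U" for q
    using eq that rep(1,3)[of q] C_proj[of q] UC by auto
  then show "p \<in> C \<and> (\<exists>d F G. hom_poly d F \<and> hom_poly d G \<and> G (rep p) \<noteq> 0 \<and>
     f p = F (rep p) / G (rep p) \<and> (\<forall>\<^sub>F q in \<eta>. f q = F (rep q) / G (rep q)))"
    using U UC unfolding eventually_ae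
    by (intro conjI exI[of _ d] exI[of _ F] exI[of _ G]) (auto intro: rev_finite_subset[OF UC(2)])
next
  assume "p \<in> C \<and> (\<exists>d F G. hom_poly d F \<and> hom_poly d G \<and> G (rep p) \<noteq> 0 \<and>
     f p = F (rep p) / G (rep p) \<and> (\<forall>\<^sub>F q in \<eta>. f q = F (rep q) / G (rep q)))"
  then obtain d F G where p: "p \<in> C" and FG: "hom_poly d F" "hom_poly d G" "G (rep p) \<noteq> 0"
     "f p = F (rep p) / G (rep p)" "\<forall>\<^sub>F q in \<eta>. f q = F (rep q) / G (rep q)" by blast
  define U where "U = {q \<in> C. G (rep q) \<noteq> 0 \<and> f q = F (rep q) / G (rep q)}"
  have "\<forall>\<^sub>F q in \<eta>. G (rep q) \<noteq> 0 \<and> f q = F (rep q) / G (rep q)"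
    using hom_poly_ae_nonzero[OF FG(2) p FG(3)] FG(5) by eventually_elim blast
  then have "finite (C - U)" unfolding eventually_ae by (rule rev_finite_subset) (auto simp: U_def)
  then have "openin (zariski_on C) U" by (auto simp: openin_C_iff U_def)
  moreover have "G x \<noteq> 0 \<and> f q = F x / G x" if "q \<in> U" "x \<in> q - {0}" for q x
  proof -
    have q: "q \<in> C" "G (rep q) \<noteq> 0" "f q = F (rep q) / G (rep q)" and x: "x \<in> q" "x \<noteq> 0"
      using that by (auto simp: U_def)
    obtain c where c: "c \<noteq> 0" "x = c *\<^sub>C rep q" by (rule multiple_of_rep[OF C_proj[OF q(1)] x])
    show ?thesis unfolding c(2) hom_poly_scale[OF FG(1)] hom_poly_scale[OF FG(2)] using q c(1) by simp
  qed
  moreover have "p \<in> U" using FG p by (simp add: U_def)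
  ultimately show "regular_at C p f" unfolding regular_at_def using FG(1,2) by blast
qed

end

section \<open>Rational functions and orders\<close>

context projective_curve
begin

abbreviation aeq :: "'n cfun \<Rightarrow> 'n cfun \<Rightarrow> bool" (infix "\<doteq>" 50) where
  "f \<doteq> g \<equiv> \<forall>\<^sub>F q in \<eta>. f q = g q"

definition nz :: "'n cfun \<Rightarrow> bool" where
  "nz f \<longleftrightarrow> (\<forall>\<^sub>F q in \<eta>. f q \<noteq> 0)"

definition rational :: "'n cfun \<Rightarrow> bool" where
  "rational f \<longleftrightarrow> (\<exists>d F G. hom_poly d F \<and> hom_poly d G \<and> (\<exists>q\<in>C. G (rep q) \<noteq> 0) \<and>
     (\<forall>\<^sub>F q in \<eta>. f q = F (rep q) / G (rep q)))"

abbreviation reg :: "'n pt \<Rightarrow> 'n cfun \<Rightarrow> bool" where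
  "reg p f \<equiv> regular_at C p f"

lemma ae_I: "(\<And>q. q \<in> C \<Longrightarrow> P q) \<Longrightarrow> eventually P \<eta>"
  unfolding eventually_ae by (rule finite_subset[of _ "{}"]) auto

lemma aeq_sym: "f \<doteq> g \<Longrightarrow> g \<doteq> f"
  by (erule eventually_mono) simp

lemma nz_not_zero: "nz f \<Longrightarrow> \<not> f \<doteq> (\<lambda>_. 0)"
  unfolding nz_def
proof
  assume "\<forall>\<^sub>F q in \<eta>. f q \<noteq> 0" "f \<doteq> (\<lambda>_. 0)"
  then have "\<forall>\<^sub>F q in \<eta>. False" by eventually_elim simp
  then show False using eventually_ex by blast
qed

lemma nz_mult: "nz f \<Longrightarrow> nz g \<Longrightarrow> nz (\<lambda>q. f q * g q)"
  unfolding nz_def by (erule (1) eventually_elim2) simp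

lemma nz_inverse: "nz f \<Longrightarrow> nz (\<lambda>q. inverse (f q))"
  unfolding nz_def by (erule eventually_mono) simp

lemma nz_power: "nz f \<Longrightarrow> nz (\<lambda>q. f q ^ n)"
  unfolding nz_def by (erule eventually_mono) simp

lemma nz_powi: "nz f \<Longrightarrow> nz (\<lambda>q. f q powi n)"
  unfolding nz_def by (erule eventually_mono) simp

lemma nz_const: "c \<noteq> 0 \<Longrightarrow> nz (\<lambda>_. c)"
  by (simp add: nz_def)

lemma rational_cong: "f \<doteq> g \<Longrightarrow> rational g \<Longrightarrow> rational f"
  unfolding rational_def
proof (elim exE conjE)
  fix d F G
  assume *: "f \<doteq> g" "hom_poly d F" "hom_poly d G" "\<exists>q\<in>C. G (rep q) \<noteq> 0"
    "\<forall>\<^sub>F q in \<eta>. g q = F (rep q) / G (rep q)"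
  from *(1,5) have f: "\<forall>\<^sub>F q in \<eta>. f q = F (rep q) / G (rep q)" by eventually_elim simp
  show "\<exists>d F G. hom_poly d F \<and> hom_poly d G \<and> (\<exists>q\<in>C. G (rep q) \<noteq> 0) \<and>
     (\<forall>\<^sub>F q in \<eta>. f q = F (rep q) / G (rep q))"
    by (rule exI[of _ d], rule exI[of _ F], rule exI[of _ G]) (intro conjI *(2-4) f)
qed

lemma rationalI:
  assumes "hom_poly d F" "hom_poly d G" "\<forall>\<^sub>F q in \<eta>. G (rep q) \<noteq> 0" "\<forall>\<^sub>F q in \<eta>. f q = F (rep q) / G (rep q)"
  shows "rational f"
  unfolding rational_def
  by (rule exI[of _ d], rule exI[of _ F], rule exI[of _ G]) (intro conjI eventually_ex assms)

lemma rationalE: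
  assumes "rational f"
  obtains d F G where "hom_poly d F" "hom_poly d G" "\<forall>\<^sub>F q in \<eta>. G (rep q) \<noteq> 0"
    "\<forall>\<^sub>F q in \<eta>. f q = F (rep q) / G (rep q)"
proof -
  obtain d F G where F: "hom_poly d F" "hom_poly d G" "\<exists>q\<in>C. G (rep q) \<noteq> 0"
    "\<forall>\<^sub>F q in \<eta>. f q = F (rep q) / G (rep q)" using assms unfolding rational_def by (elim exE conjE)
  from F(3) obtain q where "q \<in> C" "G (rep q) \<noteq> 0" ..
  from that[OF F(1,2) hom_poly_ae_nonzero[OF F(2) this] F(4)] show ?thesis .
qed

lemma rational_const: "rational (\<lambda>_. c)"
  by (rule rationalI[OF hom_poly.const[of c] hom_poly.const[of 1]]) auto

text \<open>By irreducibility a form that is nonzero somewhere on the curve is nonzero almost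
  everywhere; modulo finite sets the rational functions thus form a field.\<close>

lemma rational_dichotomy:
  assumes "rational f"
  shows "f \<doteq> (\<lambda>_. 0) \<or> nz f"
proof -
  obtain d F G where F: "hom_poly d F" "hom_poly d G" "\<forall>\<^sub>F q in \<eta>. G (rep q) \<noteq> 0"
    "\<forall>\<^sub>F q in \<eta>. f q = F (rep q) / G (rep q)" using rationalE[OF assms(1)] .
  show ?thesis
  proof (cases "\<exists>q\<in>C. F (rep q) \<noteq> 0")
    case True
    then have "\<forall>\<^sub>F q in \<eta>. F (rep q) \<noteq> 0" using hom_poly_ae_nonzero[OF F(1)] by blast
    then have "nz f" unfolding nz_def using F(3,4) by eventually_elim simp
    then show ?thesis ..
  next
    case False
    then have "\<forall>\<^sub>F q in \<eta>. F (rep q) = 0" by (intro ae_I) auto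
    then have "f \<doteq> (\<lambda>_. 0)" using F(4) by eventually_elim simp
    then show ?thesis ..
  qed
qed

lemma regI:
  assumes "p \<in> C" "hom_poly d F" "hom_poly d G" "G (rep p) \<noteq> 0" "f p = F (rep p) / G (rep p)"
    "\<forall>\<^sub>F q in \<eta>. f q = F (rep q) / G (rep q)"
  shows "reg p f"
  unfolding regular_at_iff
  by (rule conjI[OF assms(1)], rule exI[of _ d], rule exI[of _ F], rule exI[of _ G]) (intro conjI assms)

lemma regE:
  assumes "reg p f"
  obtains d F G where "p \<in> C" "hom_poly d F" "hom_poly d G" "G (rep p) \<noteq> 0" "f p = F (rep p) / G (rep p)"
    "\<forall>\<^sub>F q in \<eta>. f q = F (rep q) / G (rep q)" "\<forall>\<^sub>F q in \<eta>. G (rep q) \<noteq> 0"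
proof -
  obtain d F G where F: "p \<in> C" "hom_poly d F" "hom_poly d G" "G (rep p) \<noteq> 0"
    "f p = F (rep p) / G (rep p)" "\<forall>\<^sub>F q in \<eta>. f q = F (rep q) / G (rep q)"
    using assms unfolding regular_at_iff by (elim exE conjE)
  from that[OF F hom_poly_ae_nonzero[OF F(3,1,4)]] show ?thesis .
qed

lemma reg_in_C: "reg p f \<Longrightarrow> p \<in> C"
  by (simp add: regular_at_iff)

lemma reg_rational: "reg p f \<Longrightarrow> rational f"
  by (erule regE) (rule rationalI)

lemma reg_cong: "reg p f \<Longrightarrow> f \<doteq> g \<Longrightarrow> f p = g p \<Longrightarrow> reg p g"
proof (erule regE)
  fix d F G assume *: "p \<in> C" "hom_poly d F" "hom_poly d G" "G (rep p) \<noteq> 0" "f p = F (rep p) / G (rep p)"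
    "\<forall>\<^sub>F q in \<eta>. f q = F (rep q) / G (rep q)" and fg: "f \<doteq> g" "f p = g p"
  have "\<forall>\<^sub>F q in \<eta>. g q = F (rep q) / G (rep q)" using fg(1) *(6) by eventually_elim simp
  then show "reg p g" using * fg(2) by (intro regI[of p d F G]) auto
qed

lemma reg_const: "p \<in> C \<Longrightarrow> reg p (\<lambda>_. c)"
  by (rule regI[OF _ hom_poly.const[of c] hom_poly.const[of 1]]) auto

lemma reg_add:
  assumes "reg p f" "reg p g"
  shows "reg p (\<lambda>q. f q + g q)"
proof -
  obtain d F G where F: "p \<in> C" "hom_poly d F" "hom_poly d G" "G (rep p) \<noteq> 0" "f p = F (rep p) / G (rep p)"
    "\<forall>\<^sub>F q in \<eta>. f q = F (rep q) / G (rep q)" "\<forall>\<^sub>F q in \<eta>. G (rep q) \<noteq> 0" using regE[OF assms(1)] .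
  obtain e H K where H': "p \<in> C" and H: "hom_poly e H" "hom_poly e K" "K (rep p) \<noteq> 0" "g p = H (rep p) / K (rep p)"
    "\<forall>\<^sub>F q in \<eta>. g q = H (rep q) / K (rep q)" "\<forall>\<^sub>F q in \<eta>. K (rep q) \<noteq> 0" using regE[OF assms(2)] .
  have 1: "hom_poly (d + e) (\<lambda>x. F x * K x + G x * H x)"
    by (intro hom_poly.add hom_poly_prod F H)
  have 2: "hom_poly (d + e) (\<lambda>x. G x * K x)" by (intro hom_poly_prod F H)
  have 3: "\<forall>\<^sub>F q in \<eta>. f q + g q = (F (rep q) * K (rep q) + G (rep q) * H (rep q)) / (G (rep q) * K (rep q))"
    using F(6,7) H(5,6) by eventually_elim (simp add: field_simps)
  show ?thesis by (rule regI[OF F(1) 1 2 _ _ 3]) (use F H in \<open>simp_all add: field_simps\<close>)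
qed

lemma reg_mult:
  assumes "reg p f" "reg p g"
  shows "reg p (\<lambda>q. f q * g q)"
proof -
  obtain d F G where F: "p \<in> C" "hom_poly d F" "hom_poly d G" "G (rep p) \<noteq> 0" "f p = F (rep p) / G (rep p)"
    "\<forall>\<^sub>F q in \<eta>. f q = F (rep q) / G (rep q)" "\<forall>\<^sub>F q in \<eta>. G (rep q) \<noteq> 0" using regE[OF assms(1)] .
  obtain e H K where H': "p \<in> C" and H: "hom_poly e H" "hom_poly e K" "K (rep p) \<noteq> 0" "g p = H (rep p) / K (rep p)"
    "\<forall>\<^sub>F q in \<eta>. g q = H (rep q) / K (rep q)" "\<forall>\<^sub>F q in \<eta>. K (rep q) \<noteq> 0" using regE[OF assms(2)] .
  have 1: "hom_poly (d + e) (\<lambda>x. F x * H x)" "hom_poly (d + e) (\<lambda>x. G x * K x)"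
    by (rule hom_poly_prod[OF F(2) H(1)], rule hom_poly_prod[OF F(3) H(2)])
  have 3: "\<forall>\<^sub>F q in \<eta>. f q * g q = (F (rep q) * H (rep q)) / (G (rep q) * K (rep q))"
    using F(6) H(5) by eventually_elim simp
  show ?thesis by (rule regI[OF F(1) 1 _ _ 3]) (use F H in simp_all)
qed

lemma reg_inverse:
  assumes "reg p f" "f p \<noteq> 0"
  shows "reg p (\<lambda>q. inverse (f q))"
proof -
  obtain d F G where F: "p \<in> C" "hom_poly d F" "hom_poly d G" "G (rep p) \<noteq> 0" "f p = F (rep p) / G (rep p)"
    "\<forall>\<^sub>F q in \<eta>. f q = F (rep q) / G (rep q)" "\<forall>\<^sub>F q in \<eta>. G (rep q) \<noteq> 0" using regE[OF assms(1)] .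
  have "\<forall>\<^sub>F q in \<eta>. inverse (f q) = G (rep q) / F (rep q)" using F(6) by eventually_elim simp
  then show ?thesis using F assms(2) by (intro regI[OF F(1,3,2)]) auto
qed

lemma reg_cmult: "reg p f \<Longrightarrow> reg p (\<lambda>q. c * f q)"
  by (rule reg_mult[OF reg_const]) (auto intro: reg_in_C)

lemma reg_diff: "reg p f \<Longrightarrow> reg p g \<Longrightarrow> reg p (\<lambda>q. f q - g q)"
  using reg_add[OF _ reg_cmult[of p g "-1"], of f] by simp

lemma reg_power:
  assumes "reg p f"
  shows "reg p (\<lambda>q. f q ^ n)"
proof (induction n)
  case (Suc n)
  then show ?case using reg_mult[OF assms Suc] by simp
qed (simp add: reg_const reg_in_C[OF assms])

text \<open>A numerator vanishing almost everywhere vanishes on the whole curve. Hence the generic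
  values of a regular function determine its value at \<open>p\<close>.\<close>

lemma reg_zero:
  assumes "reg p f" "f \<doteq> (\<lambda>_. 0)"
  shows "f p = 0"
proof -
  obtain d F G where F: "p \<in> C" "hom_poly d F" and G: "hom_poly d G" "G (rep p) \<noteq> 0"
    and F': "f p = F (rep p) / G (rep p)" "\<forall>\<^sub>F q in \<eta>. f q = F (rep q) / G (rep q)"
      "\<forall>\<^sub>F q in \<eta>. G (rep q) \<noteq> 0" using regE[OF assms(1)] .
  have "\<forall>\<^sub>F q in \<eta>. F (rep q) = 0" using F'(2,3) assms(2) by eventually_elim simp
  from hom_poly_ae_zero[OF F(2) this F(1)] show ?thesis using F'(1) by simp
qed

lemma reg_unique:
  assumes "reg p f" "reg p g" "f \<doteq> g"
  shows "f p = g p"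
proof -
  have "\<forall>\<^sub>F q in \<eta>. f q - g q = 0" using assms(3) by eventually_elim simp
  from reg_zero[OF reg_diff[OF assms(1,2)] this] show ?thesis by simp
qed

lemma reg_nz: "reg p u \<Longrightarrow> u p \<noteq> 0 \<Longrightarrow> nz u"
  using rational_dichotomy[OF reg_rational] reg_zero by blast

text \<open>Numerator and denominator are divided by the same power of a linear form that is nonzero
  at \<open>p\<close>, which makes each of them regular there.\<close>

lemma rational_quotient:
  assumes "rational f" "p \<in> C"
  obtains A B where "reg p A" "reg p B" "nz B" "\<forall>\<^sub>F q in \<eta>. f q = A q / B q"
proof -
  obtain d F G where F: "hom_poly d F" "hom_poly d G" "\<forall>\<^sub>F q in \<eta>. G (rep q) \<noteq> 0"
    "\<forall>\<^sub>F q in \<eta>. f q = F (rep q) / G (rep q)" using rationalE[OF assms(1)] .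
  obtain L :: "complex ^ 'n \<Rightarrow> complex" where L: "clinear L" "L (rep p) = 1"
    using nonzero_functional[OF rep(1)[OF C_proj[OF assms(2)]]] .
  have Ld: "hom_poly d (\<lambda>x. L x ^ d)" using hom_poly_power[OF hom_poly_clinear[OF L(1)], of d] by simp
  have L0: "\<forall>\<^sub>F q in \<eta>. L (rep q) ^ d \<noteq> 0" using hom_poly_ae_nonzero[OF Ld assms(2)] L(2) by simp
  have "reg p (\<lambda>q. F (rep q) / L (rep q) ^ d)" by (rule regI[OF assms(2) F(1) Ld]) (use L in auto)
  moreover have "reg p (\<lambda>q. G (rep q) / L (rep q) ^ d)" by (rule regI[OF assms(2) F(2) Ld]) (use L in auto)
  moreover have "nz (\<lambda>q. G (rep q) / L (rep q) ^ d)"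
    unfolding nz_def using F(3) L0 by eventually_elim simp
  moreover have "\<forall>\<^sub>F q in \<eta>. f q = (F (rep q) / L (rep q) ^ d) / (G (rep q) / L (rep q) ^ d)"
    using F(4) L0 by eventually_elim simp
  ultimately show ?thesis by (rule that)
qed

lemma rational_ae_reg:
  assumes "rational f"
  shows "\<forall>\<^sub>F p in \<eta>. reg p f"
proof -
  obtain d F G where F: "hom_poly d F" "hom_poly d G" "\<forall>\<^sub>F q in \<eta>. G (rep q) \<noteq> 0"
    "\<forall>\<^sub>F q in \<eta>. f q = F (rep q) / G (rep q)" using rationalE[OF assms(1)] .
  have "\<forall>\<^sub>F q in \<eta>. q \<in> C" by (rule ae_I)
  then show ?thesis using F(3,4)
  proof eventually_elim
    case (elim q)
    then show ?case using F by (intro regI[OF _ F(1,2)])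
  qed
qed

text \<open>Both functions are regular at almost all points; at a common one the claim is about the
  local ring.\<close>

lemma rational_mult:
  assumes "rational f" "rational g"
  shows "rational (\<lambda>q. f q * g q)"
proof -
  obtain p where "reg p f" "reg p g"
    using eventually_ex[OF eventually_conj[OF assms[THEN rational_ae_reg]]] by blast
  from reg_rational[OF reg_mult[OF this]] show ?thesis .
qed

lemma rational_inverse:
  assumes "rational f"
  shows "rational (\<lambda>q. inverse (f q))"
  using rational_dichotomy[OF assms]
proof
  assume "f \<doteq> (\<lambda>_. 0)"
  then have "\<forall>\<^sub>F q in \<eta>. inverse (f q) = 0" by eventually_elim simp
  then show ?thesis by (rule rational_cong[OF _ rational_const])
next
  assume "nz f"
  then obtain p where "reg p f" "f p \<noteq> 0"
    using eventually_ex[OF eventually_conj[OF rational_ae_reg[OF assms]]] unfolding nz_def by blast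
  from reg_rational[OF reg_inverse[OF this]] show ?thesis .
qed

lemma rational_power:
  assumes "rational f"
  shows "rational (\<lambda>q. f q ^ n)"
proof (induction n)
  case (Suc n)
  then show ?case using rational_mult[OF assms Suc] by simp
qed (simp add: rational_const)

lemma rational_powi: "rational f \<Longrightarrow> rational (\<lambda>q. f q powi n)"
  by (cases "n \<ge> 0") (simp_all add: power_int_def rational_power rational_power[OF rational_inverse])

lemma nonzero_rational_iff: "nonzero_rational C f \<longleftrightarrow> rational f \<and> nz f"
proof
  assume "nonzero_rational C f"
  then obtain p where "p \<in> C" "reg p f" "f p \<noteq> 0"
    unfolding nonzero_rational_def using reg_in_C by blast
  then show "rational f \<and> nz f" using reg_rational reg_nz by blast
next
  assume f: "rational f \<and> nz f"
  then have ev: "\<forall>\<^sub>F p in \<eta>. reg p f \<and> f p \<noteq> 0"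
    using rational_ae_reg[of f] by (auto simp: nz_def intro: eventually_conj)
  have "finite (C - {p \<in> C. reg p f \<and> f p \<noteq> 0})"
    using ev unfolding eventually_ae by (rule rev_finite_subset) auto
  then have "openin (zariski_on C) {p \<in> C. reg p f \<and> f p \<noteq> 0}" by (simp add: openin_C_iff)
  then show "nonzero_rational C f"
    unfolding nonzero_rational_def using eventually_ex[OF ev]
    by (intro exI[of _ "{p \<in> C. reg p f \<and> f p \<noteq> 0}"]) auto
qed

section \<open>Uniformizers and orders\<close>

lemma uniformizer_iff:
  assumes "p \<in> C"
  shows "uniformizer C p t \<longleftrightarrow> reg p t \<and> t p = 0 \<and>
    (\<forall>h. reg p h \<and> h p = 0 \<longrightarrow> (\<exists>k. reg p k \<and> h \<doteq> (\<lambda>q. t q * k q)))"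
  unfolding uniformizer_def eventually_nhdsin_C[OF assms] by auto

lemma uniformizerD:
  assumes "p \<in> C" "uniformizer C p t"
  shows "reg p t" "t p = 0"
    "reg p h \<Longrightarrow> h p = 0 \<Longrightarrow> \<exists>k. reg p k \<and> h \<doteq> (\<lambda>q. t q * k q)"
  using assms(2) unfolding uniformizer_iff[OF assms(1)] by blast+

text \<open>The local ring is not a field: a linear form that vanishes at \<open>p\<close> but not
  at some other point gives a nonzero element of the maximal ideal, which a zero uniformizer could
  not divide.\<close>

lemma uniformizer_nz:
  assumes "p \<in> C" "uniformizer C p t"
  shows "nz t"
proof (rule ccontr)
  assume "\<not> nz t"
  then have t0: "t \<doteq> (\<lambda>_. 0)"
    using rational_dichotomy[OF reg_rational[OF uniformizerD(1)[OF assms]]] by blast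
  have "infinite (C - {p})" using infinite_C by simp
  then obtain q where q: "q \<in> C" "q \<noteq> p" using infinite_imp_nonempty by blast
  obtain \<phi> :: "complex ^ 'n \<Rightarrow> complex" where \<phi>: "clinear \<phi>" "\<phi> (rep p) = 0" "\<phi> (rep q) = 1"
    using points_separated[OF C_proj[OF assms(1)] C_proj[OF q(1)] q(2)[symmetric]] .
  obtain L :: "complex ^ 'n \<Rightarrow> complex" where L: "clinear L" "L (rep p) = 1"
    using nonzero_functional[OF rep(1)[OF C_proj[OF assms(1)]]] .
  note h = hom_poly_clinear[OF \<phi>(1)] hom_poly_clinear[OF L(1)]
  have "reg p (\<lambda>q. \<phi> (rep q) / L (rep q))" by (rule regI[OF assms(1) h]) (use L in auto)
  from uniformizerD(3)[OF assms this] obtain k where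
    "(\<lambda>q. \<phi> (rep q) / L (rep q)) \<doteq> (\<lambda>q. t q * k q)" using \<phi> by auto
  moreover have "\<forall>\<^sub>F q in \<eta>. L (rep q) \<noteq> 0" using hom_poly_ae_nonzero[OF h(2) assms(1)] L by simp
  ultimately have "\<forall>\<^sub>F q in \<eta>. \<phi> (rep q) = 0" using t0 by eventually_elim simp
  from hom_poly_ae_zero[OF h(1) this q(1)] \<phi> show False by simp
qed

lemma reg_fun_alg:
  assumes "p \<in> C" "clinear L" "L (rep p) \<noteq> 0" "r \<in> fun_alg (range (\<lambda>i x. x $ i / L x))"
  shows "reg p (\<lambda>q. r (rep q))"
  using assms(4)
proof induction
  case (gen f)
  then obtain i where i: "f = (\<lambda>x. x $ i / L x)" by auto
  have "clinear (\<lambda>x :: complex ^ 'n. x $ i)" by (simp add: clinear_iff scaleC_vec_def)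
  then show ?case unfolding i
    by (intro regI[OF assms(1) hom_poly_clinear hom_poly_clinear[OF assms(2)]]) (use assms in auto)
qed (use assms(1) in \<open>auto intro: reg_const reg_add reg_mult\<close>)

text \<open>If \<open>h\<close> were divisible by every power of \<open>t\<close>, the quotients \<open>h / t\<^sup>n\<close> would generate a strictly
  increasing sequence of ideals of the local ring.\<close>

lemma regular_decomposition:
  assumes p: "p \<in> C" and t: "uniformizer C p t" and h: "reg p h" "nz h"
  shows "\<exists>n u. reg p u \<and> u p \<noteq> 0 \<and> h \<doteq> (\<lambda>q. t q ^ n * u q)"
proof (rule ccontr)
  assume no: "\<nexists>n u. reg p u \<and> u p \<noteq> 0 \<and> h \<doteq> (\<lambda>q. t q ^ n * u q)"
  have "\<exists>u. \<forall>n. (reg p (u n) \<and> h \<doteq> (\<lambda>q. t q ^ n * u n q)) \<and> u n \<doteq> (\<lambda>q. t q * u (Suc n) q)"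
  proof (rule dependent_nat_choice)
    show "\<exists>u. reg p u \<and> h \<doteq> (\<lambda>q. t q ^ 0 * u q)" using h by (intro exI[of _ h]) auto
  next
    fix u and n :: nat assume u: "reg p u \<and> h \<doteq> (\<lambda>q. t q ^ n * u q)"
    then have "u p = 0" using no by blast
    then obtain k where k: "reg p k" "u \<doteq> (\<lambda>q. t q * k q)" using uniformizerD(3)[OF p t] u by blast
    have "h \<doteq> (\<lambda>q. t q ^ Suc n * k q)"
      using conjunct2[OF u] k(2) by eventually_elim simp
    then show "\<exists>v. (reg p v \<and> h \<doteq> (\<lambda>q. t q ^ Suc n * v q)) \<and> u \<doteq> (\<lambda>q. t q * v q)"
      using k by blast
  qed
  then obtain u where ureg: "\<And>n. reg p (u n)" and hu: "\<And>n. h \<doteq> (\<lambda>q. t q ^ n * u n q)"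
    and u: "\<And>n. u n \<doteq> (\<lambda>q. t q * u (Suc n) q)" by blast
  have unz: "nz (u n)" for n
    using h(2) hu[of n] unfolding nz_def by eventually_elim auto
  \<comment> \<open>Descending along the sequence, \<open>u i\<close> is divisible by
    \<open>t\<close> times any later term.\<close>
  have umult: "\<exists>y. reg p y \<and> u i \<doteq> (\<lambda>q. t q * u (Suc (i + m)) q * y q)" for i m
  proof (induction m)
    case 0
    show ?case using u[of i] reg_const[OF p, of 1] by (intro exI[of _ "\<lambda>_. 1"]) simp
  next
    case (Suc m)
    then obtain y where y: "reg p y" "u i \<doteq> (\<lambda>q. t q * u (Suc (i + m)) q * y q)" by blast
    have "u i \<doteq> (\<lambda>q. t q * u (Suc (i + Suc m)) q * (t q * y q))"
      using y(2) u[of "Suc (i + m)"] by eventually_elim (simp add: ac_simps)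
    then show ?case using reg_mult[OF uniformizerD(1)[OF p t] y(1)] by blast
  qed
  obtain L :: "complex ^ 'n \<Rightarrow> complex" where L: "clinear L" "L (rep p) = 1"
    using nonzero_functional[OF rep(1)[OF C_proj[OF p]]] .
  let ?R = "fun_alg (range (\<lambda>i (x :: complex ^ 'n). x $ i / L x))"
  \<comment> \<open>The local ring is not a finitely generated algebra. Each \<open>u n\<close> is
    therefore written as a fraction over the affine coordinate algebra, with denominator nonzero at
    \<open>p\<close>, and the Noetherian property is applied to the numerators.\<close>
  have "\<exists>a b. a \<in> ?R \<and> b \<in> ?R \<and> b (rep p) \<noteq> 0 \<and> (\<lambda>q. a (rep q)) \<doteq> (\<lambda>q. b (rep q) * u n q)" for n
  proof -
    obtain d F G where F0: "p \<in> C" "hom_poly d F" "hom_poly d G" "G (rep p) \<noteq> 0" "u n p = F (rep p) / G (rep p)"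
      "\<forall>\<^sub>F q in \<eta>. u n q = F (rep q) / G (rep q)" "\<forall>\<^sub>F q in \<eta>. G (rep q) \<noteq> 0"
      using regE[OF ureg[of n]] .
    note F = F0(1-4,6,7)
    have "\<forall>\<^sub>F q in \<eta>. F (rep q) / L (rep q) ^ d = G (rep q) / L (rep q) ^ d * u n q"
      using F(5,6) by eventually_elim simp
    then show ?thesis
      using hom_poly_quotient_fun_alg[OF F(2), of L] hom_poly_quotient_fun_alg[OF F(3), of L] F(4) L
      by (intro exI[of _ "\<lambda>x. F x / L x ^ d"] exI[of _ "\<lambda>x. G x / L x ^ d"]) auto
  qed
  then have "\<forall>n. \<exists>a b. a \<in> ?R \<and> b \<in> ?R \<and> b (rep p) \<noteq> 0 \<and> (\<lambda>q. a (rep q)) \<doteq> (\<lambda>q. b (rep q) * u n q)" ..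
  from choice[OF this] obtain a where "\<forall>n. \<exists>b. a n \<in> ?R \<and> b \<in> ?R \<and> b (rep p) \<noteq> 0 \<and>
    (\<lambda>q. a n (rep q)) \<doteq> (\<lambda>q. b (rep q) * u n q)" ..
  from choice[OF this] obtain b where "\<forall>n. a n \<in> ?R \<and> b n \<in> ?R \<and> b n (rep p) \<noteq> 0 \<and>
    (\<lambda>q. a n (rep q)) \<doteq> (\<lambda>q. b n (rep q) * u n q)" ..
  then have ab: "\<And>n. a n \<in> ?R" "\<And>n. b n \<in> ?R" "\<And>n. b n (rep p) \<noteq> 0"
    "\<And>n. (\<lambda>q. a n (rep q)) \<doteq> (\<lambda>q. b n (rep q) * u n q)" by blast+
  have "noeth_ring ?R" by (rule noeth_fun_alg) simp
  then obtain n where n: "a n \<in> gen_ideal ?R (a ` {..<n})"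
    using ab(1) unfolding noeth_ring_def by blast
  have reg_alg: "reg p (\<lambda>q. r (rep q))" if "r \<in> ?R" for r
    using reg_fun_alg[OF p L(1) _ that] L(2) by simp
  have "\<exists>y. reg p y \<and> (\<lambda>q. x (rep q)) \<doteq> (\<lambda>q. t q * u n q * y q)"
    if "x \<in> gen_ideal ?R (a ` {..<n})" for x
    using that
  proof induction
    case zero
    show ?case using reg_const[OF p, of 0] by (intro exI[of _ "\<lambda>_. 0"]) simp
  next
    case (step r x z)
    then obtain y where y: "reg p y" "(\<lambda>q. z (rep q)) \<doteq> (\<lambda>q. t q * u n q * y q)" by blast
    obtain i where i: "i < n" "x = a i" using step by auto
    obtain w where w: "reg p w" "u i \<doteq> (\<lambda>q. t q * u n q * w q)"
      using umult[of i "n - Suc i"] i(1) by auto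
    have "(\<lambda>q. (r * x + z) (rep q)) \<doteq>
        (\<lambda>q. t q * u n q * (r (rep q) * b i (rep q) * w q + y q))"
      using y(2) w(2) ab(4)[of i] unfolding i(2) by eventually_elim (simp add: algebra_simps)
    moreover have "reg p (\<lambda>q. r (rep q) * b i (rep q) * w q + y q)"
      using step ab(2) y w by (intro reg_add reg_mult reg_alg)
    ultimately show ?case by blast
  qed
  from this[OF n] obtain y where y: "reg p y" "(\<lambda>q. a n (rep q)) \<doteq> (\<lambda>q. t q * u n q * y q)" by blast
  \<comment> \<open>Cancelling \<open>u n\<close> makes the denominator \<open>b n\<close> divisible
    by \<open>t\<close>, although it does not vanish at \<open>p\<close>.\<close>
  have "(\<lambda>q. b n (rep q)) \<doteq> (\<lambda>q. t q * y q)"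
    using y(2) ab(4)[of n] unz[of n] unfolding nz_def by eventually_elim simp
  then have "b n (rep p) = t p * y p"
    by (intro reg_unique[of p "\<lambda>q. b n (rep q)"] reg_alg ab reg_mult y uniformizerD(1)[OF p t])
  then show False using ab(3)[of n] uniformizerD(2)[OF p t] by simp
qed

definition unit_at :: "'n pt \<Rightarrow> 'n cfun \<Rightarrow> bool" where
  "unit_at p u \<longleftrightarrow> reg p u \<and> u p \<noteq> 0"

lemma unit_at_mult: "unit_at p u \<Longrightarrow> unit_at p v \<Longrightarrow> unit_at p (\<lambda>q. u q * v q)"
  unfolding unit_at_def by (auto intro: reg_mult)

lemma unit_at_inverse: "unit_at p u \<Longrightarrow> unit_at p (\<lambda>q. inverse (u q))"
  unfolding unit_at_def by (auto intro: reg_inverse)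

lemma unit_at_powi: "unit_at p u \<Longrightarrow> unit_at p (\<lambda>q. u q powi n)"
  by (cases "n \<ge> 0") (simp_all add: unit_at_def power_int_def reg_power reg_power[OF reg_inverse])

lemma unit_at_nz: "unit_at p u \<Longrightarrow> nz u"
  unfolding unit_at_def using reg_nz by blast

lemma rational_decomposition:
  assumes p: "p \<in> C" and t: "uniformizer C p t" and f: "rational f" "nz f"
  shows "\<exists>n u. unit_at p u \<and> f \<doteq> (\<lambda>q. t q powi n * u q)"
proof -
  obtain A B where AB: "reg p A" "reg p B" "nz B" "\<forall>\<^sub>F q in \<eta>. f q = A q / B q"
    using rational_quotient[OF f(1) p] .
  have "nz A" using AB(4) f(2) unfolding nz_def by eventually_elim auto
  then obtain n u m v where u: "reg p u" "u p \<noteq> 0" "A \<doteq> (\<lambda>q. t q ^ n * u q)"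
    and v: "reg p v" "v p \<noteq> 0" "B \<doteq> (\<lambda>q. t q ^ m * v q)"
    using regular_decomposition[OF p t AB(1)] regular_decomposition[OF p t AB(2,3)] by blast
  have uv: "unit_at p (\<lambda>q. u q * inverse (v q))"
    by (intro unit_at_mult unit_at_inverse) (use u v in \<open>auto simp: unit_at_def\<close>)
  have "f \<doteq> (\<lambda>q. t q powi (int n - int m) * (u q * inverse (v q)))"
    using AB(4) u(3) v(3) uniformizer_nz[OF p t] unfolding nz_def
    by eventually_elim (simp add: power_int_diff field_simps)
  then show ?thesis using uv by blast
qed

lemma uniformizer_associated:
  assumes p: "p \<in> C" and t: "uniformizer C p t" and s: "uniformizer C p s"
  shows "\<exists>k. unit_at p k \<and> s \<doteq> (\<lambda>q. t q * k q)"
proof -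
  obtain k where k: "reg p k" "s \<doteq> (\<lambda>q. t q * k q)"
    using uniformizerD(3)[OF p t] uniformizerD(1,2)[OF p s] by blast
  obtain l where l: "reg p l" "t \<doteq> (\<lambda>q. s q * l q)"
    using uniformizerD(3)[OF p s] uniformizerD(1,2)[OF p t] by blast
  have "(\<lambda>q. k q * l q) \<doteq> (\<lambda>_. 1)"
    using k(2) l(2) uniformizer_nz[OF p t] unfolding nz_def by eventually_elim (auto simp: field_simps)
  from reg_unique[OF reg_mult[OF k(1) l(1)] reg_const[OF p] this] have "k p \<noteq> 0" by auto
  then show ?thesis using k unfolding unit_at_def by blast
qed

lemma powi_not_unit:
  assumes p: "p \<in> C" and t: "uniformizer C p t" and u: "unit_at p u" and "(\<lambda>q. t q powi n) \<doteq> u"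
  shows "n = 0"
proof -
  have *: "n \<le> 0" if u: "unit_at p u" and eq: "(\<lambda>q. t q powi n) \<doteq> u" for n u
  proof (rule ccontr)
    assume "\<not> n \<le> 0"
    then have "n = int (Suc (nat n - 1))" by simp
    then obtain m where m: "n = int (Suc m)" ..
    have "(\<lambda>q. t q ^ Suc m) \<doteq> u" using eq unfolding m power_int_of_nat .
    then have "t p ^ Suc m = u p"
      using u unfolding unit_at_def by (intro reg_unique[of p "\<lambda>q. t q ^ Suc m"] reg_power uniformizerD(1)[OF p t]) auto
    then show False using u uniformizerD(2)[OF p t] by (simp add: unit_at_def)
  qed
  have "(\<lambda>q. t q powi (- n)) \<doteq> (\<lambda>q. inverse (u q))"
    using assms(4) by eventually_elim (simp add: power_int_minus)
  from *[OF unit_at_inverse[OF u] this] *[OF u assms(4)] show ?thesis by simp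
qed

text \<open>Another uniformizer differs from \<open>t\<close> by a unit, so two factorisations with
  different exponents would make a nontrivial power of \<open>t\<close> a unit. This is the
  uniqueness behind the description in \<open>ord_at\<close>.\<close>

lemma ord_at_eq:
  assumes p: "p \<in> C" and t: "uniformizer C p t" and u: "unit_at p u" and f: "f \<doteq> (\<lambda>q. t q powi n * u q)"
  shows "ord_at C p f = n"
  unfolding ord_at_def eventually_atin_C[OF p]
proof (rule the_equality)
  show "\<exists>t u. uniformizer C p t \<and> reg p u \<and> u p \<noteq> 0 \<and> (\<forall>\<^sub>F q in \<eta>. f q = t q powi n * u q)"
    using t u f unfolding unit_at_def by blast
next
  fix m assume "\<exists>t u. uniformizer C p t \<and> reg p u \<and> u p \<noteq> 0 \<and> (\<forall>\<^sub>F q in \<eta>. f q = t q powi m * u q)"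
  then obtain s v where s: "uniformizer C p s" and v: "unit_at p v" and f': "f \<doteq> (\<lambda>q. s q powi m * v q)"
    unfolding unit_at_def by blast
  obtain k where k: "unit_at p k" "s \<doteq> (\<lambda>q. t q * k q)" using uniformizer_associated[OF p t s] by blast
  have "(\<lambda>q. t q powi (n - m)) \<doteq> (\<lambda>q. k q powi m * (v q * inverse (u q)))"
    using f f' k(2) uniformizer_nz[OF p t] unit_at_nz[OF u] unfolding nz_def
    by eventually_elim (simp add: power_int_diff power_int_mult_distrib field_simps)
  then have "n - m = 0"
    by (rule powi_not_unit[OF p t, rotated]) (intro unit_at_mult unit_at_powi unit_at_inverse k u v)
  then show "m = n" by simp
qed

end

text \<open>Uniformizers make \<open>ord_at\<close> a valuation at every point; in genus one they
  are supplied by \<open>uniformizer_exists\<close>.\<close>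

locale smooth_curve = projective_curve C for C :: "'n::finite pt set" +
  assumes uniformizer_ex: "p \<in> C \<Longrightarrow> \<exists>t. uniformizer C p t"
begin

lemma ord_at_decomposition:
  assumes "p \<in> C" "uniformizer C p t" "rational f" "nz f"
  shows "\<exists>u. unit_at p u \<and> f \<doteq> (\<lambda>q. t q powi (ord_at C p f) * u q)"
proof -
  obtain n u where u: "unit_at p u" "f \<doteq> (\<lambda>q. t q powi n * u q)"
    using rational_decomposition[OF assms] by (elim exE conjE)
  then show ?thesis using ord_at_eq[OF assms(1,2) u] by (intro exI[of _ u]) simp
qed

lemma ord_at_mult:
  assumes p: "p \<in> C" and f: "rational f" "nz f" and g: "rational g" "nz g"
  shows "ord_at C p (\<lambda>q. f q * g q) = ord_at C p f + ord_at C p g"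
proof -
  obtain t where t: "uniformizer C p t" using uniformizer_ex[OF p] ..
  obtain u where u: "unit_at p u" "f \<doteq> (\<lambda>q. t q powi (ord_at C p f) * u q)"
    using ord_at_decomposition[OF p t f] by (elim exE conjE)
  obtain w where w: "unit_at p w" "g \<doteq> (\<lambda>q. t q powi (ord_at C p g) * w q)"
    using ord_at_decomposition[OF p t g] by (elim exE conjE)
  have "\<forall>\<^sub>F q in \<eta>. f q * g q = t q powi (ord_at C p f + ord_at C p g) * (u q * w q)"
    using u(2) w(2) uniformizer_nz[OF p t] unfolding nz_def
    by eventually_elim (simp add: power_int_add)
  from ord_at_eq[OF p t unit_at_mult[OF u(1) w(1)] this] show ?thesis .
qed

lemma ord_at_const:
  assumes "p \<in> C" "c \<noteq> 0"
  shows "ord_at C p (\<lambda>_. c) = 0"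
proof -
  obtain t where t: "uniformizer C p t" using uniformizer_ex[OF assms(1)] ..
  have u: "unit_at p (\<lambda>_. c)" using assms reg_const by (simp add: unit_at_def)
  show ?thesis by (rule ord_at_eq[OF assms(1) t u]) simp
qed

lemma ord_at_cong:
  assumes p: "p \<in> C" and f: "rational f" "nz f" and "f \<doteq> g"
  shows "ord_at C p g = ord_at C p f"
proof -
  obtain t where t: "uniformizer C p t" using uniformizer_ex[OF p] ..
  obtain u where u: "unit_at p u" "f \<doteq> (\<lambda>q. t q powi (ord_at C p f) * u q)"
    using ord_at_decomposition[OF p t f] by (elim exE conjE)
  have "g \<doteq> (\<lambda>q. t q powi (ord_at C p f) * u q)" using assms(4) u(2) by eventually_elim simp
  from ord_at_eq[OF p t u(1) this] show ?thesis .
qed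

lemma ord_at_inverse:
  assumes p: "p \<in> C" and f: "rational f" "nz f"
  shows "ord_at C p (\<lambda>q. inverse (f q)) = - ord_at C p f"
proof -
  have "(\<lambda>_. 1) \<doteq> (\<lambda>q. f q * inverse (f q))" using f(2) unfolding nz_def by eventually_elim simp
  from ord_at_cong[OF p rational_const nz_const this]
  have "ord_at C p (\<lambda>q. f q * inverse (f q)) = 0" using ord_at_const[OF p, of 1] by simp
  then show ?thesis using ord_at_mult[OF p f rational_inverse[OF f(1)] nz_inverse[OF f(2)]] by simp
qed

lemma ord_at_power:
  assumes p: "p \<in> C" and f: "rational f" "nz f"
  shows "ord_at C p (\<lambda>q. f q ^ n) = int n * ord_at C p f"
proof (induction n)
  case (Suc n)
  then show ?case
    using ord_at_mult[OF p f rational_power[OF f(1), of n] nz_power[OF f(2), of n]]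
    by (simp add: algebra_simps)
qed (simp add: ord_at_const[OF p])

lemma ord_at_powi:
  assumes p: "p \<in> C" and f: "rational f" "nz f"
  shows "ord_at C p (\<lambda>q. f q powi n) = n * ord_at C p f"
proof (cases "n \<ge> 0")
  case True
  then show ?thesis using ord_at_power[OF assms, of "nat n"] by (simp add: power_int_def)
next
  case False
  then show ?thesis
    using ord_at_power[OF p rational_inverse[OF f(1)] nz_inverse[OF f(2)], of "nat (- n)"]
      ord_at_inverse[OF assms] by (simp add: power_int_def)
qed

text \<open>Gives the zero function infinite order. \<open>ord_at\<close> has no meaningful value
  there, so bounds that must survive sums are stated through this predicate.\<close>

definition vge :: "'n pt \<Rightarrow> int \<Rightarrow> 'n cfun \<Rightarrow> bool" where
  "vge p n f \<longleftrightarrow> rational f \<and> (f \<doteq> (\<lambda>_. 0) \<or> n \<le> ord_at C p f)"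

lemma vge_rational: "vge p n f \<Longrightarrow> rational f"
  by (simp add: vge_def)

lemma vge_mono: "vge p n f \<Longrightarrow> m \<le> n \<Longrightarrow> vge p m f"
  by (auto simp: vge_def)

lemma vge_ord: "rational f \<Longrightarrow> n \<le> ord_at C p f \<Longrightarrow> vge p n f"
  by (simp add: vge_def)

lemma vge_nz: "vge p n f \<Longrightarrow> nz f \<Longrightarrow> n \<le> ord_at C p f"
  using nz_not_zero by (auto simp: vge_def)

text \<open>The fractional ideal generated by the \<open>n\<close>-th power of \<open>t\<close>; in
  this form closure under sums and products is immediate.\<close>

lemma vge_iff:
  assumes p: "p \<in> C" and t: "uniformizer C p t"
  shows "vge p n f \<longleftrightarrow> (\<exists>w. reg p w \<and> f \<doteq> (\<lambda>q. t q powi n * w q))"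
proof
  assume v: "vge p n f"
  show "\<exists>w. reg p w \<and> f \<doteq> (\<lambda>q. t q powi n * w q)"
  proof (cases "nz f")
    case False
    then have "f \<doteq> (\<lambda>_. 0)" using rational_dichotomy[OF vge_rational[OF v]] by blast
    then show ?thesis using reg_const[OF p, of 0] by (intro exI[of _ "\<lambda>_. 0"]) simp
  next
    case True
    obtain u where u: "unit_at p u" "f \<doteq> (\<lambda>q. t q powi (ord_at C p f) * u q)"
      using ord_at_decomposition[OF p t vge_rational[OF v] True] by (elim exE conjE)
    define k where "k = nat (ord_at C p f - n)"
    have k: "ord_at C p f = n + int k" using vge_nz[OF v True] by (simp add: k_def)
    have "f \<doteq> (\<lambda>q. t q powi n * (t q ^ k * u q))"
      using u(2) uniformizer_nz[OF p t] unfolding nz_def k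
      by eventually_elim (simp add: power_int_add)
    moreover have "reg p (\<lambda>q. t q ^ k * u q)"
      using u(1) unfolding unit_at_def by (intro reg_mult reg_power uniformizerD(1)[OF p t]) simp
    ultimately show ?thesis by (intro exI[of _ "\<lambda>q. t q ^ k * u q"] conjI)
  qed
next
  assume "\<exists>w. reg p w \<and> f \<doteq> (\<lambda>q. t q powi n * w q)"
  then obtain w where w: "reg p w" "f \<doteq> (\<lambda>q. t q powi n * w q)" by (elim exE conjE)
  have "rational (\<lambda>q. t q powi n * w q)"
    by (intro rational_mult rational_powi reg_rational[OF w(1)] reg_rational[OF uniformizerD(1)[OF p t]])
  then have f: "rational f" by (rule rational_cong[OF w(2)])
  show "vge p n f"
  proof (cases "nz f")
    case False
    then show ?thesis using f rational_dichotomy by (auto simp: vge_def)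
  next
    case True
    have "nz w" using w(2) True unfolding nz_def by eventually_elim auto
    obtain k u where u: "reg p u" "u p \<noteq> 0" "w \<doteq> (\<lambda>q. t q ^ k * u q)"
      using regular_decomposition[OF p t w(1) \<open>nz w\<close>] by blast
    have "f \<doteq> (\<lambda>q. t q powi (n + int k) * u q)"
      using w(2) u(3) uniformizer_nz[OF p t] unfolding nz_def
      by eventually_elim (simp add: power_int_add)
    then have "ord_at C p f = n + int k"
      by (rule ord_at_eq[OF p t, rotated]) (simp add: unit_at_def u)
    then show ?thesis using f by (simp add: vge_def)
  qed
qed

lemma vge_cong: "p \<in> C \<Longrightarrow> f \<doteq> g \<Longrightarrow> vge p n f \<Longrightarrow> vge p n g"
proof -
  assume p: "p \<in> C" and fg: "f \<doteq> g" and v: "vge p n f"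
  obtain t where t: "uniformizer C p t" using uniformizer_ex[OF p] ..
  obtain w where w: "reg p w" "f \<doteq> (\<lambda>q. t q powi n * w q)"
    using v unfolding vge_iff[OF p t] by (elim exE conjE)
  have "g \<doteq> (\<lambda>q. t q powi n * w q)" using fg w(2) by eventually_elim simp
  then show "vge p n g" unfolding vge_iff[OF p t] using w(1) by (intro exI[of _ w] conjI)
qed

lemma vge_add:
  assumes p: "p \<in> C" and "vge p n f" "vge p n g"
  shows "vge p n (\<lambda>q. f q + g q)"
proof -
  obtain t where t: "uniformizer C p t" using uniformizer_ex[OF p] ..
  obtain w where w: "reg p w" "f \<doteq> (\<lambda>q. t q powi n * w q)"
    using assms(2) unfolding vge_iff[OF p t] by (elim exE conjE)
  obtain x where x: "reg p x" "g \<doteq> (\<lambda>q. t q powi n * x q)"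
    using assms(3) unfolding vge_iff[OF p t] by (elim exE conjE)
  have "\<forall>\<^sub>F q in \<eta>. f q + g q = t q powi n * (w q + x q)"
    using w(2) x(2) by eventually_elim (simp add: algebra_simps)
  then show ?thesis unfolding vge_iff[OF p t]
    by (intro exI[of _ "\<lambda>q. w q + x q"] conjI reg_add w x)
qed

lemma vge_mult:
  assumes p: "p \<in> C" and "vge p n f" "vge p m g"
  shows "vge p (n + m) (\<lambda>q. f q * g q)"
proof -
  obtain t where t: "uniformizer C p t" using uniformizer_ex[OF p] ..
  obtain w where w: "reg p w" "f \<doteq> (\<lambda>q. t q powi n * w q)"
    using assms(2) unfolding vge_iff[OF p t] by (elim exE conjE)
  obtain x where x: "reg p x" "g \<doteq> (\<lambda>q. t q powi m * x q)"
    using assms(3) unfolding vge_iff[OF p t] by (elim exE conjE)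
  have "\<forall>\<^sub>F q in \<eta>. f q * g q = t q powi (n + m) * (w q * x q)"
    using w(2) x(2) uniformizer_nz[OF p t] unfolding nz_def
    by eventually_elim (simp add: power_int_add)
  then show ?thesis unfolding vge_iff[OF p t]
    by (intro exI[of _ "\<lambda>q. w q * x q"] conjI reg_mult w x)
qed

lemma reg_vge: "reg p f \<Longrightarrow> vge p 0 f"
proof -
  assume f: "reg p f"
  obtain t where t: "uniformizer C p t" using uniformizer_ex[OF reg_in_C[OF f]] ..
  show ?thesis unfolding vge_iff[OF reg_in_C[OF f] t] by (rule exI[of _ f]) (simp add: f)
qed

lemma vge_0_reg:
  assumes p: "p \<in> C" and "vge p 0 f"
  shows "\<exists>w. reg p w \<and> f \<doteq> w"
proof -
  obtain t where t: "uniformizer C p t" using uniformizer_ex[OF p] ..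
  show ?thesis using assms(2) unfolding vge_iff[OF p t] by simp
qed

lemma vge_const: "p \<in> C \<Longrightarrow> vge p 0 (\<lambda>_. c)"
  by (rule reg_vge[OF reg_const])

lemma vge_cmult: "p \<in> C \<Longrightarrow> vge p n f \<Longrightarrow> vge p n (\<lambda>q. c * f q)"
  using vge_mult[OF _ vge_const, of p n f c] by simp

lemma vge_diff: "p \<in> C \<Longrightarrow> vge p n f \<Longrightarrow> vge p n g \<Longrightarrow> vge p n (\<lambda>q. f q - g q)"
  using vge_add[OF _ _ vge_cmult[of p n g "-1"], of f] by simp

text \<open>The residue field consists of the constants, so the leading coefficient of
  \<open>f\<close> is cancelled by a scalar multiple of \<open>s\<close>, namely by the ratio of the
  two leading values at \<open>p\<close>.\<close>

lemma vge_eliminate: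
  assumes p: "p \<in> C" and s: "rational s" "nz s" and f: "vge p (ord_at C p s) f"
  shows "\<exists>c. vge p (ord_at C p s + 1) (\<lambda>q. f q - c * s q)"
proof -
  obtain t where t: "uniformizer C p t" using uniformizer_ex[OF p] ..
  obtain u where u: "unit_at p u" "s \<doteq> (\<lambda>q. t q powi (ord_at C p s) * u q)"
    using ord_at_decomposition[OF p t s] by (elim exE conjE)
  obtain w where w: "reg p w" "f \<doteq> (\<lambda>q. t q powi (ord_at C p s) * w q)"
    using f unfolding vge_iff[OF p t] by (elim exE conjE)
  define c where "c = w p / u p"
  have "reg p (\<lambda>q. w q - c * u q)"
    using u(1) unfolding unit_at_def by (intro reg_diff reg_cmult w(1)) simp
  moreover have "w p - c * u p = 0" using u(1) by (simp add: c_def unit_at_def)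
  ultimately obtain k where k: "reg p k" "(\<lambda>q. w q - c * u q) \<doteq> (\<lambda>q. t q * k q)"
    using uniformizerD(3)[OF p t] by blast
  have "\<forall>\<^sub>F q in \<eta>. f q - c * s q = t q powi (ord_at C p s + 1) * k q"
    using u(2) w(2) k(2) uniformizer_nz[OF p t] unfolding nz_def
  proof eventually_elim
    case (elim q)
    have "f q - c * s q = t q powi (ord_at C p s) * (w q - c * u q)"
      using elim(1,2) by (simp add: algebra_simps)
    also have "\<dots> = t q powi (ord_at C p s) * (t q * k q)" using elim(3) by simp
    also have "\<dots> = t q powi (ord_at C p s + 1) * k q" using elim(4) by (simp add: power_int_add)
    finally show ?case .
  qed
  then have "vge p (ord_at C p s + 1) (\<lambda>q. f q - c * s q)"
    unfolding vge_iff[OF p t] by (intro exI[of _ k] conjI k(1))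
  then show ?thesis ..
qed

end

section \<open>Divisors and global sections\<close>

abbreviation dmult :: "('p \<Rightarrow>\<^sub>0 int) \<Rightarrow> 'p \<Rightarrow> int" where
  "dmult \<equiv> Poly_Mapping.lookup"

lemma deg_eq_sum: "finite A \<Longrightarrow> Poly_Mapping.keys D \<subseteq> A \<Longrightarrow> deg D = (\<Sum>p\<in>A. dmult D p)"
  unfolding deg_def by (rule sum.mono_neutral_left) (auto simp: in_keys_iff)

lemma deg_add: "deg (D + E) = deg D + deg E"
proof -
  let ?A = "Poly_Mapping.keys D \<union> Poly_Mapping.keys E"
  have "deg (D + E) = (\<Sum>p\<in>?A. dmult (D + E) p)"
    using Poly_Mapping.keys_add[of D E] by (intro deg_eq_sum) auto
  also have "\<dots> = (\<Sum>p\<in>?A. dmult D p) + (\<Sum>p\<in>?A. dmult E p)"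
    by (simp add: lookup_add sum.distrib)
  also have "\<dots> = deg D + deg E" by (simp add: deg_eq_sum[of ?A D] deg_eq_sum[of ?A E])
  finally show ?thesis .
qed

lemma deg_zero [simp]: "deg 0 = 0"
  by (simp add: deg_def)

lemma deg_uminus: "deg (- D) = - deg D"
  using deg_add[of D "- D"] by simp

lemma deg_diff: "deg (D - E) = deg D - deg E"
  using deg_add[of D "- E"] by (simp add: deg_uminus)

lemma deg_single [simp]: "deg (Poly_Mapping.single p n) = n"
  by (simp add: deg_def)

lemma divisors_zero: "0 \<in> divisors C"
  by (simp add: divisors_def)

lemma divisors_single: "p \<in> C \<Longrightarrow> Poly_Mapping.single p n \<in> divisors C"
  by (simp add: divisors_def)

lemma divisors_add: "D \<in> divisors C \<Longrightarrow> E \<in> divisors C \<Longrightarrow> D + E \<in> divisors C"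
  unfolding divisors_def using Poly_Mapping.keys_add[of D E] by auto

lemma divisors_uminus: "D \<in> divisors C \<Longrightarrow> - D \<in> divisors C"
  by (simp add: divisors_def)

lemma divisors_diff: "D \<in> divisors C \<Longrightarrow> E \<in> divisors C \<Longrightarrow> D - E \<in> divisors C"
  using divisors_add[OF _ divisors_uminus, of D C E] by simp

text \<open>An upper bound on \<open>cvec.dim\<close> does not imply finite dimension, because
  infinite bases count as 0; a positive value does.\<close>

definition findim :: "'v::complex_vector set \<Rightarrow> bool" where
  "findim V \<longleftrightarrow> (\<exists>B. finite B \<and> V \<subseteq> cvec.span B)"

lemma findim_dim_pos: "cvec.dim V > 0 \<Longrightarrow> findim V"
proof -
  assume V: "cvec.dim V > 0"
  obtain B where B: "B \<subseteq> V" "cvec.independent B" "V \<subseteq> cvec.span B" "card B = cvec.dim V"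
    using cvec.basis_exists[of V] .
  then have "finite B" using V by (intro card_ge_0_finite) simp
  then show ?thesis unfolding findim_def using B(3) by (intro exI[of _ B] conjI)
qed

lemma findim_basis:
  assumes "findim V"
  obtains B where "finite B" "B \<subseteq> V" "cvec.independent B" "V \<subseteq> cvec.span B" "card B = cvec.dim V"
proof -
  obtain B where B: "B \<subseteq> V" "cvec.independent B" "V \<subseteq> cvec.span B" "card B = cvec.dim V"
    using cvec.basis_exists[of V] .
  obtain S where "finite S" "V \<subseteq> cvec.span S" using assms by (auto simp: findim_def)
  then have "finite B" using cvec.independent_span_bound[of S B] B(1,2) by blast
  from that[OF this B] show ?thesis .
qed

lemma independent_card_le:
  assumes "findim V" "cvec.independent S" "S \<subseteq> cvec.span V"
  shows "finite S \<and> card S \<le> cvec.dim V"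
proof -
  obtain B where B: "finite B" "B \<subseteq> V" "cvec.independent B" "V \<subseteq> cvec.span B" "card B = cvec.dim V"
    using findim_basis[OF assms(1)] .
  have "S \<subseteq> cvec.span B" using assms(3) cvec.span_minimal[OF B(4) cvec.subspace_span] by (rule subset_trans)
  then show ?thesis using cvec.independent_span_bound[OF B(1) assms(2)] B(5) by simp
qed

lemma dim_le_linear_inj:
  assumes T: "clinear T" "\<And>v. v \<in> V \<Longrightarrow> T v \<in> W" "inj_on T V" and V: "cvec.subspace V" and W: "findim W"
  shows "findim V \<and> cvec.dim V \<le> cvec.dim W"
proof -
  obtain B where B: "B \<subseteq> V" "cvec.independent B" "V \<subseteq> cvec.span B" "card B = cvec.dim V"
    using cvec.basis_exists[of V] .
  have "cvec.span B \<subseteq> V" by (rule cvec.span_minimal[OF B(1) V])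
  then have "inj_on T (cvec.span B)" using T(3) by (rule inj_on_subset[rotated])
  then have ind: "cvec.independent (T ` B)"
    by (rule cvec_pair.linear_independent_injective_image[OF T(1) B(2)])
  have "T ` B \<subseteq> cvec.span W" using T(2) B(1) cvec.span_base by blast
  note * = independent_card_le[OF W ind this]
  have inj: "inj_on T B" using T(3) B(1) by (rule inj_on_subset)
  have "finite B" using * inj finite_image_iff by blast
  moreover have "card B \<le> cvec.dim W" using * card_image[OF inj] by simp
  ultimately show ?thesis using B unfolding findim_def by auto
qed

context smooth_curve
begin

text \<open>Unlike \<open>sections\<close>, this space is unaffected by changing finitely many
  values. Products and inclusions are handled here and transferred to sections by
  \<open>normalise\<close>.\<close>

definition LD :: "('n pt \<Rightarrow>\<^sub>0 int) \<Rightarrow> 'n cfun set" where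
  "LD D = {f. \<forall>p\<in>C. vge p (- dmult D p) f}"

lemma LD_I: "(\<And>p. p \<in> C \<Longrightarrow> vge p (- dmult D p) f) \<Longrightarrow> f \<in> LD D"
  by (simp add: LD_def)

lemma LD_D: "f \<in> LD D \<Longrightarrow> p \<in> C \<Longrightarrow> vge p (- dmult D p) f"
  by (simp add: LD_def)

lemma C_nonempty: "\<exists>p. p \<in> C"
  using infinite_imp_nonempty[OF infinite_C] by blast

lemma LD_rational: "f \<in> LD D \<Longrightarrow> rational f"
  using C_nonempty LD_D vge_rational by blast

lemma LD_cong: "f \<doteq> g \<Longrightarrow> f \<in> LD D \<Longrightarrow> g \<in> LD D"
  by (rule LD_I) (rule vge_cong, assumption, assumption, erule (1) LD_D)

lemma LD_add: "f \<in> LD D \<Longrightarrow> g \<in> LD D \<Longrightarrow> (\<lambda>q. f q + g q) \<in> LD D"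
  by (rule LD_I, rule vge_add, assumption) (erule (1) LD_D)+

lemma LD_cmult: "f \<in> LD D \<Longrightarrow> (\<lambda>q. c * f q) \<in> LD D"
  by (rule LD_I, rule vge_cmult, assumption) (erule (1) LD_D)

lemma LD_diff: "f \<in> LD D \<Longrightarrow> g \<in> LD D \<Longrightarrow> (\<lambda>q. f q - g q) \<in> LD D"
  by (rule LD_I, rule vge_diff, assumption) (erule (1) LD_D)+

lemma LD_zero: "(\<lambda>_. 0) \<in> LD D"
  by (rule LD_I) (simp add: vge_def rational_const)

lemma LD_mult: "f \<in> LD D \<Longrightarrow> g \<in> LD E \<Longrightarrow> (\<lambda>q. f q * g q) \<in> LD (D + E)"
proof (rule LD_I)
  fix p assume *: "f \<in> LD D" "g \<in> LD E" "p \<in> C"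
  from vge_mult[OF *(3) LD_D[OF *(1,3)] LD_D[OF *(2,3)]]
  show "vge p (- dmult (D + E) p) (\<lambda>q. f q * g q)" by (simp add: lookup_add)
qed

lemma LD_mono:
  assumes "f \<in> LD D" "\<And>p. p \<in> C \<Longrightarrow> dmult D p \<le> dmult E p"
  shows "f \<in> LD E"
proof (rule LD_I)
  fix p assume p: "p \<in> C"
  show "vge p (- dmult E p) f"
    by (rule vge_mono[OF LD_D[OF assms(1) p]]) (use assms(2)[OF p] in simp)
qed

lemma LD_nz_ord:
  assumes "f \<in> LD D" "nz f" "p \<in> C"
  shows "- dmult D p \<le> ord_at C p f"
  by (rule vge_nz[OF LD_D[OF assms(1,3)] assms(2)])

lemma LD_dichotomy: "f \<in> LD D \<Longrightarrow> f \<doteq> (\<lambda>_. 0) \<or> nz f"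
  by (rule rational_dichotomy[OF LD_rational])

lemma LD_ordI:
  assumes "rational f" "\<And>p. p \<in> C \<Longrightarrow> - dmult D p \<le> ord_at C p f"
  shows "f \<in> LD D"
  by (rule LD_I, rule vge_ord[OF assms(1)]) (rule assms(2))

lemma LD_const: "(\<And>p. p \<in> C \<Longrightarrow> 0 \<le> dmult D p) \<Longrightarrow> (\<lambda>_. c) \<in> LD D"
  by (rule LD_I, rule vge_mono[OF vge_const]) auto

lemma ae_lookup_0: "\<forall>\<^sub>F q in \<eta>. dmult D q = 0"
  unfolding eventually_ae
  by (rule finite_subset[OF _ finite_keys[of D]]) (auto simp: in_keys_iff)

lemma ex_lookup_0: "\<exists>p\<in>C. dmult D p = 0"
  by (rule eventually_ex[OF ae_lookup_0])

lemma sections_iff: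
  "f \<in> sections C D \<longleftrightarrow> f \<in> LD D \<and>
    (\<forall>p. p \<notin> C \<or> dmult D p > 0 \<longrightarrow> f p = 0) \<and>
    (\<forall>p\<in>C. dmult D p \<le> 0 \<longrightarrow> reg p f)"
proof
  assume f: "f \<in> sections C D"
  then have 1: "\<forall>p. p \<notin> C \<or> dmult D p > 0 \<longrightarrow> f p = 0"
    and 2: "\<forall>p\<in>C. dmult D p \<le> 0 \<longrightarrow> reg p f"
    and 3: "f = 0 \<or> (\<forall>p\<in>C. ord_at C p f \<ge> - dmult D p)"
    unfolding sections_def by blast+
  \<comment> \<open>Sections are regular outside the support of \<open>D\<close>, and regularity at
    a single point already makes them rational.\<close>
  obtain p where "p \<in> C" "dmult D p = 0" using ex_lookup_0 by blast
  then have "reg p f" using 2 by simp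
  then have rat: "rational f" by (rule reg_rational)
  have "f \<in> LD D"
    using 3
  proof
    assume "f = 0"
    then have "f = (\<lambda>_. 0)" by auto
    then show ?thesis using LD_zero by metis
  next
    assume "\<forall>p\<in>C. ord_at C p f \<ge> - dmult D p"
    then show ?thesis by (intro LD_ordI rat) blast
  qed
  then show "f \<in> LD D \<and> (\<forall>p. p \<notin> C \<or> dmult D p > 0 \<longrightarrow> f p = 0) \<and>
    (\<forall>p\<in>C. dmult D p \<le> 0 \<longrightarrow> reg p f)" using 1 2 by blast
next
  assume *: "f \<in> LD D \<and> (\<forall>p. p \<notin> C \<or> dmult D p > 0 \<longrightarrow> f p = 0) \<and>
    (\<forall>p\<in>C. dmult D p \<le> 0 \<longrightarrow> reg p f)"
  have "f = 0 \<or> (\<forall>p\<in>C. ord_at C p f \<ge> - dmult D p)"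
    using LD_dichotomy[OF conjunct1[OF *]]
  proof
    assume z: "f \<doteq> (\<lambda>_. 0)"
    have "f p = 0" for p
    proof (cases "p \<notin> C \<or> dmult D p > 0")
      case False
      then have "reg p f" using * by simp
      from reg_zero[OF this z] show ?thesis .
    qed (use * in blast)
    then show ?thesis by (auto simp: fun_eq_iff)
  next
    assume "nz f"
    then show ?thesis using LD_nz_ord * by blast
  qed
  then show "f \<in> sections C D" unfolding sections_def using * by blast
qed

lemma sections_LD: "f \<in> sections C D \<Longrightarrow> f \<in> LD D"
  by (simp add: sections_iff)

lemma sections_outside: "f \<in> sections C D \<Longrightarrow> p \<notin> C \<or> dmult D p > 0 \<Longrightarrow> f p = 0"
  by (simp add: sections_iff)

lemma sections_reg: "f \<in> sections C D \<Longrightarrow> p \<in> C \<Longrightarrow> dmult D p \<le> 0 \<Longrightarrow> reg p f"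
  by (simp add: sections_iff)

lemma sections_ext:
  assumes f: "f \<in> sections C D" and g: "g \<in> sections C D" and "f \<doteq> g"
  shows "f = g"
proof
  fix p
  show "f p = g p"
  proof (cases "p \<notin> C \<or> dmult D p > 0")
    case True
    then show ?thesis using sections_outside[OF f] sections_outside[OF g] by metis
  next
    case False
    then have "reg p f" "reg p g" using sections_reg[OF f] sections_reg[OF g] by auto
    from reg_unique[OF this assms(3)] show ?thesis .
  qed
qed

lemma sections_add:
  assumes f: "f \<in> sections C D" and g: "g \<in> sections C D"
  shows "f + g \<in> sections C D"
  unfolding sections_iff plus_fun_def
proof (intro conjI LD_add sections_LD f g allI ballI impI)
  show "f p + g p = 0" if "p \<notin> C \<or> dmult D p > 0" for p
    using sections_outside[OF f that] sections_outside[OF g that] by simp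
qed (intro reg_add sections_reg[OF f] sections_reg[OF g])

lemma sections_scale:
  assumes f: "f \<in> sections C D"
  shows "c *\<^sub>C f \<in> sections C D"
  unfolding sections_iff scaleC_fun_def scaleC_complex_eq
proof (intro conjI LD_cmult sections_LD f allI ballI impI)
  show "c * f p = 0" if "p \<notin> C \<or> dmult D p > 0" for p
    using sections_outside[OF f that] by simp
qed (intro reg_cmult sections_reg[OF f])

lemma sections_zero: "0 \<in> sections C D"
  unfolding sections_iff zero_fun_def by (intro conjI LD_zero allI impI ballI reg_const refl)

lemma subspace_sections: "cvec.subspace (sections C D)"
  unfolding cvec.subspace_def using sections_zero sections_add sections_scale by blast

lemma sections_nz: "f \<in> sections C D \<Longrightarrow> f \<noteq> 0 \<Longrightarrow> nz f"
proof -
  assume f: "f \<in> sections C D" and "f \<noteq> 0"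
  have "\<not> f \<doteq> (\<lambda>_. 0)"
  proof
    assume "f \<doteq> (\<lambda>_. 0)"
    then have "f = 0" by (intro sections_ext[OF f sections_zero]) simp
    then show False using \<open>f \<noteq> 0\<close> by contradiction
  qed
  then show "nz f" using LD_dichotomy[OF sections_LD[OF f]] by blast
qed

text \<open>At each point where \<open>D\<close> allows no pole, some regular function agrees with
  \<open>f\<close> almost everywhere and prescribes the value. By uniqueness of regular values the
  result agrees with \<open>f\<close> at almost all points.\<close>

lemma normalise:
  assumes f: "f \<in> LD D"
  shows "\<exists>s. s \<in> sections C D \<and> s \<doteq> f"
proof -
  have "\<exists>w. reg p w \<and> f \<doteq> w" if "p \<in> C" "dmult D p \<le> 0" for p
  proof -
    have "vge p 0 f" by (rule vge_mono[OF LD_D[OF f that(1)]]) (use that in simp)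
    from vge_0_reg[OF that(1) this] show ?thesis .
  qed
  then obtain w where w: "\<And>p. p \<in> C \<Longrightarrow> dmult D p \<le> 0 \<Longrightarrow> reg p (w p)"
    "\<And>p. p \<in> C \<Longrightarrow> dmult D p \<le> 0 \<Longrightarrow> f \<doteq> w p" by metis
  define s where "s p = (if p \<in> C \<and> dmult D p \<le> 0 then w p p else 0)" for p
  have "\<forall>\<^sub>F p in \<eta>. p \<in> C" by (rule ae_I)
  then have sf: "s \<doteq> f"
    using rational_ae_reg[OF LD_rational[OF f]] ae_lookup_0[of D]
  proof eventually_elim
    case (elim p)
    then have "f p = w p p" by (intro reg_unique w) simp_all
    then show ?case using elim by (simp add: s_def)
  qed
  have "reg p s" if "p \<in> C" "dmult D p \<le> 0" for p
  proof (rule reg_cong[OF w(1)[OF that]])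
    show "w p \<doteq> s" using w(2)[OF that] sf by eventually_elim simp
    show "w p p = s p" using that by (simp add: s_def)
  qed
  moreover have "s \<in> LD D" by (rule LD_cong[OF aeq_sym[OF sf] f])
  moreover have "s p = 0" if "p \<notin> C \<or> dmult D p > 0" for p
    using that by (auto simp: s_def)
  ultimately have "s \<in> sections C D" unfolding sections_iff by blast
  then show ?thesis using sf by blast
qed

text \<open>The product with \<open>g\<close> has to be normalised, which involves choices and is
  defined only on sections. A map that is linear on all functions is obtained by prescribing it on a
  basis.\<close>

lemma mult_map:
  assumes g: "\<And>f. f \<in> LD D \<Longrightarrow> (\<lambda>q. g q * f q) \<in> LD E"
  shows "\<exists>T :: 'n cfun \<Rightarrow> 'n cfun. clinear T \<and>
    (\<forall>f\<in>sections C D. T f \<in> sections C E \<and> T f \<doteq> (\<lambda>q. g q * f q))"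
proof -
  obtain B where B: "B \<subseteq> sections C D" "cvec.independent B" "sections C D \<subseteq> cvec.span B"
    "card B = cvec.dim (sections C D)" using cvec.basis_exists[of "sections C D"] .
  have "\<forall>b\<in>B. \<exists>s. s \<in> sections C E \<and> s \<doteq> (\<lambda>q. g q * b q)"
  proof
    fix b assume "b \<in> B"
    then have "b \<in> sections C D" using B(1) by blast
    from normalise[OF g[OF sections_LD[OF this]]]
    show "\<exists>s. s \<in> sections C E \<and> s \<doteq> (\<lambda>q. g q * b q)" .
  qed
  from bchoice[OF this] obtain m where
    m: "\<forall>b\<in>B. m b \<in> sections C E \<and> m b \<doteq> (\<lambda>q. g q * b q)" ..
  obtain T :: "'n cfun \<Rightarrow> 'n cfun" where T: "clinear T" "\<forall>x\<in>B. T x = m x"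
    using cvec_pair.linear_independent_extend[OF B(2), of m] by (elim exE conjE)
  have "T f \<in> sections C E \<and> T f \<doteq> (\<lambda>q. g q * f q)" if "f \<in> cvec.span B" for f
    using that
  proof (induction rule: cvec.span_induct_alt)
    case base
    have "T 0 = 0" by (rule cvec_pair.linear_0[OF T(1)])
    have "T 0 \<in> sections C E" unfolding \<open>T 0 = 0\<close> by (rule sections_zero)
    moreover have "T 0 \<doteq> (\<lambda>q. g q * 0 q)" unfolding \<open>T 0 = 0\<close> by simp
    ultimately show ?case ..
  next
    case (step c x y)
    have Tx: "T x \<in> sections C E" "T x \<doteq> (\<lambda>q. g q * x q)" using step(1) T(2) m by auto
    have eq: "T (c *\<^sub>C x + y) = c *\<^sub>C T x + T y" using T(1) by (simp add: clinear_iff)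
    have "\<forall>\<^sub>F q in \<eta>. T (c *\<^sub>C x + y) q = g q * (c *\<^sub>C x + y) q"
      using Tx(2) conjunct2[OF step.IH] unfolding eq by eventually_elim (simp add: algebra_simps)
    moreover have "T (c *\<^sub>C x + y) \<in> sections C E"
      unfolding eq using Tx(1) step.IH by (intro sections_add sections_scale) auto
    ultimately show ?case by blast
  qed
  then show ?thesis using T(1) B(3) by (intro exI[of _ T]) auto
qed

lemma mult_inj:
  assumes "nz g" "\<And>f. f \<in> sections C D \<Longrightarrow> T f \<doteq> (\<lambda>q. g q * f q)"
  shows "inj_on T (sections C D)"
proof (rule inj_onI)
  fix f h assume f: "f \<in> sections C D" and h: "h \<in> sections C D" and eq: "T f = T h"
  have "f \<doteq> h" using assms(1) assms(2)[OF f] assms(2)[OF h] unfolding nz_def eq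
    by eventually_elim auto
  then show "f = h" by (rule sections_ext[OF f h])
qed

lemma dim_sections_le:
  assumes "nz g" "\<And>f. f \<in> LD D \<Longrightarrow> (\<lambda>q. g q * f q) \<in> LD E" "findim (sections C E)"
  shows "findim (sections C D) \<and> cvec.dim (sections C D) \<le> cvec.dim (sections C E)"
proof -
  have "\<exists>T :: 'n cfun \<Rightarrow> 'n cfun. clinear T \<and>
    (\<forall>f\<in>sections C D. T f \<in> sections C E \<and> T f \<doteq> (\<lambda>q. g q * f q))"
    by (rule mult_map) (rule assms(2))
  then obtain T :: "'n cfun \<Rightarrow> 'n cfun" where T: "clinear T"
    "\<forall>f\<in>sections C D. T f \<in> sections C E \<and> T f \<doteq> (\<lambda>q. g q * f q)" by (elim exE conjE)
  show ?thesis
    by (rule dim_le_linear_inj[OF T(1) _ mult_inj[OF assms(1)] subspace_sections assms(3)])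
      (use T(2) in blast)+
qed

end

section \<open>Riemann's inequality in genus one\<close>

locale elliptic = projective_curve C for C :: "'n::finite pt set" +
  assumes genus: "has_genus C 1"
begin

lemma riemann: "D \<in> divisors C \<Longrightarrow> deg D \<le> int (cvec.dim (sections C D))"
  using genus unfolding has_genus_def by simp

text \<open>Without a uniformizer at \<open>p\<close> the order at \<open>p\<close> would be one and the same junk value for all
  functions, so that the spaces of sections of \<open>n p\<close> would not grow with \<open>n\<close>.\<close>

lemma uniformizer_exists:
  assumes p: "p \<in> C"
  shows "\<exists>t. uniformizer C p t"
proof (rule ccontr)
  assume no: "\<nexists>t. uniformizer C p t"
  define c where "c = (THE n :: int. False)"
  have ord: "ord_at C p f = c" for f using no by (simp add: ord_at_def c_def)
  \<comment> \<open>For \<open>k \<ge> N\<close> the multiplicity at \<open>p\<close> is positive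
    and the junk order \<open>c\<close> satisfies the bound \<open>- k\<close>, so the space of
    sections of \<open>k p\<close> no longer depends on \<open>k\<close>. The multiplicity
    \<open>N + d + 1\<close> used below exceeds the common dimension \<open>d\<close>.\<close>
  define N where "N = max 1 (- c)"
  have char: "f \<in> sections C (Poly_Mapping.single p k) \<longleftrightarrow> (\<forall>q. q \<notin> C \<or> q = p \<longrightarrow> f q = 0) \<and>
      (\<forall>q\<in>C. q \<noteq> p \<longrightarrow> reg q f) \<and> (f = 0 \<or> (\<forall>q\<in>C. q \<noteq> p \<longrightarrow> 0 \<le> ord_at C q f))" if "N \<le> k" for f k
  proof -
    have k: "1 \<le> k" "- k \<le> c" using that by (auto simp: N_def)
    have 1: "0 < dmult (Poly_Mapping.single p k) q \<longleftrightarrow> q = p"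
      and 2: "dmult (Poly_Mapping.single p k) q \<le> 0 \<longleftrightarrow> q \<noteq> p"
      and 3: "- dmult (Poly_Mapping.single p k) q \<le> ord_at C q f \<longleftrightarrow>
        (q \<noteq> p \<longrightarrow> 0 \<le> ord_at C q f)" for q
      using k ord by (auto simp: lookup_single when_def)
    show ?thesis unfolding sections_def mem_Collect_eq 1 2 3 by (rule refl)
  qed
  have sub: "sections C (Poly_Mapping.single p n) \<subseteq> sections C (Poly_Mapping.single p m)"
    if "N \<le> n" "N \<le> m" for n m
    by (rule subsetI) (unfold char[OF that(1)] char[OF that(2)], assumption)
  define d where "d = cvec.dim (sections C (Poly_Mapping.single p N))"
  have eq: "sections C (Poly_Mapping.single p (N + int d + 1)) = sections C (Poly_Mapping.single p N)"
    by (intro equalityI sub) (auto simp: N_def)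
  have "N + int d + 1 \<le> int d"
    using riemann[OF divisors_single[OF p, of "N + int d + 1"]] unfolding eq by (simp flip: d_def)
  then show False by (auto simp: N_def)
qed

sublocale smooth_curve
  by unfold_locales (rule uniformizer_exists)

section \<open>Riemann--Roch on an elliptic curve\<close>

abbreviation ell :: "('n pt \<Rightarrow>\<^sub>0 int) \<Rightarrow> nat" where
  "ell D \<equiv> cvec.dim (sections C D)"

abbreviation pnt :: "'n pt \<Rightarrow> 'n pt \<Rightarrow>\<^sub>0 int" where
  "pnt q \<equiv> Poly_Mapping.single q 1"

lemma lookup_pnt: "dmult (Poly_Mapping.single q (n::int)) p = (if p = q then n else 0)"
  by (auto simp: lookup_single when_def)

lemma LD_subset_add: "q \<in> C \<Longrightarrow> 0 \<le> n \<Longrightarrow> f \<in> LD D \<Longrightarrow> f \<in> LD (D + Poly_Mapping.single q n)"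
  by (erule LD_mono) (simp add: lookup_add lookup_pnt)

text \<open>Adding a large multiple of a point makes the dimension positive by Riemann's inequality,
  hence finite; the smaller space embeds.\<close>

lemma findim_sections:
  assumes D: "D \<in> divisors C"
  shows "findim (sections C D)"
proof -
  obtain q where q: "q \<in> C" using C_nonempty ..
  define n where "n = max 0 (1 - deg D)"
  define E where "E = D + Poly_Mapping.single q n"
  have E: "E \<in> divisors C" unfolding E_def by (intro divisors_add D divisors_single q)
  have "1 \<le> deg E" by (simp add: E_def deg_add n_def)
  then have "0 < ell E" using riemann[OF E] by simp
  then have fin: "findim (sections C E)" by (rule findim_dim_pos)
  have "(\<lambda>p. 1 * f p) \<in> LD E" if "f \<in> LD D" for f
    using LD_subset_add[OF q _ that, of n] by (simp add: E_def n_def)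
  from dim_sections_le[OF nz_const[of 1] this fin] show ?thesis by simp
qed

lemma ell_le:
  assumes "nz g" "\<And>f. f \<in> LD D \<Longrightarrow> (\<lambda>q. g q * f q) \<in> LD E" "E \<in> divisors C"
  shows "ell D \<le> ell E"
  using dim_sections_le[OF assms(1) _ findim_sections[OF assms(3)]] assms(2) by blast

lemma ell_mono: "(\<And>f. f \<in> LD D \<Longrightarrow> f \<in> LD E) \<Longrightarrow> E \<in> divisors C \<Longrightarrow> ell D \<le> ell E"
  using ell_le[of "\<lambda>_. 1" D E] nz_const[of 1] by simp

lemma ell_pos:
  assumes "1 \<le> ell D"
  shows "\<exists>s. s \<in> sections C D \<and> nz s"
proof (rule ccontr)
  assume "\<nexists>s. s \<in> sections C D \<and> nz s"
  then have "sections C D \<subseteq> cvec.span {}" using sections_nz by auto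
  from cvec.dim_le_card[OF this] assms show False by simp
qed

text \<open>Multiplication by \<open>f\<^sup>n\<close> embeds the sections of \<open>-n D\<close>, whose number grows linearly in \<open>n\<close>,
  into the finite-dimensional space of sections of \<open>0\<close>.\<close>

lemma negative_degree:
  assumes D: "D \<in> divisors C" "deg D < 0" and f: "f \<in> LD D"
  shows "f \<doteq> (\<lambda>_. 0)"
proof (rule ccontr)
  assume "\<not> f \<doteq> (\<lambda>_. 0)"
  then have nz: "nz f" using LD_dichotomy[OF f] by blast
  have "\<exists>E\<in>divisors C. deg E = - (int n * deg D) \<and> (\<forall>p. dmult E p = - (int n * dmult D p))"
    for n
  proof (induction n)
    case 0
    show ?case by (intro bexI[of _ 0] divisors_zero) simp
  next
    case (Suc n)
    then obtain E where E: "E \<in> divisors C" "deg E = - (int n * deg D)"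
      "\<forall>p. dmult E p = - (int n * dmult D p)" by blast
    show ?case
      by (intro bexI[of _ "E - D"] divisors_diff E D)
        (simp add: deg_diff E lookup_minus algebra_simps)
  qed
  \<comment> \<open>Since \<open>- deg D\<close> is at least 1, the multiple
    \<open>ell 0 + 1\<close> makes the degree of \<open>E\<close>, and with it \<open>ell E\<close>,
    exceed \<open>ell 0\<close>.\<close>
  then obtain E where E: "E \<in> divisors C" "deg E = - (int (ell 0 + 1) * deg D)"
      "\<forall>p. dmult E p = - (int (ell 0 + 1) * dmult D p)" by blast
  let ?n = "ell 0 + 1"
  have "ell E \<le> ell 0"
  proof (rule ell_le[OF nz_power[OF nz] _ divisors_zero])
    fix h assume h: "h \<in> LD E"
    show "(\<lambda>q. f q ^ ?n * h q) \<in> LD 0"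
    proof (rule LD_I)
      fix p assume p: "p \<in> C"
      have "int ?n * - dmult D p \<le> int ?n * ord_at C p f"
        using LD_nz_ord[OF f nz p] by (intro mult_left_mono) auto
      then have "vge p (int ?n * - dmult D p) (\<lambda>q. f q ^ ?n)"
        using ord_at_power[OF p LD_rational[OF f] nz, of ?n]
        by (intro vge_ord rational_power LD_rational[OF f]) simp
      from vge_mult[OF p this LD_D[OF h p]]
      show "vge p (- dmult 0 p) (\<lambda>q. f q ^ ?n * h q)" using E(3) by simp
    qed
  qed
  moreover have "int ?n \<le> deg E"
    using mult_left_mono[of 1 "- deg D" "int ?n"] D(2) unfolding E(2) by simp
  ultimately show False using riemann[OF E(1)] by simp
qed

text \<open>If the order at \<open>q\<close> were larger than the bound, \<open>f\<close> would be a
  nonzero function in the space of \<open>D - pnt q\<close>, which has negative degree.\<close>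

lemma degree_zero:
  assumes D: "D \<in> divisors C" "deg D = 0" and f: "f \<in> LD D" "nz f" and q: "q \<in> C"
  shows "ord_at C q f = - dmult D q"
proof (rule ccontr)
  assume "ord_at C q f \<noteq> - dmult D q"
  then have "- dmult D q + 1 \<le> ord_at C q f" using LD_nz_ord[OF f q] by simp
  then have "f \<in> LD (D - pnt q)"
    using LD_nz_ord[OF f] by (intro LD_ordI LD_rational[OF f(1)]) (simp add: lookup_minus lookup_pnt)
  then have "f \<doteq> (\<lambda>_. 0)"
    by (rule negative_degree[rotated 2]) (use D q in \<open>auto intro: divisors_diff divisors_single simp: deg_diff\<close>)
  then show False using nz_not_zero[OF f(2)] by contradiction
qed

text \<open>Subtracting the value at one point leaves a function in a space of degree -1.\<close>

lemma LD_0_const: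
  assumes "f \<in> LD 0"
  shows "\<exists>c. f \<doteq> (\<lambda>_. c)"
proof -
  obtain q where q: "q \<in> C" using C_nonempty ..
  have "vge q (ord_at C q (\<lambda>_. 1)) f" using LD_D[OF assms q] ord_at_const[OF q, of 1] by simp
  from vge_eliminate[OF q rational_const nz_const this] obtain c where
    c: "vge q (ord_at C q (\<lambda>_. 1) + 1) (\<lambda>p. f p - c * 1)" by auto
  have "(\<lambda>p. f p - c) \<in> LD (0 - pnt q)"
  proof (rule LD_I)
    fix p assume p: "p \<in> C"
    show "vge p (- dmult (0 - pnt q) p) (\<lambda>p. f p - c)"
    proof (cases "p = q")
      case True
      then show ?thesis using c ord_at_const[OF q, of 1] by (simp add: lookup_minus lookup_pnt)
    next
      case False
      then show ?thesis using vge_diff[OF p LD_D[OF assms p, simplified] vge_const[OF p]]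
        by (simp add: lookup_minus lookup_pnt)
    qed
  qed
  then have "(\<lambda>p. f p - c) \<doteq> (\<lambda>_. 0)"
    by (rule negative_degree[rotated 2]) (use q in \<open>auto intro: divisors_uminus divisors_single simp: deg_uminus\<close>)
  then have "f \<doteq> (\<lambda>_. c)" by eventually_elim simp
  then show ?thesis ..
qed

section \<open>Adding a point to a divisor\<close>

lemma not_in_LD_ord:
  assumes "s \<in> LD (D + pnt q)" "s \<notin> LD D" "q \<in> C"
  shows "nz s" "ord_at C q s = - dmult D q - 1"
proof -
  show nz: "nz s" using LD_dichotomy[OF assms(1)] LD_cong[OF aeq_sym LD_zero] assms(2) by blast
  have ge: "- dmult D p - (if p = q then 1 else 0) \<le> ord_at C p s" if "p \<in> C" for p
    using LD_nz_ord[OF assms(1) nz that] by (simp add: lookup_add lookup_pnt split: if_splits)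
  show "ord_at C q s = - dmult D q - 1"
  proof (rule ccontr)
    assume "ord_at C q s \<noteq> - dmult D q - 1"
    then have "s \<in> LD D" using ge[OF assms(3)] ge
      by (intro LD_ordI LD_rational[OF assms(1)]) (force split: if_splits)
    then show False using assms(2) by contradiction
  qed
qed

lemma eliminate_pole:
  assumes q: "q \<in> C" and s: "s \<in> LD (D + pnt q)" "nz s" "ord_at C q s = - dmult D q - 1"
    and f: "f \<in> LD (D + pnt q)"
  shows "\<exists>c. (\<lambda>p. f p - c * s p) \<in> LD D"
proof -
  have "vge q (ord_at C q s) f" using LD_D[OF f q] s(3) by (simp add: lookup_add lookup_pnt)
  then obtain c where c: "vge q (ord_at C q s + 1) (\<lambda>p. f p - c * s p)"
    using vge_eliminate[OF q LD_rational[OF s(1)] s(2)] by blast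
  have "(\<lambda>p. f p - c * s p) \<in> LD (D + pnt q)" by (intro LD_diff LD_cmult f s)
  then have "(\<lambda>p. f p - c * s p) \<in> LD D"
    using c s(3) unfolding LD_def by (auto simp: lookup_add lookup_pnt split: if_splits)
  then show ?thesis ..
qed

text \<open>If \<open>D\<close> has multiplicity 0 at \<open>q\<close>, sections of
  \<open>D + pnt q\<close> are normalised to be 0 at \<open>q\<close> and those of \<open>D\<close>
  are not; so the inclusion is a map and not a subset relation.\<close>

lemma inclusion_map:
  assumes q: "q \<in> C"
  obtains T :: "'n cfun \<Rightarrow> 'n cfun" where "clinear T"
    "\<forall>f\<in>sections C D. T f \<in> sections C (D + pnt q)" "\<forall>f\<in>sections C D. T f \<doteq> f"
    "inj_on T (sections C D)"
proof -
  have "\<exists>T :: 'n cfun \<Rightarrow> 'n cfun. clinear T \<and>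
    (\<forall>f\<in>sections C D. T f \<in> sections C (D + pnt q) \<and> T f \<doteq> (\<lambda>q. 1 * f q))"
    by (rule mult_map) (use LD_subset_add[OF q, of 1] in simp)
  then obtain T :: "'n cfun \<Rightarrow> 'n cfun" where T: "clinear T"
    "\<forall>f\<in>sections C D. T f \<in> sections C (D + pnt q) \<and> T f \<doteq> (\<lambda>q. 1 * f q)" by (elim exE conjE)
  have T': "T f \<doteq> (\<lambda>q. 1 * f q)" if "f \<in> sections C D" for f using T(2) that by blast
  have "inj_on T (sections C D)" by (rule mult_inj[OF nz_const[of 1] T']) simp_all
  then show ?thesis using that[OF T(1)] T(2) T' by simp
qed

text \<open>Leading coefficients at \<open>q\<close> are scalars: one section with the additional
  pole, together with the old sections, spans everything.\<close>

lemma ell_add_point_le: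
  assumes D: "D \<in> divisors C" and q: "q \<in> C"
  shows "ell (D + pnt q) \<le> ell D + 1"
proof (cases "\<forall>f\<in>LD (D + pnt q). f \<in> LD D")
  case True
  then have "ell (D + pnt q) \<le> ell D" by (intro ell_mono D) simp
  then show ?thesis by simp
next
  case False
  then obtain s0 where s0: "s0 \<in> LD (D + pnt q)" "s0 \<notin> LD D" by blast
  obtain s where s: "s \<in> sections C (D + pnt q)" "s \<doteq> s0" using normalise[OF s0(1)] by blast
  have "s \<notin> LD D" using LD_cong[OF s(2)] s0(2) by blast
  note s_ord = not_in_LD_ord[OF sections_LD[OF s(1)] this q]
  obtain T :: "'n cfun \<Rightarrow> 'n cfun" where T0: "clinear T"
    "\<forall>f\<in>sections C D. T f \<in> sections C (D + pnt q)" "\<forall>f\<in>sections C D. T f \<doteq> f"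
    "inj_on T (sections C D)" using inclusion_map[OF q, of D] .
  note T = T0(1) T0(2)[THEN bspec] T0(3)[THEN bspec] T0(4)
  obtain B where B: "finite B" "B \<subseteq> sections C D" "cvec.independent B" "sections C D \<subseteq> cvec.span B" "card B = ell D"
    using findim_basis[OF findim_sections[OF D]] .
  have "sections C (D + pnt q) \<subseteq> cvec.span (insert s (T ` B))"
  proof
    fix f assume f: "f \<in> sections C (D + pnt q)"
    obtain c where c: "(\<lambda>p. f p - c * s p) \<in> LD D"
      using eliminate_pole[OF q sections_LD[OF s(1)] s_ord sections_LD[OF f]] ..
    obtain h where h: "h \<in> sections C D" "h \<doteq> (\<lambda>p. f p - c * s p)" using normalise[OF c] by blast
    have "f = c *\<^sub>C s + T h"
    proof (rule sections_ext[OF f])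
      show "c *\<^sub>C s + T h \<in> sections C (D + pnt q)" by (intro sections_add sections_scale s T h)
      show "f \<doteq> c *\<^sub>C s + T h" using h(2) T(3)[OF h(1)] by eventually_elim simp
    qed
    moreover have "T h \<in> cvec.span (T ` B)"
      using h(1) B(4) cvec_pair.linear_span_image[OF T(1), of B] by blast
    then have "T h \<in> cvec.span (insert s (T ` B))"
      using cvec.span_mono[of "T ` B" "insert s (T ` B)"] by blast
    ultimately show "f \<in> cvec.span (insert s (T ` B))"
      by (simp add: cvec.span_add cvec.span_scale cvec.span_base)
  qed
  from cvec.dim_le_card[OF this] have "ell (D + pnt q) \<le> card (insert s (T ` B))" using B(1) by simp
  also have "\<dots> \<le> Suc (card (T ` B))" by (rule card_insert_le_m1) (simp_all add: B(1))
  also have "\<dots> \<le> ell D + 1" using card_image_le[OF B(1), of T] B(5) by simp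
  finally show ?thesis .
qed

lemma ell_add_point_ge:
  assumes D: "D \<in> divisors C" and q: "q \<in> C"
    and s0: "s0 \<in> LD (D + pnt q)" "s0 \<notin> LD D"
  shows "ell D + 1 \<le> ell (D + pnt q)"
proof -
  obtain s where s: "s \<in> sections C (D + pnt q)" "s \<doteq> s0" using normalise[OF s0(1)] by blast
  have sD: "s \<notin> LD D" using LD_cong[OF s(2)] s0(2) by blast
  obtain T :: "'n cfun \<Rightarrow> 'n cfun" where T0: "clinear T"
    "\<forall>f\<in>sections C D. T f \<in> sections C (D + pnt q)" "\<forall>f\<in>sections C D. T f \<doteq> f"
    "inj_on T (sections C D)" using inclusion_map[OF q, of D] .
  note T = T0(1) T0(2)[THEN bspec] T0(3)[THEN bspec] T0(4)
  obtain B where B: "finite B" "B \<subseteq> sections C D" "cvec.independent B" "sections C D \<subseteq> cvec.span B" "card B = ell D"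
    using findim_basis[OF findim_sections[OF D]] .
  have "cvec.span B \<subseteq> sections C D" by (rule cvec.span_minimal[OF B(2) subspace_sections])
  then have span: "cvec.span B = sections C D" using B(4) by blast
  have ind: "cvec.independent (T ` B)"
    by (rule cvec_pair.linear_independent_injective_image[OF T(1) B(3)]) (simp add: span T(4))
  have "s \<notin> cvec.span (T ` B)"
  proof
    assume "s \<in> cvec.span (T ` B)"
    then obtain h where h: "h \<in> sections C D" "s = T h"
      using cvec_pair.linear_span_image[OF T(1), of B] span by blast
    have "s \<in> LD D" using LD_cong[OF aeq_sym[OF T(3)[OF h(1)]] sections_LD[OF h(1)]] h(2) by simp
    then show False using sD by contradiction
  qed
  from cvec.independent_insertI[OF this ind] have ind2: "cvec.independent (insert s (T ` B))" .
  have s_new: "s \<notin> T ` B" using \<open>s \<notin> cvec.span (T ` B)\<close> cvec.span_base[of s "T ` B"] by blast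
  have "insert s (T ` B) \<subseteq> sections C (D + pnt q)" using s(1) T(2) B(2) by blast
  then have "insert s (T ` B) \<subseteq> cvec.span (sections C (D + pnt q))" using cvec.span_superset by blast
  from independent_card_le[OF findim_sections ind2 this] D q
  have "card (insert s (T ` B)) \<le> ell (D + pnt q)" by (auto intro: divisors_add divisors_single)
  moreover have "card (T ` B) = ell D" using T(4) B(2,5) by (metis card_image inj_on_subset)
  ultimately show ?thesis using B(1) s_new by simp
qed

lemma power_in_LD:
  assumes q: "q \<in> C" and f: "f \<in> LD (pnt q)" "nz f"
  shows "(\<lambda>p. f p ^ m) \<in> LD (Poly_Mapping.single q (int m))"
proof (intro LD_ordI rational_power LD_rational[OF f(1)])
  fix p assume p: "p \<in> C"
  have "int m * - (if p = q then 1 else 0) \<le> int m * ord_at C p f"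
    using LD_nz_ord[OF f p] by (intro mult_left_mono) (auto simp: lookup_pnt)
  then show "- dmult (Poly_Mapping.single q (int m)) p \<le> ord_at C p (\<lambda>p. f p ^ m)"
    by (simp add: ord_at_power[OF p LD_rational[OF f(1)] f(2)] lookup_pnt split: if_splits)
qed

text \<open>Each power of \<open>f\<close> has one pole more at \<open>q\<close> than the preceding
  one, so every step adds a dimension. The base case passes from \<open>- pnt q\<close> to 0 by
  means of the constant 1.\<close>

lemma ell_multiple_ge:
  assumes q: "q \<in> C" and f: "f \<in> LD (pnt q)" "f \<notin> LD 0"
  shows "m + 1 \<le> ell (Poly_Mapping.single q (int m))"
proof (induction m)
  case 0
  have "(\<lambda>_. 1) \<in> LD (- pnt q + pnt q)" by (rule LD_const) simp
  moreover have "(\<lambda>_. 1) \<notin> LD (- pnt q)"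
  proof
    assume "(\<lambda>_. 1) \<in> LD (- pnt q)"
    from LD_nz_ord[OF this nz_const q] show False using ord_at_const[OF q, of 1] by (simp add: lookup_pnt)
  qed
  ultimately have "ell (- pnt q) + 1 \<le> ell (- pnt q + pnt q)"
    by (rule ell_add_point_ge[OF divisors_uminus[OF divisors_single[OF q]] q])
  then have "0 + 1 \<le> ell (Poly_Mapping.single q (int 0))" by simp
  then show ?case .
next
  case (Suc m)
  have "f \<in> LD (0 + pnt q)" using f(1) by simp
  note f_ord = not_in_LD_ord[OF this f(2) q]
  let ?D = "Poly_Mapping.single q (int m)"
  have eq: "?D + pnt q = Poly_Mapping.single q (int (Suc m))" by (simp add: add.commute flip: single_add)
  have "(\<lambda>p. f p ^ Suc m) \<in> LD (?D + pnt q)" unfolding eq by (rule power_in_LD[OF q f(1) f_ord(1)])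
  moreover have "(\<lambda>p. f p ^ Suc m) \<notin> LD ?D"
  proof
    assume "(\<lambda>p. f p ^ Suc m) \<in> LD ?D"
    from LD_nz_ord[OF this nz_power[OF f_ord(1)] q] show False
      using f_ord(2) unfolding ord_at_power[OF q LD_rational[OF f(1)] f_ord(1)] by (simp add: lookup_pnt)
  qed
  ultimately have "ell ?D + 1 \<le> ell (?D + pnt q)"
    by (rule ell_add_point_ge[OF divisors_single[OF q] q])
  moreover have "m + 1 \<le> ell ?D" by (rule Suc.IH)
  ultimately have "Suc m + 1 \<le> ell (Poly_Mapping.single q (int (Suc m)))" unfolding eq by simp
  then show ?case .
qed

text \<open>The function is \<open>f\<close> minus its value at \<open>r\<close>. It has at most a
  simple pole, at \<open>q\<close>, and a zero at \<open>r\<close>; the divisor bounding it has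
  degree 0, which leaves room for no further zeros.\<close>

lemma principal_point_difference:
  assumes q: "q \<in> C" and f: "f \<in> LD (pnt q)" "f \<notin> LD 0" and r: "r \<in> C"
  shows "\<exists>g. rational g \<and> nz g \<and> (\<forall>x\<in>C. ord_at C x g = (if x = r then 1 else 0) - (if x = q then 1 else 0))"
proof (cases "r = q")
  case True
  then show ?thesis
    by (intro exI[of _ "\<lambda>_. 1"] conjI ballI rational_const nz_const) (simp_all add: ord_at_const)
next
  case False
  have "vge r 0 f" using LD_D[OF f(1) r] False by (simp add: lookup_pnt)
  then obtain c where c: "vge r 1 (\<lambda>p. f p - c)"
    using vge_eliminate[OF r rational_const nz_const, of 1 f] ord_at_const[OF r, of 1] by auto
  let ?g = "\<lambda>p. f p - c"
  have fc: "vge p (- (if p = q then 1 else 0)) ?g" if "p \<in> C" for p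
    using LD_D[OF f(1) that] vge_mono[OF vge_const[OF that]] unfolding lookup_pnt
    by (intro vge_diff that) auto
  have g: "?g \<in> LD (pnt q - pnt r)"
  proof (rule LD_I)
    fix p assume p: "p \<in> C"
    show "vge p (- dmult (pnt q - pnt r) p) ?g"
      using c fc[OF p] False by (cases "p = r") (auto simp: lookup_minus lookup_pnt)
  qed
  have "nz ?g"
  proof (rule ccontr)
    assume "\<not> nz ?g"
    then have "?g \<doteq> (\<lambda>_. 0)" using LD_dichotomy[OF g] by blast
    then have "(\<lambda>_. c) \<doteq> f" by eventually_elim simp
    from LD_cong[OF this LD_const] f(2) show False by simp
  qed
  have "ord_at C x ?g = (if x = r then 1 else 0) - (if x = q then 1 else 0)" if "x \<in> C" for x
    using degree_zero[OF divisors_diff[OF divisors_single[OF q] divisors_single[OF r]] _ g \<open>nz ?g\<close> that]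
    by (simp add: deg_diff lookup_minus lookup_pnt)
  then show ?thesis using LD_rational[OF g] \<open>nz ?g\<close> by blast
qed

text \<open>The function of \<open>principal_point_difference\<close>, raised to the multiplicity,
  moves one point of the support to \<open>q\<close> at a time.\<close>

lemma principal_divisor_difference:
  assumes q: "q \<in> C" and f: "f \<in> LD (pnt q)" "f \<notin> LD 0" and D: "D \<in> divisors C"
  shows "\<exists>g. rational g \<and> nz g \<and>
    (\<forall>x\<in>C. ord_at C x g = dmult D x - (if x = q then deg D else 0))"
  using D
proof (induction D rule: Poly_Mapping.update_induct)
  case const
  show ?case
    by (intro exI[of _ "\<lambda>_. 1"] conjI ballI rational_const nz_const) (simp_all add: ord_at_const)
next
  case (update D r n)
  have eq: "Poly_Mapping.update r n D = D + Poly_Mapping.single r n"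
    using update(1) by (intro poly_mapping_eqI) (auto simp: lookup_add lookup_update lookup_pnt in_keys_iff)
  have "r \<in> Poly_Mapping.keys (Poly_Mapping.update r n D)" using update(2) by (simp add: in_keys_iff lookup_update)
  then have r: "r \<in> C" using update(4) by (auto simp: divisors_def)
  have "Poly_Mapping.keys D \<subseteq> Poly_Mapping.keys (Poly_Mapping.update r n D)"
    using update(2) by (auto simp: in_keys_iff lookup_update)
  then have "D \<in> divisors C" using update(4) by (auto simp: divisors_def)
  from update(3)[OF this] obtain g where g: "rational g" "nz g"
    "\<forall>x\<in>C. ord_at C x g = dmult D x - (if x = q then deg D else 0)" by blast
  obtain h where h: "rational h" "nz h"
    "\<forall>x\<in>C. ord_at C x h = (if x = r then 1 else 0) - (if x = q then 1 else 0)"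
    using principal_point_difference[OF q f r] by blast
  show ?case
  proof (intro exI[of _ "\<lambda>x. g x * h x powi n"] conjI ballI rational_mult nz_mult rational_powi nz_powi g h)
    fix x assume x: "x \<in> C"
    show "ord_at C x (\<lambda>x. g x * h x powi n) =
      dmult (Poly_Mapping.update r n D) x - (if x = q then deg (Poly_Mapping.update r n D) else 0)"
      unfolding eq ord_at_mult[OF x g(1,2) rational_powi[OF h(1)] nz_powi[OF h(2)]] ord_at_powi[OF x h(1,2)]
      using g(3) h(3) x by (simp add: lookup_add deg_add lookup_pnt)
  qed
qed

text \<open>A function with a single simple pole would make all divisors of the same degree linearly
  equivalent and force \<open>ell D \<ge> deg D + 1\<close> for all \<open>D\<close> of nonnegative degree, that is, genus \<open>0\<close>.\<close>

lemma ell_point_le: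
  assumes q: "q \<in> C"
  shows "ell (pnt q) \<le> 1"
proof (rule ccontr)
  assume big: "\<not> ell (pnt q) \<le> 1"
  have "\<exists>f\<in>LD (pnt q). f \<notin> LD 0"
  proof (rule ccontr)
    assume no: "\<not> (\<exists>f\<in>LD (pnt q). f \<notin> LD 0)"
    have "(\<lambda>_. 1) \<in> LD (pnt q)" by (rule LD_const) (simp add: lookup_pnt)
    then obtain s where s: "s \<in> sections C (pnt q)" "s \<doteq> (\<lambda>_. 1)" using normalise by blast
    have "sections C (pnt q) \<subseteq> cvec.span {s}"
    proof
      fix f assume f: "f \<in> sections C (pnt q)"
      then have "f \<in> LD 0" using no sections_LD by blast
      then obtain c where c: "f \<doteq> (\<lambda>_. c)" using LD_0_const by blast
      have "f = c *\<^sub>C s"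
        by (rule sections_ext[OF f sections_scale[OF s(1)]]) (use c s(2) in eventually_elim, simp)
      then show "f \<in> cvec.span {s}" by (simp add: cvec.span_scale cvec.span_base)
    qed
    from cvec.dim_le_card[OF this] big show False by simp
  qed
  then obtain f where f: "f \<in> LD (pnt q)" "f \<notin> LD 0" by blast
  \<comment> \<open>The divisor at which Riemann's inequality is sharp exists by the minimality of
    the genus. It is equivalent to a multiple of \<open>q\<close>, whose sections are too
    numerous.\<close>
  obtain D where D: "D \<in> divisors C" "int (ell D) = deg D"
    using genus unfolding has_genus_def by auto
  define m where "m = nat (deg D)"
  have m: "deg D = int m" using D(2) by (simp add: m_def)
  obtain g where g: "rational g" "nz g"
    "\<forall>x\<in>C. ord_at C x g = dmult D x - (if x = q then deg D else 0)"
    using principal_divisor_difference[OF q f D(1)] by blast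
  have "ell (Poly_Mapping.single q (int m)) \<le> ell D"
  proof (rule ell_le[OF nz_inverse[OF g(2)] _ D(1)])
    fix h assume h: "h \<in> LD (Poly_Mapping.single q (int m))"
    have "(\<lambda>x. inverse (g x)) \<in> LD (D - Poly_Mapping.single q (int m))"
      by (rule LD_ordI[OF rational_inverse[OF g(1)]])
        (simp add: ord_at_inverse[OF _ g(1,2)] g(3) lookup_minus lookup_pnt m)
    from LD_mult[OF this h] show "(\<lambda>x. inverse (g x) * h x) \<in> LD D" by simp
  qed
  then show False using ell_multiple_ge[OF q f, of m] D(2) m by simp
qed

text \<open>Each point adds at most one dimension, so degree 1 is the essential case. If
  \<open>D\<close> of degree 1 had two independent sections, \<open>D - pnt q\<close> would have a
  nonzero one. In degree 0 this section trivialises the bundle, so \<open>D\<close> is equivalent to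
  \<open>pnt q\<close>, where \<open>ell_point_le\<close> applies.\<close>

lemma ell_le_deg:
  assumes "D \<in> divisors C" "1 \<le> deg D"
  shows "int (ell D) \<le> deg D"
proof -
  obtain q where q: "q \<in> C" using C_nonempty ..
  have "int (ell D) \<le> deg D" if "D \<in> divisors C" "deg D = int n + 1" for n D
    using that
  proof (induction n arbitrary: D)
    case 0
    show ?case
    proof (rule ccontr)
      assume "\<not> int (ell D) \<le> deg D"
      then have big: "2 \<le> ell D" using 0 by simp
      let ?E = "D - pnt q"
      have E: "?E \<in> divisors C" by (intro divisors_diff 0 divisors_single q)
      have "ell D \<le> ell ?E + 1" using ell_add_point_le[OF E q] by simp
      then obtain w where w: "w \<in> sections C ?E" "nz w" using ell_pos[of ?E] big by auto
      have deg0: "deg ?E = 0" using 0 by (simp add: deg_diff)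
      note w_ord = degree_zero[OF E deg0 sections_LD[OF w(1)] w(2)]
      note rat = LD_rational[OF sections_LD[OF w(1)]]
      have "ell D \<le> ell (pnt q)"
      proof (rule ell_le[OF nz_inverse[OF w(2)] _ divisors_single[OF q]])
        fix f assume f: "f \<in> LD D"
        have "(\<lambda>x. inverse (w x)) \<in> LD (pnt q - D)"
          by (rule LD_ordI[OF rational_inverse[OF rat]])
            (simp add: ord_at_inverse[OF _ rat w(2)] w_ord lookup_minus)
        from LD_mult[OF this f] show "(\<lambda>x. inverse (w x) * f x) \<in> LD (pnt q)" by simp
      qed
      then show False using ell_point_le[OF q] big by simp
    qed
  next
    case (Suc n)
    let ?E = "D - pnt q"
    have E: "?E \<in> divisors C" by (intro divisors_diff Suc divisors_single q)
    have "int (ell ?E) \<le> deg ?E" by (rule Suc.IH[OF E]) (simp add: deg_diff Suc)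
    moreover have "ell D \<le> ell ?E + 1" using ell_add_point_le[OF E q] by simp
    ultimately have "int (ell D) \<le> deg D" by (simp add: deg_diff)
    then show ?case .
  qed
  from this[of D "nat (deg D - 1)"] assms show ?thesis by simp
qed

theorem ell_eq_deg:
  assumes "D \<in> divisors C" "1 \<le> deg D"
  shows "int (ell D) = deg D"
  using ell_le_deg[OF assms] riemann[OF assms(1)] by simp

text \<open>Otherwise the dimension would not grow with the degree.\<close>

lemma exact_pole:
  assumes D: "D \<in> divisors C" "1 \<le> deg D" and q: "q \<in> C"
  shows "\<exists>s. s \<in> sections C (D + pnt q) \<and> s \<notin> LD D"
proof (rule ccontr)
  assume no: "\<not> ?thesis"
  have "f \<in> LD D" if f: "f \<in> LD (D + pnt q)" for f
  proof -
    obtain s where "s \<in> sections C (D + pnt q)" "s \<doteq> f" using normalise[OF f] by blast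
    then show ?thesis using no LD_cong by blast
  qed
  then have "ell (D + pnt q) \<le> ell D" by (rule ell_mono[OF _ D(1)])
  then show False
    using ell_eq_deg[OF D] ell_eq_deg[OF divisors_add[OF D(1) divisors_single[OF q]], of 1] D(2)
    by (simp add: deg_add)
qed

end

section \<open>Bivectors and Zariski topology\<close>

lemma clinear_add: "clinear f \<Longrightarrow> f (x + y) = f x + f y"
  by (simp add: clinear_iff)

lemma clinear_scale: "clinear f \<Longrightarrow> f (c *\<^sub>C x) = c *\<^sub>C f x"
  by (simp add: clinear_iff)

lemma clinear_0: "clinear f \<Longrightarrow> f 0 = 0"
  by (rule cvec_pair.linear_0)

lemma clinear_fst: "clinear (f :: 'a::complex_vector \<Rightarrow> complex) \<Longrightarrow> clinear (\<lambda>x :: 'a \<times> 'b::complex_vector. f (fst x))"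
  by (simp add: clinear_iff scaleC_prod_def)

lemma clinear_snd: "clinear (f :: 'b::complex_vector \<Rightarrow> complex) \<Longrightarrow> clinear (\<lambda>x :: 'a::complex_vector \<times> 'b. f (snd x))"
  by (simp add: clinear_iff scaleC_prod_def)

lemma clinear_projections: "clinear fst" "clinear snd"
  by (simp_all add: clinear_iff scaleC_prod_def)

lemma clinear_comp: "clinear f \<Longrightarrow> clinear g \<Longrightarrow> clinear (\<lambda>x. f (g x))"
  by (simp add: clinear_iff)

lemma wedge_apply: "clinear \<phi> \<Longrightarrow> clinear \<psi> \<Longrightarrow> wedge s t (\<phi>, \<psi>) = \<phi> s * \<psi> t - \<phi> t * \<psi> s"
  by (simp add: wedge_def)

lemma wedge_add_left: "wedge (s + s') t = wedge s t + wedge s' t"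
  by (auto simp: wedge_def fun_eq_iff clinear_add algebra_simps)

lemma wedge_add_right: "wedge s (t + t') = wedge s t + wedge s t'"
  by (auto simp: wedge_def fun_eq_iff clinear_add algebra_simps)

lemma wedge_scale_left: "wedge (c *\<^sub>C s) t = c *\<^sub>C wedge s t"
  by (auto simp: wedge_def fun_eq_iff clinear_scale algebra_simps)

lemma wedge_scale_right: "wedge s (c *\<^sub>C t) = c *\<^sub>C wedge s t"
  by (auto simp: wedge_def fun_eq_iff clinear_scale algebra_simps)

lemma wedge_self: "wedge s s = 0"
  by (auto simp: wedge_def fun_eq_iff)

lemma wedge_0: "wedge 0 t = 0" "wedge s 0 = 0"
  by (auto simp: wedge_def fun_eq_iff clinear_0)

lemma wedge_nonzero_iff: "wedge s t \<noteq> 0 \<longleftrightarrow> s \<noteq> t \<and> cvec.independent {s, t}"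
proof
  assume nz: "wedge s t \<noteq> 0"
  then have "s \<noteq> t" using wedge_self by blast
  moreover have "s \<notin> cvec.span {t}"
  proof
    assume "s \<in> cvec.span {t}"
    then obtain c where "s = c *\<^sub>C t" by (auto simp: cvec.span_singleton)
    then have "wedge s t = c *\<^sub>C wedge t t" by (simp only: wedge_scale_left)
    then show False using nz by (simp add: wedge_self)
  qed
  moreover have "t \<noteq> 0" using nz wedge_0 by blast
  then have "cvec.independent {t}" by simp
  ultimately have "cvec.independent {s, t}" by (intro cvec.independent_insertI[of s "{t}"])
  then show "s \<noteq> t \<and> cvec.independent {s, t}" using \<open>s \<noteq> t\<close> by blast
next
  assume st: "s \<noteq> t \<and> cvec.independent {s, t}"
  then have "cvec.independent {s, t}" "cvec.independent {t, s}" by (simp_all add: insert_commute)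
  then have s: "s \<notin> cvec.span {t}" "s \<noteq> 0" and t: "t \<notin> cvec.span {s}" "t \<noteq> 0"
    using st by (auto simp: cvec.independent_insert)
  obtain \<phi> :: "'a \<Rightarrow> complex" where \<phi>: "clinear \<phi>" "\<phi> t = 0" "\<phi> s = 1" using separating_functional[OF t(2) s(1)] .
  obtain \<psi> :: "'a \<Rightarrow> complex" where \<psi>: "clinear \<psi>" "\<psi> s = 0" "\<psi> t = 1" using separating_functional[OF s(2) t(1)] .
  have "wedge s t (\<phi>, \<psi>) = 1" using wedge_apply[OF \<phi>(1) \<psi>(1)] \<phi> \<psi> by simp
  then show "wedge s t \<noteq> 0" by auto
qed

text \<open>Functionals pull back along \<open>p\<close>, so a pair of them detecting the image also
  detects the bivector itself.\<close>

lemma wedge_image_nonzero: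
  assumes "clinear p" "wedge (p s) (p t) \<noteq> 0"
  shows "wedge s t \<noteq> 0"
proof
  assume z: "wedge s t = 0"
  have "wedge (p s) (p t) x = 0 x" for x
  proof (cases "clinear (fst x) \<and> clinear (snd x)")
    case True
    then show ?thesis
      using fun_cong[OF z, of "(\<lambda>v. fst x (p v), \<lambda>v. snd x (p v))"]
      by (cases x) (simp add: wedge_apply clinear_comp[OF _ assms(1)])
  qed (auto simp: wedge_def split: prod.split)
  then show False using assms(2) by blast
qed

text \<open>The kernel condition depends on the line only: any two bivectors spanning it are
  proportional, so it may be tested on \<open>wedge s t\<close> by
  \<open>second_det_wedge\<close>.\<close>

lemma rank_one_pencils_iff:
  "L \<in> rank_one_pencils C D1 D2 \<longleftrightarrow> (\<exists>s t. s \<in> sections2 C D1 D2 \<and> t \<in> sections2 C D1 D2 \<and>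
     wedge s t \<noteq> 0 \<and> fst s * snd t = fst t * snd s \<and> L = cvec.span {wedge s t})"
proof
  assume "L \<in> rank_one_pencils C D1 D2"
  then obtain s t \<omega> where st: "s \<in> sections2 C D1 D2" "t \<in> sections2 C D1 D2" "s \<noteq> t" "cvec.independent {s, t}"
      "L = cvec.span {wedge s t}"
    and \<omega>: "second_det \<omega> = 0" "L = cvec.span {\<omega>}"
    unfolding rank_one_pencils_def Gr2_def proj_def by blast
  have "wedge s t \<in> cvec.span {\<omega>}" using st(5) \<omega>(2) cvec.span_base[of "wedge s t" "{wedge s t}"] by simp
  then obtain c where "wedge s t = c *\<^sub>C \<omega>" by (auto simp: cvec.span_singleton)
  then have "second_det (wedge s t) = c *\<^sub>C second_det \<omega>" by (simp only: clinear_scale[OF second_det_linear])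
  then have "fst s * snd t - fst t * snd s = 0" using \<omega>(1) unfolding second_det_wedge by simp
  then have "fst s * snd t = fst t * snd s" by simp
  moreover have "wedge s t \<noteq> 0" using st by (simp add: wedge_nonzero_iff)
  ultimately show "\<exists>s t. s \<in> sections2 C D1 D2 \<and> t \<in> sections2 C D1 D2 \<and>
     wedge s t \<noteq> 0 \<and> fst s * snd t = fst t * snd s \<and> L = cvec.span {wedge s t}" using st by blast
next
  assume "\<exists>s t. s \<in> sections2 C D1 D2 \<and> t \<in> sections2 C D1 D2 \<and>
     wedge s t \<noteq> 0 \<and> fst s * snd t = fst t * snd s \<and> L = cvec.span {wedge s t}"
  then obtain s t where st: "s \<in> sections2 C D1 D2" "t \<in> sections2 C D1 D2"
     "wedge s t \<noteq> 0" "fst s * snd t = fst t * snd s" "L = cvec.span {wedge s t}" by blast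
  have "second_det (wedge s t) = 0" using st(4) unfolding second_det_wedge by simp
  moreover have "wedge s t \<in> exterior_square (sections2 C D1 D2)"
    unfolding exterior_square_def using st(1,2) by (intro cvec.span_base) blast
  ultimately show "L \<in> rank_one_pencils C D1 D2"
    using st wedge_nonzero_iff[of s t] unfolding rank_one_pencils_def Gr2_def proj_def by blast
qed

lemma span_in_proj: "\<omega> \<noteq> 0 \<Longrightarrow> cvec.span {\<omega>} \<in> proj UNIV"
  by (auto simp: proj_def)

lemma rank_one_pencils_proj: "rank_one_pencils C D1 D2 \<subseteq> proj UNIV"
  unfolding rank_one_pencils_def proj_def by auto

lemma rep_span_nonzero:
  assumes "hom_poly d f" "\<omega> \<noteq> 0"
  shows "f (rep (cvec.span {\<omega>})) \<noteq> 0 \<longleftrightarrow> f \<omega> \<noteq> 0"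
  using rep_nonzero_iff[OF assms(1) span_in_proj[OF assms(2)]] line_nonzero_iff[OF assms(1), of \<omega>] by argo

lemma topspace_sub: "G \<subseteq> proj UNIV \<Longrightarrow> topspace (subtopology zariski G) = G"
  by (rule topspace_subtopology_subset) (simp add: topspace_zariski)

section \<open>Criteria for irreducibility\<close>

lemma not_irreducibleI:
  fixes G :: "'v::complex_vector set set"
  assumes G: "G \<subseteq> proj UNIV" and F: "hom_poly d F" and H: "hom_poly e H"
    and cover: "\<And>L. L \<in> G \<Longrightarrow> F (rep L) = 0 \<or> H (rep L) = 0"
    and "L1 \<in> G" "F (rep L1) \<noteq> 0" "L2 \<in> G" "H (rep L2) \<noteq> 0"
  shows "\<not> irreducible_space (subtopology zariski G)"
proof
  assume irr: "irreducible_space (subtopology zariski G)"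
  define Z where "Z f = {q \<in> proj UNIV. f (rep q) = 0} \<inter> G" for f :: "'v \<Rightarrow> complex"
  have "closedin (subtopology zariski G) (Z F)" "closedin (subtopology zariski G) (Z H)"
    using closedin_zero_locus[OF F] closedin_zero_locus[OF H] unfolding Z_def closedin_subtopology by blast+
  moreover have "G = Z F \<union> Z H" using G cover by (auto simp: Z_def)
  ultimately have "Z F = G \<or> Z H = G"
    using irr unfolding irreducible_space_def topspace_sub[OF G] by blast
  then show False using assms(5-8) by (auto simp: Z_def)
qed

text \<open>A proper closed subset lies in the zero set of a form that is nonzero somewhere on
  \<open>G\<close>. It therefore suffices that the nonvanishing loci of two such forms meet.\<close>

lemma irreducibleI:
  assumes G: "G \<subseteq> proj UNIV" "G \<noteq> {}"
    and *: "\<And>d F e H L1 L2. hom_poly d F \<Longrightarrow> hom_poly e H \<Longrightarrow> L1 \<in> G \<Longrightarrow> F (rep L1) \<noteq> 0 \<Longrightarrow>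
      L2 \<in> G \<Longrightarrow> H (rep L2) \<noteq> 0 \<Longrightarrow> \<exists>L\<in>G. F (rep L) \<noteq> 0 \<and> H (rep L) \<noteq> 0"
  shows "irreducible_space (subtopology zariski G)"
  unfolding irreducible_space_def topspace_sub[OF G(1)]
proof (intro conjI allI impI G(2))
  fix A B assume AB: "closedin (subtopology zariski G) A \<and> closedin (subtopology zariski G) B \<and> G = A \<union> B"
  have ex: "\<exists>d f. \<exists>L\<in>G. hom_poly d f \<and> f (rep L) \<noteq> 0 \<and> (\<forall>L\<in>A. f (rep L) = 0)"
    if A: "closedin (subtopology zariski G) A" "A \<noteq> G" for A
  proof -
    obtain Z where Z: "closedin zariski Z" "A = Z \<inter> G" using A(1) unfolding closedin_subtopology by blast
    obtain \<F> where \<F>: "\<forall>f\<in>\<F>. \<exists>d. hom_poly d f" "Z = {q \<in> proj UNIV. \<forall>f\<in>\<F>. f (rep q) = 0}"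
      using Z(1) unfolding closedin_zariski by (elim exE conjE)
    obtain L where L: "L \<in> G" "L \<notin> Z" using A(2) Z(2) by blast
    then obtain f where f: "f \<in> \<F>" "f (rep L) \<noteq> 0" using \<F>(2) G(1) by blast
    obtain d where "hom_poly d f" using \<F>(1) f(1) by blast
    moreover have "\<forall>L\<in>A. f (rep L) = 0" using Z(2) \<F>(2) f(1) by blast
    ultimately show ?thesis using L(1) f(2) by blast
  qed
  show "A = G \<or> B = G"
  proof (rule ccontr)
    assume "\<not> (A = G \<or> B = G)"
    then have AG: "A \<noteq> G" and BG: "B \<noteq> G" by auto
    obtain d F L1 where F: "L1 \<in> G" "hom_poly d F" "F (rep L1) \<noteq> 0" "\<forall>L\<in>A. F (rep L) = 0"
      using ex[OF _ AG] AB by blast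
    obtain e H L2 where H: "L2 \<in> G" "hom_poly e H" "H (rep L2) \<noteq> 0" "\<forall>L\<in>B. H (rep L) = 0"
      using ex[OF _ BG] AB by blast
    obtain L where "L \<in> G" "F (rep L) \<noteq> 0" "H (rep L) \<noteq> 0" using *[OF F(2) H(2) F(1,3) H(1,3)] by blast
    then show False using AB F(4) H(4) by blast
  qed
qed

text \<open>Polynomiality is tested by functionals, as the space of bivectors is
  infinite-dimensional; forms are built from functionals, so this is what
  \<open>hom_poly_curve\<close> needs.\<close>

definition poly_curve :: "(complex \<Rightarrow> 'v::complex_vector) \<Rightarrow> bool" where
  "poly_curve \<gamma> \<longleftrightarrow> (\<forall>\<phi> :: 'v \<Rightarrow> complex. clinear \<phi> \<longrightarrow> (\<exists>p. \<forall>t. \<phi> (\<gamma> t) = poly p t))"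

lemma poly_curve_add: "poly_curve \<gamma> \<Longrightarrow> poly_curve \<delta> \<Longrightarrow> poly_curve (\<lambda>t. \<gamma> t + \<delta> t)"
  unfolding poly_curve_def
proof (intro allI impI)
  fix \<phi> :: "'a \<Rightarrow> complex"
  assume *: "\<forall>\<phi>. clinear \<phi> \<longrightarrow> (\<exists>p. \<forall>t. \<phi> (\<gamma> t) = poly p t)" "\<forall>\<phi>. clinear \<phi> \<longrightarrow> (\<exists>p. \<forall>t. \<phi> (\<delta> t) = poly p t)"
    and \<phi>: "clinear \<phi>"
  then obtain p q where "\<forall>t. \<phi> (\<gamma> t) = poly p t" "\<forall>t. \<phi> (\<delta> t) = poly q t" by blast
  then show "\<exists>p. \<forall>t. \<phi> (\<gamma> t + \<delta> t) = poly p t"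
    by (intro exI[of _ "p + q"]) (simp add: clinear_add[OF \<phi>])
qed

lemma poly_curve_scale: "poly_curve \<gamma> \<Longrightarrow> poly_curve (\<lambda>t. poly p t *\<^sub>C \<gamma> t)"
  unfolding poly_curve_def
proof (intro allI impI)
  fix \<phi> :: "'a \<Rightarrow> complex"
  assume *: "\<forall>\<phi>. clinear \<phi> \<longrightarrow> (\<exists>p. \<forall>t. \<phi> (\<gamma> t) = poly p t)" and \<phi>: "clinear \<phi>"
  then obtain q where "\<forall>t. \<phi> (\<gamma> t) = poly q t" by blast
  then show "\<exists>q. \<forall>t. \<phi> (poly p t *\<^sub>C \<gamma> t) = poly q t"
    by (intro exI[of _ "p * q"]) (simp add: clinear_scale[OF \<phi>])
qed

lemma poly_curve_const: "poly_curve (\<lambda>t. x)"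
  unfolding poly_curve_def
proof (intro allI impI)
  fix \<phi> :: "'a \<Rightarrow> complex"
  show "\<exists>p. \<forall>t::complex. \<phi> x = poly p t" by (rule exI[of _ "[:\<phi> x:]"]) simp
qed

lemma hom_poly_curve:
  assumes "hom_poly d F" "poly_curve \<gamma>"
  shows "\<exists>p. \<forall>t. F (\<gamma> t) = poly p t"
  using assms(1)
proof induction
  case (const c)
  show ?case by (rule exI[of _ "[:c:]"]) simp
next
  case (mult \<phi> d f)
  obtain q where q: "\<forall>t. \<phi> (\<gamma> t) = poly q t" using assms(2) mult(1) unfolding poly_curve_def by blast
  obtain p where "\<forall>t. f (\<gamma> t) = poly p t" using mult.IH ..
  then show ?case using q by (intro exI[of _ "q * p"]) simp
next
  case (add d f g)
  obtain q where q: "\<forall>t. g (\<gamma> t) = poly q t" using add.IH(2) ..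
  obtain p where "\<forall>t. f (\<gamma> t) = poly p t" using add.IH(1) ..
  then show ?case using q by (intro exI[of _ "p + q"]) simp
qed

lemma poly_curve_wedge:
  "poly_curve (\<lambda>t. wedge (u + t *\<^sub>C u') (w + t *\<^sub>C w'))"
proof -
  have "wedge (u + t *\<^sub>C u') (w + t *\<^sub>C w') =
    wedge u w + poly [:0, 1:] t *\<^sub>C (wedge u w' + wedge u' w + poly [:0, 1:] t *\<^sub>C wedge u' w')" for t
    unfolding wedge_add_left wedge_add_right wedge_scale_left wedge_scale_right
    by (simp add: cvec.scale_right_distrib)
  then show ?thesis by (simp only: poly_curve_add poly_curve_scale poly_curve_const)
qed

text \<open>With \<open>T\<close> the isomorphism from the sections of \<open>\<O>(a P)\<close> to
  those of \<open>\<O>(a Q)\<close>, this embeds the plane of \<open>u\<close> and \<open>w\<close>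
  with constant ratio \<open>l : m\<close> of the components.\<close>

definition pencil :: "('v::complex_vector \<Rightarrow> 'w::complex_vector) \<Rightarrow> complex \<Rightarrow> complex \<Rightarrow> 'v \<Rightarrow> 'v \<Rightarrow> ('v \<times> 'w) bivector"
  where "pencil T l m u w = wedge (l *\<^sub>C u, m *\<^sub>C T u) (l *\<^sub>C w, m *\<^sub>C T w)"

text \<open>Separating the two summands gives four wedges of affine lines, whose coefficients are
  products of two of the polynomials \<open>?l\<close> and \<open>?m\<close>.\<close>

lemma poly_curve_pencil:
  fixes T :: "'v::complex_vector \<Rightarrow> 'w::complex_vector"
  assumes T: "clinear T"
  shows "poly_curve (\<lambda>t. pencil T (l + t * l') (m + t * m') (u + t *\<^sub>C u') (w + t *\<^sub>C w'))"
proof -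
  let ?l = "[:l, l':]" and ?m = "[:m, m':]"
  define x where "x v = (v, 0 :: 'w)" for v :: 'v
  define y where "y v = (0 :: 'v, T v)" for v
  have line: "x (v + t *\<^sub>C v') = x v + t *\<^sub>C x v'" "y (v + t *\<^sub>C v') = y v + t *\<^sub>C y v'" for v v' t
    by (simp_all add: x_def y_def scaleC_prod_def clinear_add[OF T] clinear_scale[OF T])
  have split: "(r *\<^sub>C v, k *\<^sub>C T v) = r *\<^sub>C x v + k *\<^sub>C y v" for r k v
    by (simp add: x_def y_def scaleC_prod_def)
  have expand: "pencil T r k v z = (r * r) *\<^sub>C wedge (x v) (x z) + (r * k) *\<^sub>C wedge (x v) (y z) +
      ((r * k) *\<^sub>C wedge (y v) (x z) + (k * k) *\<^sub>C wedge (y v) (y z))" for r k v z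
    unfolding pencil_def split wedge_add_left wedge_add_right wedge_scale_left wedge_scale_right
    by (simp add: cvec.scale_right_distrib algebra_simps)
  have "pencil T (l + t * l') (m + t * m') (u + t *\<^sub>C u') (w + t *\<^sub>C w') =
      poly (?l * ?l) t *\<^sub>C wedge (x u + t *\<^sub>C x u') (x w + t *\<^sub>C x w') +
      poly (?l * ?m) t *\<^sub>C wedge (x u + t *\<^sub>C x u') (y w + t *\<^sub>C y w') +
      (poly (?l * ?m) t *\<^sub>C wedge (y u + t *\<^sub>C y u') (x w + t *\<^sub>C x w') +
      poly (?m * ?m) t *\<^sub>C wedge (y u + t *\<^sub>C y u') (y w + t *\<^sub>C y w'))" for t
    unfolding expand line poly_mult by simp
  then show ?thesis by (simp only: poly_curve_add poly_curve_scale poly_curve_wedge)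
qed

lemma three_polys_nonzero:
  fixes p q r :: "complex poly"
  assumes "p \<noteq> 0" "q \<noteq> 0" "r \<noteq> 0"
  obtains t where "poly p t \<noteq> 0" "poly q t \<noteq> 0" "poly r t \<noteq> 0"
proof -
  have "finite {t. poly (p * q * r) t = 0}" using assms by (intro poly_roots_finite) simp
  then have "\<exists>t. t \<notin> {t. poly (p * q * r) t = 0}" by (rule ex_new_if_finite[OF infinite_UNIV_char_0])
  then show ?thesis using that by auto
qed

text \<open>The determinant tests whether the products \<open>m g\<close> with \<open>m \<in> M\<close> and \<open>g\<close> in the pencil, which are
  contractions of the bivector, span \<open>W\<close>.\<close>

lemma spanning_form:
  fixes W :: "'b::complex_vector set" and M :: "('b \<Rightarrow> 'b) set" and g1 g2 :: 'b
  assumes M: "\<And>m. m \<in> M \<Longrightarrow> clinear m" and W: "findim W"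
    and MW: "\<And>m. m \<in> M \<Longrightarrow> m g1 \<in> W" "\<And>m. m \<in> M \<Longrightarrow> m g2 \<in> W"
    and WM: "W \<subseteq> cvec.span {m g | m g. m \<in> M \<and> g \<in> {g1, g2}}"
    and g: "wedge g1 g2 \<noteq> 0"
  shows "\<exists>d (F :: ('a::complex_vector \<times> 'b) bivector \<Rightarrow> complex).
    hom_poly d F \<and> F (wedge (0, g1) (0, g2)) \<noteq> 0 \<and>
    (\<forall>s t \<kappa> x. clinear \<kappa> \<and> x \<in> W \<and> \<kappa> x \<noteq> (0::complex) \<and>
      (\<forall>m\<in>M. m (snd s) \<in> W \<and> m (snd t) \<in> W \<and> \<kappa> (m (snd s)) = 0 \<and> \<kappa> (m (snd t)) = 0) \<longrightarrow>
      F (wedge s t) = 0)"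
proof -
  let ?X = "{m g | m g. m \<in> M \<and> g \<in> {g1, g2}}"
  \<comment> \<open>Every basis vector is a single product of a multiplier with \<open>g1\<close> or
    \<open>g2\<close>; this makes the matrix below the identity at the reference pencil.\<close>
  obtain B where B: "B \<subseteq> ?X" "cvec.independent B" "?X \<subseteq> cvec.span B"
    using cvec.maximal_independent_subset[of ?X] .
  have "?X \<subseteq> W" using MW by auto
  then have "B \<subseteq> cvec.span W" using B(1) cvec.span_superset[of W] by blast
  then have finB: "finite B" using independent_card_le[OF W B(2)] by blast
  have "cvec.span ?X \<subseteq> cvec.span B" by (rule cvec.span_minimal[OF B(3) cvec.subspace_span])
  then have WB: "W \<subseteq> cvec.span B" using WM by (rule subset_trans[rotated])
  define N where "N = card B"
  obtain b where b: "bij_betw b {0..<N} B" using ex_bij_betw_nat_finite[OF finB] N_def by blast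
  have bB: "b i \<in> B" if "i < N" for i using b that by (auto simp: bij_betw_def)
  have b_inj: "b i = b j \<longleftrightarrow> i = j" if "i < N" "j < N" for i j
    using b that by (auto simp: bij_betw_def inj_on_def)
  have "\<forall>i. \<exists>m g. i < N \<longrightarrow> m \<in> M \<and> g \<in> {g1, g2} \<and> b i = m g" using bB B(1) by blast
  then obtain m gg where mg: "\<And>i. i < N \<Longrightarrow> m i \<in> M" "\<And>i. i < N \<Longrightarrow> gg i \<in> {g1, g2}" "\<And>i. i < N \<Longrightarrow> b i = m i (gg i)"
    by metis
  have "\<forall>i. \<exists>l :: 'b \<Rightarrow> complex. clinear l \<and> (\<forall>x\<in>B. l x = (if x = b i then 1 else 0))"
    by (rule allI) (rule cvec_pair.linear_independent_extend[OF B(2)])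
  from choice[OF this] obtain l :: "nat \<Rightarrow> 'b \<Rightarrow> complex"
    where l: "\<forall>i. clinear (l i) \<and> (\<forall>x\<in>B. l i x = (if x = b i then 1 else 0))" ..
  have l_lin: "clinear (l i)" for i using l by blast
  have l_B: "l i (b j) = (if i = j then 1 else 0)" if "i < N" "j < N" for i j
    using l bB[OF that(2)] b_inj[OF that(2,1)] by auto
  have g_ind: "g1 \<noteq> g2" "cvec.independent {g1, g2}" using g unfolding wedge_nonzero_iff by simp_all
  let ?s = "(0, g1) :: 'a \<times> 'b" and ?t = "(0, g2) :: 'a \<times> 'b"
  \<comment> \<open>Contraction with a functional dual to one of \<open>g1\<close>,
    \<open>g2\<close> recovers the other, up to the sign built into the prescribed values.\<close>
  have contr: "\<exists>\<phi> :: 'a \<times> 'b \<Rightarrow> complex. clinear \<phi> \<and> (\<forall>\<psi>. clinear \<psi> \<longrightarrow> wedge ?s ?t (\<phi>, \<psi>) = \<psi> (0, h))"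
    if h: "h \<in> {g1, g2}" for h
  proof -
    obtain a :: "'b \<Rightarrow> complex" where a: "clinear a"
      "\<forall>x\<in>{g1, g2}. a x = (if x = g1 then (if h = g1 then 0 else 1) else (if h = g1 then -1 else 0))"
      using cvec_pair.linear_independent_extend[OF g_ind(2), of "\<lambda>x. if x = g1 then (if h = g1 then 0 else 1)
        else (if h = g1 then -1 else 0) :: complex"] by (elim exE conjE)
    show ?thesis
    proof (intro exI[of _ "\<lambda>x. a (snd x)"] conjI allI impI clinear_snd a(1))
      fix \<psi> :: "'a \<times> 'b \<Rightarrow> complex" assume "clinear \<psi>"
      from wedge_apply[OF clinear_snd[OF a(1)] this, of ?s ?t]
      show "wedge ?s ?t (\<lambda>x. a (snd x), \<psi>) = \<psi> (0, h)"
        using a(2) h g_ind(1) by auto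
    qed
  qed
  have "\<forall>j. \<exists>\<phi> :: 'a \<times> 'b \<Rightarrow> complex. j < N \<longrightarrow> clinear \<phi> \<and>
      (\<forall>\<psi>. clinear \<psi> \<longrightarrow> wedge ?s ?t (\<phi>, \<psi>) = \<psi> (0, gg j))"
  proof
    fix j
    show "\<exists>\<phi> :: 'a \<times> 'b \<Rightarrow> complex. j < N \<longrightarrow> clinear \<phi> \<and>
      (\<forall>\<psi>. clinear \<psi> \<longrightarrow> wedge ?s ?t (\<phi>, \<psi>) = \<psi> (0, gg j))"
      using contr[OF mg(2)[of j]] by (cases "j < N") simp_all
  qed
  from choice[OF this] obtain \<phi> :: "nat \<Rightarrow> 'a \<times> 'b \<Rightarrow> complex" where
    \<phi>: "\<forall>j. j < N \<longrightarrow> clinear (\<phi> j) \<and> (\<forall>\<psi>. clinear \<psi> \<longrightarrow> wedge ?s ?t (\<phi> j, \<psi>) = \<psi> (0, gg j))" ..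
  define \<psi> where "\<psi> i j = (\<lambda>x :: 'a \<times> 'b. l i (m j (snd x)))" for i j
  have \<psi>: "clinear (\<psi> i j)" if "j < N" for i j
    unfolding \<psi>_def
    by (rule clinear_snd[OF clinear_comp[OF conjunct1[OF spec[OF l, of i]] M[OF mg(1)[OF that]]]])
  \<comment> \<open>Column \<open>j\<close> holds the coordinates of the multiplier
    \<open>m j\<close> applied to the second component of the \<open>j\<close>-th contraction. The
    entries are evaluations of the bivector and hence linear in it.\<close>
  define F where "F \<omega> = det (mat N N (\<lambda>(i, j). \<omega> (\<phi> j, \<psi> i j)))" for \<omega> :: "('a \<times> 'b) bivector"
  have F: "hom_poly N F" unfolding F_def by (rule hom_poly_det) (rule clinear_eval)
  have "F (wedge ?s ?t) = det (1\<^sub>m N :: complex mat)"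
    unfolding F_def
  proof (rule arg_cong[where f = det], rule eq_matI)
    fix i j assume ij: "i < dim_row (1\<^sub>m N :: complex mat)" "j < dim_col (1\<^sub>m N :: complex mat)"
    then have "wedge ?s ?t (\<phi> j, \<psi> i j) = \<psi> i j (0, gg j)" using \<phi> \<psi> by simp
    also have "\<dots> = l i (b j)" using ij mg(3)[of j] by (simp add: \<psi>_def)
    also have "\<dots> = (if i = j then 1 else 0)" using ij by (intro l_B) simp_all
    finally show "mat N N (\<lambda>(i, j). wedge ?s ?t (\<phi> j, \<psi> i j)) $$ (i, j) = 1\<^sub>m N $$ (i, j)" using ij by simp
  qed simp_all
  then have F0: "F (wedge ?s ?t) \<noteq> 0" by simp
  have vanish: "F (wedge s t) = 0"
    if \<kappa>: "clinear \<kappa>" "x \<in> W" "\<kappa> x \<noteq> (0::complex)"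
      and st: "\<forall>m\<in>M. m (snd s) \<in> W \<and> m (snd t) \<in> W \<and> \<kappa> (m (snd s)) = 0 \<and> \<kappa> (m (snd t)) = 0"
    for s t :: "'a \<times> 'b" and \<kappa> x
  proof -
    have expand: "\<kappa> y = (\<Sum>i<N. \<kappa> (b i) * l i y)" if y: "y \<in> W" for y
    proof -
      have lin: "clinear (\<lambda>y. \<Sum>i<N. \<kappa> (b i) * l i y)"
        unfolding clinear_iff clinear_add[OF l_lin] clinear_scale[OF l_lin]
        by (simp add: sum.distrib sum_distrib_left algebra_simps)
      have onB: "\<kappa> x = (\<Sum>i<N. \<kappa> (b i) * l i x)" if "x \<in> B" for x
      proof -
        obtain k where k: "k < N" "x = b k" using b \<open>x \<in> B\<close> by (auto simp: bij_betw_def)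
        have "(\<Sum>i<N. \<kappa> (b i) * l i x) = (\<Sum>i<N. if i = k then \<kappa> (b k) else 0)"
          using k by (intro sum.cong) (auto simp: l_B)
        also have "\<dots> = \<kappa> x" using k by simp
        finally show ?thesis ..
      qed
      show ?thesis by (rule cvec_pair.linear_eq_on[OF \<kappa>(1) lin subsetD[OF WB y] onB])
    qed
    have "\<exists>i<N. \<kappa> (b i) \<noteq> 0"
    proof (rule ccontr)
      assume "\<not> (\<exists>i<N. \<kappa> (b i) \<noteq> 0)"
      then have "\<kappa> x = 0" unfolding expand[OF \<kappa>(2)] by (intro sum.neutral) simp
      then show False using \<kappa>(3) by contradiction
    qed
    then obtain i where i: "i < N" "\<kappa> (b i) \<noteq> 0" by (elim exE conjE)
    \<comment> \<open>All the products lie in the kernel of \<open>\<kappa>\<close>, so its values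
      on the basis are the coefficients of a nontrivial relation between the rows.\<close>
    show ?thesis unfolding F_def
    proof (rule det_eq_0_if_row_relation[where c = "\<lambda>i. \<kappa> (b i)", OF _ i])
      fix j assume j: "j < N"
      have stj: "m j (snd s) \<in> W" "m j (snd t) \<in> W" "\<kappa> (m j (snd s)) = 0" "\<kappa> (m j (snd t)) = 0"
        using bspec[OF st mg(1)[OF j]] by simp_all
      have \<phi>j: "clinear (\<phi> j)" using \<phi> j by simp
      have "(\<Sum>i<N. \<kappa> (b i) * wedge s t (\<phi> j, \<psi> i j)) =
          (\<Sum>i<N. \<phi> j s * (\<kappa> (b i) * l i (m j (snd t))) - \<phi> j t * (\<kappa> (b i) * l i (m j (snd s))))"
        unfolding wedge_apply[OF \<phi>j \<psi>[OF j]] unfolding \<psi>_def by (simp add: algebra_simps)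
      also have "\<dots> = \<phi> j s * (\<Sum>i<N. \<kappa> (b i) * l i (m j (snd t))) - \<phi> j t * (\<Sum>i<N. \<kappa> (b i) * l i (m j (snd s)))"
        by (simp only: sum_subtractf sum_distrib_left)
      also have "\<dots> = \<phi> j s * \<kappa> (m j (snd t)) - \<phi> j t * \<kappa> (m j (snd s))"
        using expand[OF stj(1)] expand[OF stj(2)] by argo
      also have "\<dots> = 0" using stj by simp
      finally show "(\<Sum>i<N. \<kappa> (b i) * wedge s t (\<phi> j, \<psi> i j)) = 0" .
    qed
  qed
  show ?thesis
    by (rule exI[of _ N], rule exI[of _ F], intro conjI F F0 allI impI, elim conjE) (rule vanish)
qed

lemma functional_vanishing:
  fixes U :: "'v::complex_vector set"
  assumes U: "cvec.subspace U" and x: "x \<notin> U"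
  obtains \<kappa> :: "'v \<Rightarrow> complex" where "clinear \<kappa>" "\<kappa> x = 1" "\<forall>u\<in>U. \<kappa> u = 0"
proof -
  obtain B where B: "B \<subseteq> U" "cvec.independent B" "U \<subseteq> cvec.span B"
    using cvec.maximal_independent_subset[of U] .
  have "cvec.span B \<subseteq> U" by (rule cvec.span_minimal[OF B(1) U])
  then have xB: "x \<notin> cvec.span B" using x by blast
  then have "x \<notin> B" using cvec.span_base by blast
  have "cvec.independent (insert x B)" by (rule cvec.independent_insertI[OF xB B(2)])
  from cvec_pair.linear_independent_extend[OF this, of "\<lambda>y. if y = x then 1 else 0 :: complex"]
  obtain \<kappa> :: "'v \<Rightarrow> complex" where \<kappa>: "clinear \<kappa>" "\<forall>y\<in>insert x B. \<kappa> y = (if y = x then 1 else 0)"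
    by (elim exE conjE)
  have "\<kappa> u = 0" if "u \<in> U" for u
  proof (rule cvec_pair.linear_eq_on[OF \<kappa>(1) clinear_zero])
    show "u \<in> cvec.span B" using that B(3) by blast
    show "\<kappa> b = 0" if "b \<in> B" for b using \<kappa>(2) that \<open>x \<notin> B\<close> by auto
  qed
  then show ?thesis using that[OF \<kappa>(1)] \<kappa>(2) by simp
qed

context elliptic
begin

section \<open>Sections with poles at one point\<close>

abbreviation mpt :: "'n pt \<Rightarrow> int \<Rightarrow> 'n pt \<Rightarrow>\<^sub>0 int" where
  "mpt q n \<equiv> Poly_Mapping.single q n"

lemma mpt_Suc: "mpt q n + pnt q = mpt q (n + 1)"
  by (simp flip: single_add)

lemma LD_point_const:
  assumes "q \<in> C" "f \<in> LD (pnt q)"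
  shows "\<exists>c. f \<doteq> (\<lambda>_. c)"
proof -
  have "f \<in> LD 0"
    using ell_multiple_ge[OF assms, of 1] ell_point_le[OF assms(1)] by auto
  then show ?thesis by (rule LD_0_const)
qed

text \<open>The constant 1 as a section of \<open>\<O>(n Q)\<close> with \<open>n \<ge> 1\<close>:
  the normalisation forces the value 0 at \<open>Q\<close> and outside the curve.\<close>

definition one_off :: "'n pt \<Rightarrow> 'n cfun" where
  "one_off Q q = (if q \<in> C \<and> q \<noteq> Q then 1 else 0)"

lemma one_off_aeq: "one_off Q \<doteq> (\<lambda>_. 1)"
  unfolding eventually_ae by (rule finite_subset[of _ "{Q}"]) (auto simp: one_off_def)

lemma one_off_section:
  assumes "1 \<le> n"
  shows "one_off Q \<in> sections C (mpt Q n)"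
  unfolding sections_iff
proof (intro conjI allI impI ballI)
  have "(\<lambda>_. 1) \<in> LD (mpt Q n)" by (rule LD_const) (use assms in \<open>simp add: lookup_pnt\<close>)
  then show "one_off Q \<in> LD (mpt Q n)" by (rule LD_cong[OF aeq_sym[OF one_off_aeq]])
  show "one_off Q p = 0" if "p \<notin> C \<or> 0 < dmult (mpt Q n) p" for p
    using that by (auto simp: one_off_def lookup_pnt split: if_splits)
  show "reg p (one_off Q)" if "p \<in> C" "dmult (mpt Q n) p \<le> 0" for p
    by (rule reg_cong[OF reg_const[OF that(1), of 1] aeq_sym[OF one_off_aeq]])
      (use that assms in \<open>auto simp: one_off_def lookup_pnt\<close>)
qed

lemma one_off_mult:
  assumes "f \<in> sections C (mpt Q n)" "1 \<le> n"
  shows "f * one_off Q = f"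
  using sections_outside[OF assms(1)] assms(2) by (auto simp: fun_eq_iff one_off_def lookup_pnt)

lemma sections_mult:
  assumes f: "f \<in> sections C (mpt Q m)" "1 \<le> m" and g: "g \<in> sections C (mpt Q n)" "1 \<le> n"
  shows "f * g \<in> sections C (mpt Q (m + n))"
  unfolding sections_iff
proof (intro conjI allI impI ballI)
  show "f * g \<in> LD (mpt Q (m + n))"
    using LD_mult[OF sections_LD[OF f(1)] sections_LD[OF g(1)]] by (simp add: single_add times_fun_def)
  show "(f * g) p = 0" if p: "p \<notin> C \<or> 0 < dmult (mpt Q (m + n)) p" for p
    using sections_outside[OF f(1), of p] p f(2) by (auto simp: lookup_pnt split: if_splits)
  show "reg p (f * g)" if p: "p \<in> C" "dmult (mpt Q (m + n)) p \<le> 0" for p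
    unfolding times_fun_def
    by (rule reg_mult[OF sections_reg[OF f(1) p(1)] sections_reg[OF g(1) p(1)]])
      (use p f(2) g(2) in \<open>auto simp: lookup_pnt split: if_splits\<close>)
qed

text \<open>For all positive multiplicities at \<open>Q\<close> the normalisation is the same, so
  inclusions between these spaces are literal.\<close>

lemma sections_change:
  assumes f: "f \<in> sections C (mpt Q m)" "1 \<le> m" and n: "1 \<le> n" "f \<in> LD (mpt Q n)"
  shows "f \<in> sections C (mpt Q n)"
  unfolding sections_iff
proof (intro conjI allI impI ballI n(2))
  show "f p = 0" if p: "p \<notin> C \<or> 0 < dmult (mpt Q n) p" for p
    using sections_outside[OF f(1), of p] p f(2) by (auto simp: lookup_pnt split: if_splits)
  show "reg p f" if p: "p \<in> C" "dmult (mpt Q n) p \<le> 0" for p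
    by (rule sections_reg[OF f(1) p(1)]) (use p f(2) n(1) in \<open>auto simp: lookup_pnt split: if_splits\<close>)
qed

lemma sections_raise:
  assumes f: "f \<in> sections C (mpt Q m)" "1 \<le> m" "m \<le> n"
  shows "f \<in> sections C (mpt Q n)"
  by (rule sections_change[OF f(1,2)]) (use f LD_mono[OF sections_LD[OF f(1)]] in \<open>auto simp: lookup_pnt\<close>)

text \<open>Every positive pole order except 1 occurs at \<open>Q\<close>, since the dimension jumps
  from degree \<open>n - 1\<close> to degree \<open>n\<close> once \<open>n - 1\<close> is
  positive.\<close>

lemma pole_section:
  assumes Q: "Q \<in> C" and n: "2 \<le> n"
  obtains s where "s \<in> sections C (mpt Q n)" "s \<notin> LD (mpt Q (n - 1))" "nz s" "ord_at C Q s = - n"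
proof -
  obtain s where s: "s \<in> sections C (mpt Q (n - 1) + pnt Q)" "s \<notin> LD (mpt Q (n - 1))"
    using exact_pole[OF divisors_single[OF Q] _ Q, of "n - 1"] n by auto
  note * = not_in_LD_ord[OF sections_LD[OF s(1)] s(2) Q]
  have "s \<in> sections C (mpt Q n)" using s(1) unfolding mpt_Suc by simp
  from that[OF this s(2) *(1)] *(2) show ?thesis by (simp add: lookup_pnt)
qed

text \<open>The products attain the pole order 0 and all orders from 2 to \<open>2 b + 1\<close>: up
  to \<open>b + 1\<close> by a multiplier times 1, beyond that by a multiplier of order at least 2
  times \<open>g\<close>. With multipliers of order at most \<open>b\<close> these two ranges would
  leave a gap at \<open>b + 1\<close>. An arbitrary section is reduced one pole order at a
  time.\<close>

lemma sections_in_span: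
  assumes Q: "Q \<in> C" and b: "2 \<le> b" and g: "g \<in> sections C (mpt Q b)" "nz g" "ord_at C Q g = - b"
  shows "sections C (mpt Q (b + (b + 1))) \<subseteq>
    cvec.span {\<alpha> * f | \<alpha> f. \<alpha> \<in> sections C (mpt Q (b + 1)) \<and> f \<in> {one_off Q, g}}" (is "_ \<subseteq> cvec.span ?X")
proof -
  have *: "sections C (mpt Q (int n + 1)) \<subseteq> cvec.span ?X" if "int n \<le> 2 * b" for n
    using that
  proof (induction n)
    case 0
    show ?case
    proof
      fix f assume "f \<in> sections C (mpt Q (int 0 + 1))"
      then have f: "f \<in> sections C (pnt Q)" by simp
      obtain c where c: "f \<doteq> (\<lambda>_. c)" using LD_point_const[OF Q sections_LD[OF f]] ..
      have one: "one_off Q \<in> sections C (pnt Q)" by (rule one_off_section) simp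
      have "f = c *\<^sub>C one_off Q"
        by (rule sections_ext[OF f sections_scale[OF one]]) (use c one_off_aeq[of Q] in eventually_elim, simp)
      moreover have "one_off Q * one_off Q \<in> ?X" using one_off_section[of "b + 1" Q] b by auto
      then have "one_off Q \<in> ?X" unfolding one_off_mult[OF one order.refl] .
      then have "one_off Q \<in> cvec.span ?X" by (rule cvec.span_base)
      ultimately show "f \<in> cvec.span ?X" by (simp add: cvec.span_scale)
    qed
  next
    case (Suc n)
    define m where "m = int n + 1"
    have m: "1 \<le> m" "m \<le> 2 * b" using Suc.prems by (auto simp: m_def)
    have IH: "sections C (mpt Q m) \<subseteq> cvec.span ?X"
      unfolding m_def by (rule Suc.IH) (use Suc.prems in simp)
    have "\<exists>s. s \<in> ?X \<and> s \<in> sections C (mpt Q (m + 1)) \<and> nz s \<and> ord_at C Q s = - (m + 1)"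
    proof (cases "m \<le> b")
      case True
      obtain s where s: "s \<in> sections C (mpt Q (m + 1))" "s \<notin> LD (mpt Q (m + 1 - 1))" "nz s" "ord_at C Q s = - (m + 1)"
        using pole_section[OF Q, of "m + 1"] m(1) by auto
      have "s \<in> sections C (mpt Q (b + 1))" by (rule sections_raise[OF s(1)]) (use True m in auto)
      moreover have "s = s * one_off Q" using one_off_mult[OF s(1)] m by simp
      ultimately have "s \<in> ?X" by blast
      then show ?thesis using s by blast
    next
      case False
      obtain s where s: "s \<in> sections C (mpt Q (m + 1 - b))" "s \<notin> LD (mpt Q (m + 1 - b - 1))" "nz s"
        "ord_at C Q s = - (m + 1 - b)"
        using pole_section[OF Q, of "m + 1 - b"] False by auto
      have "s \<in> sections C (mpt Q (b + 1))" by (rule sections_raise[OF s(1)]) (use False m in auto)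
      then have "s * g \<in> ?X" by blast
      moreover have "s * g \<in> sections C (mpt Q (m + 1))"
        using sections_mult[OF s(1) _ g(1)] False b by simp
      moreover have "nz (s * g)" using nz_mult[OF s(3) g(2)] by (simp add: times_fun_def)
      moreover have "ord_at C Q (s * g) = - (m + 1)"
        using ord_at_mult[OF Q LD_rational[OF sections_LD[OF s(1)]] s(3) LD_rational[OF sections_LD[OF g(1)]] g(2)]
        by (simp add: times_fun_def s(4) g(3))
      ultimately show ?thesis by blast
    qed
    then obtain s where s: "s \<in> ?X" "s \<in> sections C (mpt Q (m + 1))" "nz s" "ord_at C Q s = - (m + 1)"
      by (elim exE conjE)
    have "sections C (mpt Q (m + 1)) \<subseteq> cvec.span ?X"
    proof
      fix f assume f: "f \<in> sections C (mpt Q (m + 1))"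
      have fs: "f \<in> LD (mpt Q m + pnt Q)" "s \<in> LD (mpt Q m + pnt Q)"
        using sections_LD[OF f] sections_LD[OF s(2)] by (simp_all only: mpt_Suc)
      obtain c where c: "(\<lambda>p. f p - c * s p) \<in> LD (mpt Q m)"
        using eliminate_pole[OF Q fs(2) s(3) _ fs(1)] s(4) by (auto simp: lookup_pnt)
      have eq: "f - c *\<^sub>C s = (\<lambda>p. f p - c * s p)" by (simp add: fun_eq_iff)
      have "f - c *\<^sub>C s \<in> sections C (mpt Q (m + 1))"
        using subspace_sections f s(2) by (intro cvec.subspace_diff cvec.subspace_scale)
      then have "f - c *\<^sub>C s \<in> sections C (mpt Q m)"
        by (rule sections_change) (use m c eq in simp_all)
      then have "(f - c *\<^sub>C s) + c *\<^sub>C s \<in> cvec.span ?X"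
        using IH s(1) by (intro cvec.span_add cvec.span_scale cvec.span_base[OF s(1)]) blast
      then show "f \<in> cvec.span ?X" by simp
    qed
    then have "sections C (mpt Q (int (Suc n) + 1)) \<subseteq> cvec.span ?X" by (simp add: m_def add.commute)
    then show ?case .
  qed
  have "int (nat (2 * b)) + 1 = b + (b + 1)" using b by simp
  then show ?thesis using *[of "nat (2 * b)"] b by simp
qed

text \<open>If the second components of \<open>s\<close> and \<open>t\<close> both vanish at \<open>q\<close>, so do all their products with sections,
  which then do not span.\<close>

lemma basepoint_form:
  assumes Q: "Q \<in> C" and b: "2 \<le> b"
  shows "\<exists>d (F :: ('n cfun \<times> 'n cfun) bivector \<Rightarrow> complex) g.
    hom_poly d F \<and> g \<in> sections C (mpt Q b) \<and> wedge (one_off Q) g \<noteq> 0 \<and>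
    F (wedge (0, one_off Q) (0, g)) \<noteq> 0 \<and>
    (\<forall>s t q. snd s \<in> sections C (mpt Q b) \<and> snd t \<in> sections C (mpt Q b) \<and> q \<in> C \<and>
      snd s \<in> LD (mpt Q b - pnt q) \<and> snd t \<in> LD (mpt Q b - pnt q) \<longrightarrow> F (wedge s t) = 0)"
proof -
  \<comment> \<open>A pole of exact order \<open>b\<close> at \<open>Q\<close> leaves 1 and
    \<open>g\<close> without common zeros as sections of \<open>\<O>(b Q)\<close>: 1 generates away
    from \<open>Q\<close>, and \<open>g\<close> at \<open>Q\<close>.\<close>
  obtain g where g: "g \<in> sections C (mpt Q b)" "g \<notin> LD (mpt Q (b - 1))" "nz g" "ord_at C Q g = - b"
    using pole_section[OF Q b] .
  define M :: "('n cfun \<Rightarrow> 'n cfun) set" where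
    "M = (\<lambda>\<alpha> f. \<alpha> * f) ` sections C (mpt Q (b + 1))"
  define W where "W = sections C (mpt Q (b + (b + 1)))"
  have M: "clinear m" if "m \<in> M" for m
    using that by (auto simp: M_def clinear_iff fun_eq_iff algebra_simps)
  have MW: "m f \<in> W" if m: "m \<in> M" and f: "f \<in> sections C (mpt Q b)" for m f
  proof -
    obtain \<alpha> where \<alpha>: "\<alpha> \<in> sections C (mpt Q (b + 1))" "m = (\<lambda>f. \<alpha> * f)"
      using m unfolding M_def by (elim imageE)
    have "\<alpha> * f \<in> sections C (mpt Q (b + 1 + b))" by (rule sections_mult[OF \<alpha>(1) _ f]) (use b in auto)
    then show ?thesis by (simp add: W_def \<alpha>(2) add.commute)
  qed
  have one: "one_off Q \<in> sections C (mpt Q b)" by (rule one_off_section) (use b in simp)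
  have WM: "W \<subseteq> cvec.span {m f | m f. m \<in> M \<and> f \<in> {one_off Q, g}}"
  proof -
    have "{\<alpha> * f | \<alpha> f. \<alpha> \<in> sections C (mpt Q (b + 1)) \<and> f \<in> {one_off Q, g}} \<subseteq>
      {m f | m f. m \<in> M \<and> f \<in> {one_off Q, g}}" unfolding M_def by blast
    from subset_trans[OF sections_in_span[OF Q b g(1,3,4)] cvec.span_mono[OF this]] show ?thesis
      unfolding W_def .
  qed
  have g_new: "g \<notin> cvec.span {one_off Q}"
  proof
    assume "g \<in> cvec.span {one_off Q}"
    moreover have "cvec.span {one_off Q} \<subseteq> sections C (mpt Q (b - 1))"
      by (rule cvec.span_minimal[OF _ subspace_sections]) (use b one_off_section[of "b - 1" Q] in simp)
    ultimately show False using g(2) sections_LD by blast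
  qed
  have "one_off Q \<noteq> 0"
  proof
    assume "one_off Q = 0"
    then have "(\<lambda>_. 1) \<doteq> (\<lambda>_. 0)" using one_off_aeq[of Q] by simp
    then show False using nz_not_zero[OF nz_const[of 1]] by simp
  qed
  then have "cvec.independent {one_off Q}" by simp
  then have "cvec.independent {g, one_off Q}" by (rule cvec.independent_insertI[OF g_new])
  moreover have "g \<noteq> one_off Q" using g_new cvec.span_base[of g "{one_off Q}"] by auto
  ultimately have "cvec.independent {g, one_off Q}" "g \<noteq> one_off Q" by blast+
  then have nz: "wedge (one_off Q) g \<noteq> 0" unfolding wedge_nonzero_iff by (simp add: insert_commute)
  have Wdiv: "mpt Q (b + (b + 1)) \<in> divisors C" by (rule divisors_single[OF Q])
  have findimW: "findim W" unfolding W_def by (rule findim_sections[OF Wdiv])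
  have "\<exists>d (F :: ('n cfun \<times> 'n cfun) bivector \<Rightarrow> complex).
    hom_poly d F \<and> F (wedge (0, one_off Q) (0, g)) \<noteq> 0 \<and>
    (\<forall>s t \<kappa> x. clinear \<kappa> \<and> x \<in> W \<and> \<kappa> x \<noteq> (0::complex) \<and>
      (\<forall>m\<in>M. m (snd s) \<in> W \<and> m (snd t) \<in> W \<and> \<kappa> (m (snd s)) = 0 \<and> \<kappa> (m (snd t)) = 0) \<longrightarrow>
      F (wedge s t) = 0)"
    by (rule spanning_form) (fact M findimW WM nz | rule MW[OF _ one] MW[OF _ g(1)], assumption)+
  then obtain d and F :: "('n cfun \<times> 'n cfun) bivector \<Rightarrow> complex"
    where F: "hom_poly d F" "F (wedge (0, one_off Q) (0, g)) \<noteq> 0" and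
    F0: "\<forall>s t \<kappa> x. clinear \<kappa> \<and> x \<in> W \<and> \<kappa> x \<noteq> (0::complex) \<and>
      (\<forall>m\<in>M. m (snd s) \<in> W \<and> m (snd t) \<in> W \<and> \<kappa> (m (snd s)) = 0 \<and> \<kappa> (m (snd t)) = 0) \<longrightarrow>
      F (wedge s t) = 0"
    by (elim exE conjE)
  have vanish: "F (wedge s t) = 0" if st: "snd s \<in> sections C (mpt Q b)" "snd t \<in> sections C (mpt Q b)" and q: "q \<in> C"
      and st': "snd s \<in> LD (mpt Q b - pnt q)" "snd t \<in> LD (mpt Q b - pnt q)" for s t q
  proof -
    let ?D = "mpt Q (b + (b + 1)) - pnt q"
    have D: "?D \<in> divisors C" by (intro divisors_diff Wdiv divisors_single q)
    \<comment> \<open>Some section in \<open>W\<close> does not vanish at \<open>q\<close>, whereas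
      all the products do; \<open>\<kappa>\<close> will separate the two.\<close>
    obtain x where x: "x \<in> W" "x \<notin> LD ?D"
      using exact_pole[OF D _ q] b unfolding W_def by (auto simp: deg_diff)
    define U where "U = {f \<in> W. f \<in> LD ?D}"
    have "cvec.subspace U"
      unfolding cvec.subspace_def
    proof (intro conjI ballI allI)
      show "0 \<in> U" using sections_zero LD_zero by (simp add: U_def W_def zero_fun_def)
      show "f + h \<in> U" if "f \<in> U" "h \<in> U" for f h
        using that sections_add LD_add by (simp add: U_def W_def plus_fun_def)
      show "c *\<^sub>C f \<in> U" if "f \<in> U" for c f
        using that sections_scale[of f] LD_cmult[of f] by (simp add: U_def W_def scaleC_fun_def)
    qed
    moreover have "x \<notin> U" using x by (simp add: U_def)
    ultimately obtain \<kappa> :: "'n cfun \<Rightarrow> complex" where \<kappa>: "clinear \<kappa>" "\<kappa> x = 1" "\<forall>u\<in>U. \<kappa> u = 0"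
      by (rule functional_vanishing)
    have in_U: "m f \<in> U" if m: "m \<in> M" and f: "f \<in> sections C (mpt Q b)" "f \<in> LD (mpt Q b - pnt q)" for m f
    proof -
      obtain \<alpha> where \<alpha>: "\<alpha> \<in> sections C (mpt Q (b + 1))" "m = (\<lambda>f. \<alpha> * f)"
        using m unfolding M_def by (elim imageE)
      have eqD: "mpt Q (b + 1) + (mpt Q b - pnt q) = ?D"
        by (simp add: algebra_simps flip: single_add)
      have "m f \<in> LD ?D"
        using LD_mult[OF sections_LD[OF \<alpha>(1)] f(2)] unfolding eqD \<alpha>(2) times_fun_def .
      then show ?thesis using MW[OF m f(1)] by (simp add: U_def)
    qed
    have all: "\<forall>m\<in>M. m (snd s) \<in> W \<and> m (snd t) \<in> W \<and> \<kappa> (m (snd s)) = 0 \<and> \<kappa> (m (snd t)) = 0"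
      using in_U[OF _ st(1) st'(1)] in_U[OF _ st(2) st'(2)] \<kappa>(3) MW[OF _ st(1)] MW[OF _ st(2)] by simp
    have "\<kappa> x \<noteq> 0" using \<kappa>(2) by simp
    show ?thesis by (rule F0[rule_format, OF conjI[OF \<kappa>(1) conjI[OF x(1) conjI[OF \<open>\<kappa> x \<noteq> 0\<close> all]]]])
  qed
  show ?thesis
    by (rule exI[of _ d], rule exI[of _ F], rule exI[of _ g], intro conjI F g(1) nz allI impI, elim conjE)
      (rule vanish)
qed

section \<open>Rank-one pencils on an elliptic curve\<close>

text \<open>The rank-one condition is an identity at every point. Where both bundles allow no pole
  it follows from regularity; elsewhere the normalisation makes a factor vanish on each
  side.\<close>

lemma pencil_pointwise:
  assumes s1: "s1 \<in> sections C (mpt P a)" and t1: "t1 \<in> sections C (mpt P a)" and a: "1 \<le> a"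
    and s2: "s2 \<in> sections C (mpt Q b)" and t2: "t2 \<in> sections C (mpt Q b)" and b: "1 \<le> b"
    and eq: "(\<lambda>q. s1 q * t2 q) \<doteq> (\<lambda>q. t1 q * s2 q)"
  shows "s1 * t2 = t1 * s2"
proof
  fix q
  show "(s1 * t2) q = (t1 * s2) q"
  proof (cases "q \<notin> C \<or> q = P \<or> q = Q")
    case True
    then have "s1 q = 0 \<and> t1 q = 0 \<or> s2 q = 0 \<and> t2 q = 0"
      using sections_outside[OF s1, of q] sections_outside[OF t1, of q] sections_outside[OF s2, of q]
        sections_outside[OF t2, of q] a b by (auto simp: lookup_pnt)
    then show ?thesis by auto
  next
    case False
    then have q: "q \<in> C" "dmult (mpt P a) q \<le> 0" "dmult (mpt Q b) q \<le> 0"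
      by (auto simp: lookup_pnt)
    have "s1 q * t2 q = t1 q * s2 q"
      by (rule reg_unique[OF reg_mult[OF sections_reg[OF s1 q(1,2)] sections_reg[OF t2 q(1,3)]]
            reg_mult[OF sections_reg[OF t1 q(1,2)] sections_reg[OF s2 q(1,3)]] eq])
    then show ?thesis by simp
  qed
qed

text \<open>At each point one of \<open>s2\<close>, \<open>t2\<close> attains the pole order allowed by \<open>E\<close>, which bounds the poles of
  the ratio of the two components.\<close>

lemma ratio_in_LD:
  assumes s1: "s1 \<in> LD D" and t1: "t1 \<in> LD D" and s2: "s2 \<in> LD E" and t2: "t2 \<in> LD E"
    and eq: "(\<lambda>q. s1 q * t2 q) \<doteq> (\<lambda>q. t1 q * s2 q)"
    and bpf: "\<forall>q\<in>C. s2 \<notin> LD (E - pnt q) \<or> t2 \<notin> LD (E - pnt q)"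
  shows "\<exists>\<psi>. \<psi> \<in> LD (D - E) \<and> s1 \<doteq> (\<lambda>q. \<psi> q * s2 q) \<and> t1 \<doteq> (\<lambda>q. \<psi> q * t2 q)"
proof -
  have "\<exists>\<psi>. rational \<psi> \<and> s1 \<doteq> (\<lambda>q. \<psi> q * s2 q) \<and> t1 \<doteq> (\<lambda>q. \<psi> q * t2 q)"
  proof (cases "nz s2")
    case True
    let ?f = "\<lambda>q. s1 q * inverse (s2 q)"
    have "rational ?f" by (rule rational_mult[OF LD_rational[OF s1] rational_inverse[OF LD_rational[OF s2]]])
    moreover have "s1 \<doteq> (\<lambda>q. ?f q * s2 q)" using True unfolding nz_def by eventually_elim simp
    moreover have "t1 \<doteq> (\<lambda>q. ?f q * t2 q)"
      using True eq unfolding nz_def by eventually_elim (simp add: field_simps)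
    ultimately show ?thesis by blast
  next
    case False
    \<comment> \<open>If \<open>s2\<close> is generically zero it vanishes at every point, so
      freeness from common zeros at any one point makes \<open>t2\<close> nonzero and usable as
      denominator.\<close>
    obtain q where q: "q \<in> C" using C_nonempty ..
    have s20: "s2 \<doteq> (\<lambda>_. 0)" using False LD_dichotomy[OF s2] by blast
    have "s2 \<in> LD (E - pnt q)" by (rule LD_cong[OF aeq_sym[OF s20] LD_zero])
    then have "t2 \<notin> LD (E - pnt q)" using bpf q by blast
    have "nz t2"
    proof (rule ccontr)
      assume "\<not> nz t2"
      then have "t2 \<doteq> (\<lambda>_. 0)" using LD_dichotomy[OF t2] by blast
      from LD_cong[OF aeq_sym[OF this] LD_zero] \<open>t2 \<notin> LD (E - pnt q)\<close> show False by blast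
    qed
    let ?f = "\<lambda>q. t1 q * inverse (t2 q)"
    have "rational ?f" by (rule rational_mult[OF LD_rational[OF t1] rational_inverse[OF LD_rational[OF t2]]])
    moreover have "t1 \<doteq> (\<lambda>q. ?f q * t2 q)" using \<open>nz t2\<close> unfolding nz_def by eventually_elim simp
    moreover have "s1 \<doteq> (\<lambda>q. ?f q * s2 q)"
      using \<open>nz t2\<close> eq unfolding nz_def by eventually_elim (simp add: field_simps)
    ultimately show ?thesis by blast
  qed
  then obtain \<psi> where \<psi>: "rational \<psi>" "s1 \<doteq> (\<lambda>q. \<psi> q * s2 q)" "t1 \<doteq> (\<lambda>q. \<psi> q * t2 q)" by (elim exE conjE)
  have "\<psi> \<in> LD (D - E)"
  proof (rule LD_I)
    fix q assume q: "q \<in> C"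
    have "\<exists>x y. x \<in> LD E \<and> x \<notin> LD (E - pnt q) \<and> y \<in> LD D \<and> y \<doteq> (\<lambda>q. \<psi> q * x q)"
      using bspec[OF bpf q] s1 s2 t1 t2 \<psi>(2,3) by (elim disjE) (intro exI conjI; assumption)+
    then obtain x y where x: "x \<in> LD E" "x \<notin> LD (E - pnt q)" and y: "y \<in> LD D" "y \<doteq> (\<lambda>q. \<psi> q * x q)"
      by (elim exE conjE)
    have "x \<in> LD (E - pnt q + pnt q)" using x(1) by simp
    note x_ord = not_in_LD_ord[OF this x(2) q]
    have "vge q (dmult E q) (\<lambda>p. inverse (x p))"
      by (rule vge_ord[OF rational_inverse[OF LD_rational[OF x(1)]]])
        (simp add: ord_at_inverse[OF q LD_rational[OF x(1)] x_ord(1)] x_ord(2) lookup_minus lookup_pnt)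
    from vge_mult[OF q LD_D[OF y(1) q] this]
    have "vge q (- dmult (D - E) q) (\<lambda>p. y p * inverse (x p))" by (simp add: lookup_minus)
    moreover have "\<forall>\<^sub>F p in \<eta>. y p * inverse (x p) = \<psi> p"
      using y(2) x_ord(1) unfolding nz_def by eventually_elim simp
    ultimately show "vge q (- dmult (D - E) q) \<psi>" by (rule vge_cong[OF q, rotated])
  qed
  then show ?thesis using \<psi> by blast
qed

text \<open>The common part of the two reducible cases. \<open>F\<close> comes from
  \<open>basepoint_form\<close>; only \<open>H\<close>, and a pencil on which it is nonzero, depend
  on the case.\<close>

lemma reducible_pencils:
  assumes Q: "Q \<in> C" and b: "2 \<le> b"
    and H: "hom_poly e H" and L: "L \<in> rank_one_pencils C (mpt P a) (mpt Q b)" "H (rep L) \<noteq> 0"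
    and H0: "\<And>s t. s \<in> sections2 C (mpt P a) (mpt Q b) \<Longrightarrow> t \<in> sections2 C (mpt P a) (mpt Q b) \<Longrightarrow>
      fst s * snd t = fst t * snd s \<Longrightarrow>
      \<forall>q\<in>C. snd s \<notin> LD (mpt Q b - pnt q) \<or> snd t \<notin> LD (mpt Q b - pnt q) \<Longrightarrow>
      H (wedge s t) = 0"
  shows "\<not> irreducible_space (subtopology zariski (rank_one_pencils C (mpt P a) (mpt Q b)))"
proof -
  obtain d and F :: "('n cfun \<times> 'n cfun) bivector \<Rightarrow> complex" and g
    where F: "hom_poly d F" "g \<in> sections C (mpt Q b)" "wedge (one_off Q) g \<noteq> 0"
    "F (wedge (0, one_off Q) (0, g)) \<noteq> 0" and
    F0: "\<forall>s t q. snd s \<in> sections C (mpt Q b) \<and> snd t \<in> sections C (mpt Q b) \<and> q \<in> C \<and>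
      snd s \<in> LD (mpt Q b - pnt q) \<and> snd t \<in> LD (mpt Q b - pnt q) \<longrightarrow> F (wedge s t) = 0"
    using basepoint_form[OF Q b] by (elim exE conjE)
  \<comment> \<open>A pencil inside the second summand without common zeros, on which
    \<open>F\<close> is nonzero.\<close>
  let ?s = "(0, one_off Q) :: 'n cfun \<times> 'n cfun" and ?t = "(0, g) :: 'n cfun \<times> 'n cfun"
  have nz: "wedge ?s ?t \<noteq> 0"
    by (rule wedge_image_nonzero[OF clinear_projections(2)]) (simp add: F(3))
  have one: "one_off Q \<in> sections C (mpt Q b)" by (rule one_off_section) (use b in simp)
  have L1: "cvec.span {wedge ?s ?t} \<in> rank_one_pencils C (mpt P a) (mpt Q b)"
    unfolding rank_one_pencils_iff sections2_def
    by (intro exI[of _ ?s] exI[of _ ?t]) (use nz one F(2) sections_zero in simp)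
  show ?thesis
  proof (rule not_irreducibleI[OF rank_one_pencils_proj F(1) H])
    show "cvec.span {wedge ?s ?t} \<in> rank_one_pencils C (mpt P a) (mpt Q b)" by (rule L1)
    show "L \<in> rank_one_pencils C (mpt P a) (mpt Q b)" "H (rep L) \<noteq> 0" by (rule L)+
    show "F (rep (cvec.span {wedge ?s ?t})) \<noteq> 0" unfolding rep_span_nonzero[OF F(1) nz] by (rule F(4))
    fix M assume "M \<in> rank_one_pencils C (mpt P a) (mpt Q b)"
    then obtain s t where st: "s \<in> sections2 C (mpt P a) (mpt Q b)" "t \<in> sections2 C (mpt P a) (mpt Q b)"
      "wedge s t \<noteq> 0" "fst s * snd t = fst t * snd s" "M = cvec.span {wedge s t}"
      unfolding rank_one_pencils_iff by (elim exE conjE)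
    show "F (rep M) = 0 \<or> H (rep M) = 0"
    proof (cases "\<exists>q\<in>C. snd s \<in> LD (mpt Q b - pnt q) \<and> snd t \<in> LD (mpt Q b - pnt q)")
      case True
      have "snd s \<in> sections C (mpt Q b)" "snd t \<in> sections C (mpt Q b)" using st(1,2) by (auto simp: sections2_def)
      then have "F (wedge s t) = 0" using F0 True by blast
      then show ?thesis using rep_span_nonzero[OF F(1) st(3)] unfolding st(5) by blast
    next
      case False
      then have "H (wedge s t) = 0" by (intro H0 st) blast
      then show ?thesis using rep_span_nonzero[OF H st(3)] unfolding st(5) by blast
    qed
  qed
qed

lemma reducible_not_equivalent:
  assumes P: "P \<in> C" and Q: "Q \<in> C" and a: "2 \<le> a" and ab: "a \<le> b"
    and ne: "\<not> (a = b \<and> lin_equiv C (mpt P a) (mpt Q a))"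
  shows "\<not> irreducible_space (subtopology zariski (rank_one_pencils C (mpt P a) (mpt Q b)))"
proof -
  have b: "2 \<le> b" using a ab by simp
  obtain x where x: "x \<in> sections C (mpt P a)" "wedge (one_off P) x \<noteq> 0"
    using basepoint_form[OF P a] by (elim exE conjE)
  obtain \<phi> \<psi> where \<phi>\<psi>: "wedge (one_off P) x (\<phi>, \<psi>) \<noteq> 0" using x(2) by (auto simp: fun_eq_iff)
  then have lin: "clinear \<phi>" "clinear \<psi>" unfolding wedge_def by (auto split: if_splits)
  \<comment> \<open>A Pluecker coordinate of the first components. The pencil of
    \<open>(1, 0)\<close> and \<open>(x, 0)\<close>, contained in the first summand, makes it
    nonzero.\<close>
  define H where "H \<omega> = \<omega> (\<lambda>v. \<phi> (fst v), \<lambda>v. \<psi> (fst v))"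
    for \<omega> :: "('n cfun \<times> 'n cfun) bivector"
  have H_wedge: "H (wedge s t) = \<phi> (fst s) * \<psi> (fst t) - \<phi> (fst t) * \<psi> (fst s)" for s t
    unfolding H_def by (rule wedge_apply) (rule clinear_fst, rule lin)+
  have H: "hom_poly 1 H" unfolding H_def by (rule hom_poly_clinear[OF clinear_eval])
  let ?s = "(one_off P, 0) :: 'n cfun \<times> 'n cfun" and ?t = "(x, 0) :: 'n cfun \<times> 'n cfun"
  have H1: "H (wedge ?s ?t) \<noteq> 0" using \<phi>\<psi> by (simp add: H_wedge wedge_apply lin)
  have nz: "wedge ?s ?t \<noteq> 0" using H1 by (auto simp: H_def)
  have L: "cvec.span {wedge ?s ?t} \<in> rank_one_pencils C (mpt P a) (mpt Q b)"
    unfolding rank_one_pencils_iff sections2_def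
    by (intro exI[of _ ?s] exI[of _ ?t]) (use nz one_off_section[of a P] a x(1) sections_zero in simp)
  show ?thesis
  proof (rule reducible_pencils[OF Q b H L])
    show "H (rep (cvec.span {wedge ?s ?t})) \<noteq> 0" unfolding rep_span_nonzero[OF H nz] by (rule H1)
    fix s t :: "'n cfun \<times> 'n cfun"
    assume s: "s \<in> sections2 C (mpt P a) (mpt Q b)" and t: "t \<in> sections2 C (mpt P a) (mpt Q b)"
      and eq: "fst s * snd t = fst t * snd s"
      and bpf: "\<forall>q\<in>C. snd s \<notin> LD (mpt Q b - pnt q) \<or> snd t \<notin> LD (mpt Q b - pnt q)"
    have st: "fst s \<in> sections C (mpt P a)" "fst t \<in> sections C (mpt P a)"
      "snd s \<in> sections C (mpt Q b)" "snd t \<in> sections C (mpt Q b)" using s t by (auto simp: sections2_def)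
    have "(\<lambda>q. fst s q * snd t q) \<doteq> (\<lambda>q. fst t q * snd s q)" using fun_cong[OF eq] by simp
    from ratio_in_LD[OF st[THEN sections_LD] this bpf] obtain \<theta> where
      \<theta>: "\<theta> \<in> LD (mpt P a - mpt Q b)" "fst s \<doteq> (\<lambda>q. \<theta> q * snd s q)" "fst t \<doteq> (\<lambda>q. \<theta> q * snd t q)"
      by (elim exE conjE)
    have D: "mpt P a - mpt Q b \<in> divisors C" by (intro divisors_diff divisors_single P Q)
    have "\<theta> \<doteq> (\<lambda>_. 0)"
    proof (cases "a < b")
      case True
      then show ?thesis by (intro negative_degree[OF D _ \<theta>(1)]) (simp add: deg_diff)
    next
      case False
      then have [simp]: "b = a" using ab by simp
      show ?thesis
      proof (rule ccontr)
        assume "\<not> \<theta> \<doteq> (\<lambda>_. 0)"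
        then have "nz \<theta>" using LD_dichotomy[OF \<theta>(1)] by blast
        note rat = LD_rational[OF \<theta>(1)]
        \<comment> \<open>A nonzero ratio between bundles of equal degree attains the allowed order
          everywhere, so its inverse witnesses the linear equivalence.\<close>
        have "ord_at C q (\<lambda>p. inverse (\<theta> p)) = dmult (mpt P a - mpt Q a) q" if "q \<in> C" for q
          using degree_zero[OF D _ \<theta>(1) \<open>nz \<theta>\<close> that] ord_at_inverse[OF that rat \<open>nz \<theta>\<close>] by (simp add: deg_diff)
        then have "lin_equiv C (mpt P a) (mpt Q a)" unfolding lin_equiv_def nonzero_rational_iff
          using rational_inverse[OF rat] nz_inverse[OF \<open>nz \<theta>\<close>] by (intro exI[of _ "\<lambda>p. inverse (\<theta> p)"]) simp
        then show False using ne by simp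
      qed
    qed
    then have "fst s \<doteq> (\<lambda>_. 0)" "fst t \<doteq> (\<lambda>_. 0)"
      using \<theta>(2,3) by (eventually_elim, simp)+
    then have "fst s = 0" "fst t = 0" using sections_nz[OF st(1)] sections_nz[OF st(2)] nz_not_zero by blast+
    then show "H (wedge s t) = 0" by (simp add: H_wedge clinear_0[OF lin(1)] clinear_0[OF lin(2)])
  qed
qed

lemma degree_one_dependent:
  assumes D: "D \<in> divisors C" "deg D = 1" and x: "x \<in> LD D" and y: "y \<in> LD D"
  shows "\<exists>\<alpha> \<beta>. (\<alpha> \<noteq> 0 \<or> \<beta> \<noteq> 0) \<and> (\<lambda>q. \<alpha> * x q + \<beta> * y q) \<doteq> (\<lambda>_. 0)"
proof -
  obtain x' y' where x': "x' \<in> sections C D" "x' \<doteq> x" and y': "y' \<in> sections C D" "y' \<doteq> y"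
    using normalise[OF x] normalise[OF y] by blast
  obtain B where B: "finite B" "B \<subseteq> sections C D" "cvec.independent B" "sections C D \<subseteq> cvec.span B" "card B = ell D"
    using findim_basis[OF findim_sections[OF D(1)]] .
  have "card B = 1" using B(5) ell_eq_deg[OF D(1)] D(2) by simp
  then obtain e where e: "B = {e}" by (rule card_1_singletonE)
  have "x' \<in> cvec.span {e}" "y' \<in> cvec.span {e}" using x'(1) y'(1) B(4) e by blast+
  then obtain \<alpha> \<beta> where \<alpha>\<beta>: "x' = \<alpha> *\<^sub>C e" "y' = \<beta> *\<^sub>C e" by (auto simp: cvec.span_singleton)
  show ?thesis
  proof (cases "\<alpha> = 0 \<and> \<beta> = 0")
    case True
    have "\<forall>\<^sub>F q in \<eta>. 1 * x q + 0 * y q = 0"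
      using x'(2) unfolding \<alpha>\<beta>(1) by eventually_elim (use True in auto)
    then show ?thesis by (intro exI[of _ 1] exI[of _ 0] conjI) simp_all
  next
    case False
    have "\<forall>\<^sub>F q in \<eta>. \<beta> * x q + (- \<alpha>) * y q = 0"
      using x'(2) y'(2) unfolding \<alpha>\<beta>
    proof eventually_elim
      case (elim q)
      show ?case unfolding elim[symmetric] by simp
    qed
    then show ?thesis using False by (intro exI[of _ \<beta>] exI[of _ "- \<alpha>"] conjI) auto
  qed
qed

end

section \<open>The case where \<open>a P\<close> and \<open>a Q\<close> are equivalent\<close>

locale equivalent_points = elliptic C for C :: "'n::finite pt set" +
  fixes P Q :: "'n pt" and a :: int and h :: "'n cfun"
  assumes P: "P \<in> C" and Q: "Q \<in> C" and a: "2 \<le> a" and h: "rational h" "nz h"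
    and ord_h: "q \<in> C \<Longrightarrow> ord_at C q h = dmult (Poly_Mapping.single P a - Poly_Mapping.single Q a) q"
begin

abbreviation "V1 \<equiv> sections C (mpt P a)"
abbreviation "V2 \<equiv> sections C (mpt Q a)"
abbreviation "GE \<equiv> rank_one_pencils C (mpt P a) (mpt Q a)"

text \<open>\<open>h\<close> has divisor \<open>a P - a Q\<close>; multiplication by it turns poles
  at \<open>P\<close> into poles at \<open>Q\<close>.\<close>

lemma LD_mult_h: "f \<in> LD D \<Longrightarrow> (\<lambda>q. h q * f q) \<in> LD (mpt Q a - mpt P a + D)"
  by (rule LD_mult, rule LD_ordI[OF h(1)]) (simp_all add: ord_h lookup_minus)

lemma LD_div_h: "f \<in> LD D \<Longrightarrow> (\<lambda>q. inverse (h q) * f q) \<in> LD (mpt P a - mpt Q a + D)"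
  by (rule LD_mult, rule LD_ordI[OF rational_inverse[OF h(1)]])
    (simp_all add: ord_at_inverse[OF _ h] ord_h lookup_minus)

lemma transport:
  obtains T T' :: "'n cfun \<Rightarrow> 'n cfun" where "clinear T" "clinear T'"
    "\<forall>f\<in>V1. T f \<in> V2" "\<forall>f\<in>V1. T f \<doteq> (\<lambda>q. h q * f q)" "\<forall>f\<in>V1. T' (T f) = f"
    "\<forall>g\<in>V2. T' g \<in> V1 \<and> T (T' g) = g"
proof -
  have "\<exists>T :: 'n cfun \<Rightarrow> 'n cfun. clinear T \<and>
    (\<forall>f\<in>V1. T f \<in> V2 \<and> T f \<doteq> (\<lambda>q. h q * f q))"
  proof (rule mult_map)
    fix f assume "f \<in> LD (mpt P a)"
    from LD_mult_h[OF this] show "(\<lambda>q. h q * f q) \<in> LD (mpt Q a)" by simp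
  qed
  then obtain T :: "'n cfun \<Rightarrow> 'n cfun" where T: "clinear T"
    "\<forall>f\<in>V1. T f \<in> V2 \<and> T f \<doteq> (\<lambda>q. h q * f q)" by (elim exE conjE)
  have Th: "T f \<doteq> (\<lambda>q. h q * f q)" if "f \<in> V1" for f using T(2) that by blast
  have "inj_on T V1" by (rule mult_inj[OF h(2) Th])
  from cvec_pair.linear_exists_left_inverse_on[OF T(1) subspace_sections this]
  obtain T' :: "'n cfun \<Rightarrow> 'n cfun" where T': "clinear T'" "\<forall>f\<in>V1. T' (T f) = f"
    by (elim exE conjE)
  have "T' g \<in> V1 \<and> T (T' g) = g" if g: "g \<in> V2" for g
  proof -
    have "(\<lambda>q. inverse (h q) * g q) \<in> LD (mpt P a)" using LD_div_h[OF sections_LD[OF g]] by simp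
    then obtain f where f: "f \<in> V1" "f \<doteq> (\<lambda>q. inverse (h q) * g q)" using normalise by blast
    have "T f \<doteq> g" using Th[OF f(1)] f(2) h(2) unfolding nz_def by eventually_elim simp
    moreover have "T f \<in> V2" using T(2) f(1) by blast
    ultimately have "T f = g" by (intro sections_ext[OF _ g])
    then show ?thesis using T'(2) f(1) by auto
  qed
  then show ?thesis using that[OF T(1) T'(1)] T(2) T'(2) Th by blast
qed

text \<open>The pencil of \<open>(1, T x)\<close> and \<open>(x, T (x * x))\<close> has a
  nonconstant ratio after transport; its second components share the zeros of \<open>x\<close>, so
  nothing forces \<open>H\<close> to vanish on it.\<close>

lemma reducible_large:
  assumes a4: "4 \<le> a"
  shows "\<not> irreducible_space (subtopology zariski GE)"
proof -
  obtain T T' :: "'n cfun \<Rightarrow> 'n cfun" where T: "clinear T" "clinear T'"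
    "\<forall>f\<in>V1. T f \<in> V2" "\<forall>f\<in>V1. T f \<doteq> (\<lambda>q. h q * f q)" "\<forall>f\<in>V1. T' (T f) = f"
    "\<forall>g\<in>V2. T' g \<in> V1 \<and> T (T' g) = g" by (rule transport)
  obtain x where x: "x \<in> sections C (mpt P 2)" "x \<notin> LD (mpt P (2 - 1))" "nz x" "ord_at C P x = - 2"
    using pole_section[OF P order.refl] .
  have xx: "x * x \<in> sections C (mpt P 4)" using sections_mult[OF x(1) _ x(1)] by simp
  have V1: "one_off P \<in> V1" "x \<in> V1" "x * x \<in> V1"
    using one_off_section[of a P] sections_raise[OF x(1), of a] sections_raise[OF xx, of a] a4 by simp_all
  have one2: "one_off P \<in> sections C (mpt P 2)" by (rule one_off_section) simp
  have "x * x \<notin> sections C (mpt P 2)"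
  proof
    assume "x * x \<in> sections C (mpt P 2)"
    from LD_nz_ord[OF sections_LD[OF this] _ P] nz_mult[OF x(3,3)]
      ord_at_mult[OF P LD_rational[OF sections_LD[OF x(1)]] x(3) LD_rational[OF sections_LD[OF x(1)]] x(3)]
    show False by (simp add: times_fun_def x(4) lookup_pnt)
  qed
  from functional_vanishing[OF subspace_sections this] obtain \<kappa> :: "'n cfun \<Rightarrow> complex" where
    \<kappa>: "clinear \<kappa>" "\<kappa> (x * x) = 1" "\<forall>u\<in>sections C (mpt P 2). \<kappa> u = 0" .
  have "one_off P \<notin> cvec.span {x}"
  proof
    assume "one_off P \<in> cvec.span {x}"
    then obtain c where c: "one_off P = c *\<^sub>C x" by (auto simp: cvec.span_singleton)
    have cx: "\<forall>\<^sub>F q in \<eta>. c * x q = 1" using one_off_aeq[of P] unfolding c by simp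
    have "c \<noteq> 0"
    proof
      assume "c = 0"
      then have "(\<lambda>_. 1) \<doteq> (\<lambda>_. 0)" using cx by simp
      then show False using nz_not_zero[OF nz_const[of 1]] by simp
    qed
    from cx have "(\<lambda>_. inverse c) \<doteq> x" by eventually_elim (use \<open>c \<noteq> 0\<close> in \<open>simp add: field_simps\<close>)
    from LD_cong[OF this LD_const] x(2) show False by (simp add: lookup_pnt)
  qed
  from functional_vanishing[OF cvec.subspace_span this] obtain \<rho> :: "'n cfun \<Rightarrow> complex" where
    \<rho>: "clinear \<rho>" "\<rho> (one_off P) = 1" "\<forall>u\<in>cvec.span {x}. \<rho> u = 0" .
  \<comment> \<open>\<open>\<kappa>\<close> vanishes on pole orders up to 2. Adding a multiple of it
    to \<open>\<rho>\<close> corrects the value at \<open>x * x\<close> to 1 and preserves those at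
    1 and \<open>x\<close>.\<close>
  define \<phi> where "\<phi> f = \<rho> f + (1 - \<rho> (x * x)) * \<kappa> f" for f
  have \<phi>: "clinear \<phi>" using \<kappa>(1) \<rho>(1) unfolding clinear_iff \<phi>_def by (simp add: algebra_simps)
  have \<phi>_val: "\<phi> (one_off P) = 1" "\<phi> x = 0" "\<phi> (x * x) = 1"
    using \<kappa> \<rho> one2 x(1) cvec.span_base[of x "{x}"] by (simp_all add: \<phi>_def)
  \<comment> \<open>Using one functional for both components makes the two terms cancel whenever the
    first components are a common multiple of the transported second ones.\<close>
  define H where "H \<omega> = \<omega> (\<lambda>v. \<phi> (fst v), \<lambda>v. \<phi> (T' (snd v)))"
    for \<omega> :: "('n cfun \<times> 'n cfun) bivector"
  have H_wedge: "H (wedge s t) = \<phi> (fst s) * \<phi> (T' (snd t)) - \<phi> (fst t) * \<phi> (T' (snd s))" for s t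
    unfolding H_def by (rule wedge_apply[OF clinear_fst[OF \<phi>] clinear_snd[OF clinear_comp[OF \<phi> T(2)]]])
  have H: "hom_poly 1 H" unfolding H_def by (rule hom_poly_clinear[OF clinear_eval])
  let ?s = "(one_off P, T x)" and ?t = "(x, T (x * x))"
  have H1: "H (wedge ?s ?t) = 1" using T(5) V1 by (simp add: H_wedge \<phi>_val)
  have nz: "wedge ?s ?t \<noteq> 0" using H1 by (auto simp: H_def)
  have eq: "one_off P * T (x * x) = x * T x"
  proof (rule pencil_pointwise[OF V1(1,2) _ T(3)[THEN bspec, OF V1(2)] T(3)[THEN bspec, OF V1(3)]])
    show "(\<lambda>q. one_off P q * T (x * x) q) \<doteq> (\<lambda>q. x q * T x q)"
      using one_off_aeq[of P] T(4)[THEN bspec, OF V1(2)] T(4)[THEN bspec, OF V1(3)] by eventually_elim simp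
  qed (use a in auto)
  have L: "cvec.span {wedge ?s ?t} \<in> GE"
    unfolding rank_one_pencils_iff sections2_def
    by (intro exI[of _ ?s] exI[of _ ?t]) (use nz V1 T(3) eq in simp)
  show ?thesis
  proof (rule reducible_pencils[OF Q a H L])
    show "H (rep (cvec.span {wedge ?s ?t})) \<noteq> 0" unfolding rep_span_nonzero[OF H nz] H1 by simp
    fix s t :: "'n cfun \<times> 'n cfun"
    assume s: "s \<in> sections2 C (mpt P a) (mpt Q a)" and t: "t \<in> sections2 C (mpt P a) (mpt Q a)"
      and eq: "fst s * snd t = fst t * snd s"
      and bpf: "\<forall>q\<in>C. snd s \<notin> LD (mpt Q a - pnt q) \<or> snd t \<notin> LD (mpt Q a - pnt q)"
    have st: "fst s \<in> V1" "fst t \<in> V1" "snd s \<in> V2" "snd t \<in> V2" using s t by (auto simp: sections2_def)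
    have "(\<lambda>q. fst s q * snd t q) \<doteq> (\<lambda>q. fst t q * snd s q)" using fun_cong[OF eq] by simp
    from ratio_in_LD[OF st[THEN sections_LD] this bpf] obtain \<theta> where
      \<theta>: "\<theta> \<in> LD (mpt P a - mpt Q a)" "fst s \<doteq> (\<lambda>q. \<theta> q * snd s q)" "fst t \<doteq> (\<lambda>q. \<theta> q * snd t q)"
      by (elim exE conjE)
    have "(\<lambda>q. h q * \<theta> q) \<in> LD 0" using LD_mult_h[OF \<theta>(1)] by simp
    from LD_0_const[OF this] obtain c where c: "(\<lambda>q. h q * \<theta> q) \<doteq> (\<lambda>_. c)" ..
    have scal: "f = c *\<^sub>C T' g" if f: "f \<in> V1" and g: "g \<in> V2" and fg: "f \<doteq> (\<lambda>q. \<theta> q * g q)" for f g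
    proof (rule sections_ext[OF f])
      have T'g: "T' g \<in> V1" "T (T' g) = g" using T(6) g by auto
      show "c *\<^sub>C T' g \<in> V1" by (rule sections_scale[OF T'g(1)])
      have "g \<doteq> (\<lambda>q. h q * T' g q)" using T(4)[THEN bspec, OF T'g(1)] unfolding T'g(2) .
      then show "f \<doteq> c *\<^sub>C T' g" using fg c by eventually_elim (simp add: algebra_simps)
    qed
    have "fst s = c *\<^sub>C T' (snd s)" "fst t = c *\<^sub>C T' (snd t)"
      using scal[OF st(1,3) \<theta>(2)] scal[OF st(2,4) \<theta>(3)] .
    then show "H (wedge s t) = 0" by (simp add: H_wedge clinear_scale[OF \<phi>])
  qed
qed

text \<open>\<open>E\<close> is \<open>a P\<close> without the base point of \<open>u\<close> and
  \<open>w\<close>, if there is one; a second one is excluded because independent sections need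
  degree at least 2. The ratio then has at most one simple pole, hence is constant.\<close>

lemma small_pencil_constant_ratio:
  assumes a23: "a \<in> {2, 3}" and s1: "s1 \<in> V1" and t1: "t1 \<in> V1" and u: "u \<in> V1" and w: "w \<in> V1"
    and eq: "(\<lambda>q. s1 q * w q) \<doteq> (\<lambda>q. t1 q * u q)"
    and indep: "\<And>\<alpha> \<beta>. \<alpha> *\<^sub>C u + \<beta> *\<^sub>C w = 0 \<Longrightarrow> \<alpha> = 0 \<and> \<beta> = 0"
  shows "\<exists>c. s1 = c *\<^sub>C u \<and> t1 = c *\<^sub>C w"
proof -
  have D: "mpt P a \<in> divisors C" by (rule divisors_single[OF P])
  have not_both: "\<not> (u \<in> LD E \<and> w \<in> LD E)" if E: "E \<in> divisors C" "deg E = 1" for E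
  proof
    assume "u \<in> LD E \<and> w \<in> LD E"
    then obtain \<alpha> \<beta> where \<alpha>\<beta>: "\<alpha> \<noteq> 0 \<or> \<beta> \<noteq> 0" "(\<lambda>q. \<alpha> * u q + \<beta> * w q) \<doteq> (\<lambda>_. 0)"
      using degree_one_dependent[OF E, of u w] by blast
    have "\<alpha> *\<^sub>C u + \<beta> *\<^sub>C w = 0"
      by (rule sections_ext[OF sections_add[OF sections_scale[OF u] sections_scale[OF w]] sections_zero])
        (use \<alpha>\<beta>(2) in simp)
    then show False using indep \<alpha>\<beta>(1) by blast
  qed
  have "\<exists>E. u \<in> LD E \<and> w \<in> LD E \<and> (\<forall>q\<in>C. u \<notin> LD (E - pnt q) \<or> w \<notin> LD (E - pnt q)) \<and>
    (\<forall>\<psi>. \<psi> \<in> LD (mpt P a - E) \<longrightarrow> (\<exists>c. \<psi> \<doteq> (\<lambda>_. c)))"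
  proof (cases "\<exists>q\<in>C. u \<in> LD (mpt P a - pnt q) \<and> w \<in> LD (mpt P a - pnt q)")
    case False
    then show ?thesis using sections_LD[OF u] sections_LD[OF w] LD_0_const
      by (intro exI[of _ "mpt P a"] conjI ballI allI impI) auto
  next
    case True
    then obtain q where q: "q \<in> C" and uw: "u \<in> LD (mpt P a - pnt q)" "w \<in> LD (mpt P a - pnt q)" by blast
    let ?E = "mpt P a - pnt q"
    have E: "?E \<in> divisors C" by (intro divisors_diff D divisors_single q)
    have "a \<noteq> 2" using not_both[OF E] uw by (auto simp: deg_diff)
    then have a3: "a = 3" using a23 by simp
    have "u \<notin> LD (?E - pnt r) \<or> w \<notin> LD (?E - pnt r)" if r: "r \<in> C" for r
    proof -
      have "?E - pnt r \<in> divisors C" by (intro divisors_diff D divisors_single q r)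
      moreover have "deg (?E - pnt r) = 1" by (simp add: deg_diff a3)
      ultimately show ?thesis using not_both by blast
    qed
    moreover have "\<exists>c. \<psi> \<doteq> (\<lambda>_. c)" if "\<psi> \<in> LD (mpt P a - ?E)" for \<psi>
      using LD_point_const[OF q, of \<psi>] that by simp
    ultimately show ?thesis using uw by (intro exI[of _ ?E] conjI ballI allI impI) auto
  qed
  then obtain E where E: "u \<in> LD E" "w \<in> LD E" "\<forall>q\<in>C. u \<notin> LD (E - pnt q) \<or> w \<notin> LD (E - pnt q)"
    "\<forall>\<psi>. \<psi> \<in> LD (mpt P a - E) \<longrightarrow> (\<exists>c. \<psi> \<doteq> (\<lambda>_. c))" by (elim exE conjE)
  obtain \<psi> where \<psi>: "\<psi> \<in> LD (mpt P a - E)" "s1 \<doteq> (\<lambda>q. \<psi> q * u q)" "t1 \<doteq> (\<lambda>q. \<psi> q * w q)"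
    using ratio_in_LD[OF sections_LD[OF s1] sections_LD[OF t1] E(1,2) eq E(3)] by (elim exE conjE)
  obtain c where c: "\<psi> \<doteq> (\<lambda>_. c)" using E(4) \<psi>(1) by blast
  have "s1 \<doteq> c *\<^sub>C u" using \<psi>(2) c by eventually_elim simp
  moreover have "t1 \<doteq> c *\<^sub>C w" using \<psi>(3) c by eventually_elim simp
  ultimately show ?thesis
    using sections_ext[OF s1 sections_scale[OF u]] sections_ext[OF t1 sections_scale[OF w]] by blast
qed

text \<open>If both second components are 0, then \<open>m = 0\<close> works. Otherwise
  \<open>u\<close> and \<open>w\<close> are the second components moved back by \<open>T'\<close>,
  with \<open>m = 1\<close>, and the first components are a constant multiple of these.\<close>

lemma small_pencil_parametrisation:
  fixes T T' :: "'n cfun \<Rightarrow> 'n cfun"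
  assumes a23: "a \<in> {2, 3}"
    and T: "clinear T" "\<forall>f\<in>V1. T f \<doteq> (\<lambda>q. h q * f q)" "\<forall>g\<in>V2. T' g \<in> V1 \<and> T (T' g) = g"
    and s: "s \<in> sections2 C (mpt P a) (mpt Q a)" and t: "t \<in> sections2 C (mpt P a) (mpt Q a)"
    and nz: "wedge s t \<noteq> 0" and eq: "fst s * snd t = fst t * snd s"
  shows "\<exists>l m u w. u \<in> V1 \<and> w \<in> V1 \<and> s = (l *\<^sub>C u, m *\<^sub>C T u) \<and> t = (l *\<^sub>C w, m *\<^sub>C T w)"
proof -
  have st: "fst s \<in> V1" "fst t \<in> V1" "snd s \<in> V2" "snd t \<in> V2" using s t by (auto simp: sections2_def)
  show ?thesis
  proof (cases "snd s = 0 \<and> snd t = 0")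
    case True
    then have "s = (1 *\<^sub>C fst s, 0 *\<^sub>C T (fst s))" "t = (1 *\<^sub>C fst t, 0 *\<^sub>C T (fst t))"
      by (simp_all add: prod_eq_iff)
    then show ?thesis using st(1,2) by blast
  next
    case False
    define u where "u = T' (snd s)"
    define w where "w = T' (snd t)"
    have u: "u \<in> V1" "T u = snd s" and w: "w \<in> V1" "T w = snd t"
      using T(3) st by (simp_all add: u_def w_def)
    have hu: "snd s \<doteq> (\<lambda>q. h q * u q)" using T(2)[THEN bspec, OF u(1)] unfolding u(2) .
    have hw: "snd t \<doteq> (\<lambda>q. h q * w q)" using T(2)[THEN bspec, OF w(1)] unfolding w(2) .
    have "(\<lambda>q. fst s q * snd t q) \<doteq> (\<lambda>q. fst t q * snd s q)" using fun_cong[OF eq] by simp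
    then have eq': "(\<lambda>q. fst s q * w q) \<doteq> (\<lambda>q. fst t q * u q)"
      using hu hw h(2) unfolding nz_def by eventually_elim simp
    \<comment> \<open>A relation between \<open>u\<close> and \<open>w\<close> passes to the second
      components by \<open>T\<close> and to the first ones by the rank-one identity. It would then
      hold for \<open>s\<close> and \<open>t\<close>, whose wedge is nonzero.\<close>
    have indep: "\<alpha> = 0 \<and> \<beta> = 0" if rel: "\<alpha> *\<^sub>C u + \<beta> *\<^sub>C w = 0" for \<alpha> \<beta>
    proof -
      have relq: "\<alpha> * u q + \<beta> * w q = 0" for q using fun_cong[OF rel, of q] by simp
      have snd0: "\<alpha> *\<^sub>C snd s + \<beta> *\<^sub>C snd t = 0"
        unfolding u(2)[symmetric] w(2)[symmetric] clinear_scale[OF T(1), symmetric]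
          clinear_add[OF T(1), symmetric] rel by (rule clinear_0[OF T(1)])
      have "nz u \<or> nz w"
      proof (rule ccontr)
        assume "\<not> (nz u \<or> nz w)"
        then have "u = 0" "w = 0" using sections_nz[OF u(1)] sections_nz[OF w(1)] by auto
        then show False using False u(2) w(2) clinear_0[OF T(1)] by simp
      qed
      then have "(\<lambda>q. \<alpha> * fst s q + \<beta> * fst t q) \<doteq> (\<lambda>_. 0)"
      proof
        assume "nz u"
        then show ?thesis using eq' unfolding nz_def
        proof eventually_elim
          case (elim q)
          have "(\<alpha> * fst s q + \<beta> * fst t q) * u q = fst s q * (\<alpha> * u q + \<beta> * w q)"
            using elim(2) by (simp add: algebra_simps)
          then show ?case using elim(1) relq[of q] by simp
        qed
      next
        assume "nz w"
        then show ?thesis using eq' unfolding nz_def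
        proof eventually_elim
          case (elim q)
          have "(\<alpha> * fst s q + \<beta> * fst t q) * w q = fst t q * (\<alpha> * u q + \<beta> * w q)"
            using elim(2) by (simp add: algebra_simps)
          then show ?case using elim(1) relq[of q] by simp
        qed
      qed
      then have fst0: "\<alpha> *\<^sub>C fst s + \<beta> *\<^sub>C fst t = 0"
        by (intro sections_ext[OF sections_add[OF sections_scale[OF st(1)] sections_scale[OF st(2)]] sections_zero])
          simp
      have st0: "\<alpha> *\<^sub>C s + \<beta> *\<^sub>C t = 0" using fst0 snd0 by (simp add: prod_eq_iff scaleC_prod_def)
      have "wedge (\<alpha> *\<^sub>C s + \<beta> *\<^sub>C t) t = \<alpha> *\<^sub>C wedge s t"
        by (simp add: wedge_add_left wedge_scale_left wedge_self)
      then have "\<alpha> *\<^sub>C wedge s t = 0" unfolding st0 wedge_0 by simp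
      moreover have "wedge s (\<alpha> *\<^sub>C s + \<beta> *\<^sub>C t) = \<beta> *\<^sub>C wedge s t"
        by (simp add: wedge_add_right wedge_scale_right wedge_self)
      then have "\<beta> *\<^sub>C wedge s t = 0" unfolding st0 wedge_0 by simp
      ultimately show ?thesis using nz by (simp only: cvec.scale_eq_0_iff simp_thms)
    qed
    obtain c where "fst s = c *\<^sub>C u" "fst t = c *\<^sub>C w"
      using small_pencil_constant_ratio[OF a23 st(1,2) u(1) w(1) eq' indep] by blast
    then have "s = (c *\<^sub>C u, 1 *\<^sub>C T u)" "t = (c *\<^sub>C w, 1 *\<^sub>C T w)" by (simp_all add: prod_eq_iff u(2) w(2))
    then show ?thesis using u(1) w(1) by blast
  qed
qed

lemma irreducible_small:
  assumes a23: "a \<in> {2, 3}"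
  shows "irreducible_space (subtopology zariski GE)"
proof -
  obtain T T' :: "'n cfun \<Rightarrow> 'n cfun" where T: "clinear T" "clinear T'"
    "\<forall>f\<in>V1. T f \<in> V2" "\<forall>f\<in>V1. T f \<doteq> (\<lambda>q. h q * f q)" "\<forall>f\<in>V1. T' (T f) = f"
    "\<forall>g\<in>V2. T' g \<in> V1 \<and> T (T' g) = g" by (rule transport)
  have in_GE: "cvec.span {pencil T l m u w} \<in> GE" if u: "u \<in> V1" and w: "w \<in> V1" and nz: "pencil T l m u w \<noteq> 0" for l m u w
  proof -
    have V: "l *\<^sub>C u \<in> V1" "l *\<^sub>C w \<in> V1" "m *\<^sub>C T u \<in> V2" "m *\<^sub>C T w \<in> V2"
      using u w T(3) by (simp_all add: sections_scale)
    have "(l *\<^sub>C u) * (m *\<^sub>C T w) = (l *\<^sub>C w) * (m *\<^sub>C T u)"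
    proof (rule pencil_pointwise[OF V(1,2) _ V(3,4)])
      show "(\<lambda>q. (l *\<^sub>C u) q * (m *\<^sub>C T w) q) \<doteq> (\<lambda>q. (l *\<^sub>C w) q * (m *\<^sub>C T u) q)"
        using T(4)[THEN bspec, OF u] T(4)[THEN bspec, OF w] by eventually_elim simp
    qed (use a in auto)
    then show ?thesis
      unfolding rank_one_pencils_iff sections2_def
      by (intro exI[of _ "(l *\<^sub>C u, m *\<^sub>C T u)"] exI[of _ "(l *\<^sub>C w, m *\<^sub>C T w)"])
        (use V nz in \<open>simp add: pencil_def\<close>)
  qed
  have GE_param: "\<exists>l m u w. u \<in> V1 \<and> w \<in> V1 \<and> pencil T l m u w \<noteq> 0 \<and> L = cvec.span {pencil T l m u w}" if L: "L \<in> GE" for L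
  proof -
    obtain s t where st: "s \<in> sections2 C (mpt P a) (mpt Q a)" "t \<in> sections2 C (mpt P a) (mpt Q a)"
      "wedge s t \<noteq> 0" "fst s * snd t = fst t * snd s" "L = cvec.span {wedge s t}"
      using L unfolding rank_one_pencils_iff by (elim exE conjE)
    obtain l m u w where "u \<in> V1" "w \<in> V1" "s = (l *\<^sub>C u, m *\<^sub>C T u)" "t = (l *\<^sub>C w, m *\<^sub>C T w)"
      using small_pencil_parametrisation[OF a23 T(1,4,6) st(1-4)] by (elim exE conjE)
    then show ?thesis using st(3,5) unfolding pencil_def by blast
  qed
  show ?thesis
  proof (rule irreducibleI[OF rank_one_pencils_proj])
    obtain g where g: "g \<in> V1" "wedge (one_off P) g \<noteq> 0" using basepoint_form[OF P a] by (elim exE conjE)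
    have "pencil T 1 0 (one_off P) g \<noteq> 0"
      unfolding pencil_def by (rule wedge_image_nonzero[OF clinear_projections(1)]) (simp add: g(2))
    moreover have "one_off P \<in> V1" by (rule one_off_section) (use a in simp)
    ultimately show "GE \<noteq> {}" using in_GE[OF _ g(1)] by blast
  next
    fix d e and F H :: "('n cfun \<times> 'n cfun) bivector \<Rightarrow> complex" and L1 L2
    assume F: "hom_poly d F" and H: "hom_poly e H" and L1: "L1 \<in> GE" "F (rep L1) \<noteq> 0"
      and L2: "L2 \<in> GE" "H (rep L2) \<noteq> 0"
    obtain l m u w where p1: "u \<in> V1" "w \<in> V1" "pencil T l m u w \<noteq> 0" "L1 = cvec.span {pencil T l m u w}"
      using GE_param[OF L1(1)] by (elim exE conjE)
    obtain l' m' u' w' where p2: "u' \<in> V1" "w' \<in> V1" "pencil T l' m' u' w' \<noteq> 0" "L2 = cvec.span {pencil T l' m' u' w'}"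
      using GE_param[OF L2(1)] by (elim exE conjE)
    define \<gamma> where "\<gamma> t = pencil T (l + t * (l' - l)) (m + t * (m' - m)) (u + t *\<^sub>C (u' - u)) (w + t *\<^sub>C (w' - w))" for t
    have \<gamma>: "poly_curve \<gamma>" unfolding \<gamma>_def by (rule poly_curve_pencil[OF T(1)])
    have \<gamma>0: "\<gamma> 0 = pencil T l m u w" and \<gamma>1: "\<gamma> 1 = pencil T l' m' u' w'" by (simp_all add: \<gamma>_def)
    \<comment> \<open>Between the end points the bivector may degenerate to 0. Its coordinate at
      \<open>x\<close> is a third polynomial whose nonvanishing excludes this.\<close>
    obtain x where x: "\<gamma> 0 x \<noteq> 0" using p1(3) unfolding \<gamma>0 by (auto simp: fun_eq_iff)
    obtain p where p: "\<forall>t. F (\<gamma> t) = poly p t" using hom_poly_curve[OF F \<gamma>] ..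
    obtain q where q: "\<forall>t. H (\<gamma> t) = poly q t" using hom_poly_curve[OF H \<gamma>] ..
    obtain r where r: "\<forall>t. \<gamma> t x = poly r t" using hom_poly_curve[OF hom_poly_clinear[OF clinear_eval] \<gamma>] ..
    have "F (\<gamma> 0) \<noteq> 0" using L1(2) unfolding p1(4) rep_span_nonzero[OF F p1(3)] \<gamma>0 .
    then have "p \<noteq> 0" using p by auto
    moreover have "H (\<gamma> 1) \<noteq> 0" using L2(2) unfolding p2(4) rep_span_nonzero[OF H p2(3)] \<gamma>1 .
    then have "q \<noteq> 0" using q by auto
    moreover have "r \<noteq> 0" using x r by auto
    ultimately obtain t where t: "poly p t \<noteq> 0" "poly q t \<noteq> 0" "poly r t \<noteq> 0" by (rule three_polys_nonzero)
    have nz: "\<gamma> t \<noteq> 0"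
    proof
      assume "\<gamma> t = 0"
      then have "\<gamma> t x = 0" by simp
      then show False using r t(3) by simp
    qed
    have line: "v + t *\<^sub>C (v' - v) \<in> V1" if "v \<in> V1" "v' \<in> V1" for v v'
      using that subspace_sections by (intro cvec.subspace_add cvec.subspace_scale cvec.subspace_diff)
    have "cvec.span {\<gamma> t} \<in> GE"
      using in_GE[OF line[OF p1(1) p2(1)] line[OF p1(2) p2(2)]] nz unfolding \<gamma>_def by blast
    moreover have "F (rep (cvec.span {\<gamma> t})) \<noteq> 0" "H (rep (cvec.span {\<gamma> t})) \<noteq> 0"
      using p q t unfolding rep_span_nonzero[OF F nz] rep_span_nonzero[OF H nz] by simp_all
    ultimately show "\<exists>L\<in>GE. F (rep L) \<noteq> 0 \<and> H (rep L) \<noteq> 0" by blast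
  qed
qed

end

theorem corollary3p19:
  fixes C :: "'n::finite pt set" and P Q :: "'n pt" and a b :: int
  assumes "elliptic_curve C" and "P \<in> C" and "Q \<in> C" and "2 \<le> a" and "a \<le> b"
  shows "irreducible_space (subtopology zariski
           (rank_one_pencils C (Poly_Mapping.single P a) (Poly_Mapping.single Q b))) \<longleftrightarrow>
         a = b \<and> a \<in> {2, 3} \<and>
         lin_equiv C (Poly_Mapping.single P a) (Poly_Mapping.single Q a)"
proof -
  interpret elliptic C
    using assms(1) unfolding elliptic_curve_def smooth_projective_curve_def by unfold_locales blast+
  show ?thesis
  proof (cases "a = b \<and> lin_equiv C (mpt P a) (mpt Q a)")
    case False
    then show ?thesis using reducible_not_equivalent[OF assms(2-5)] by blast
  next
    case True
    then obtain h where h: "rational h" "nz h"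
      "\<forall>q\<in>C. dmult (mpt P a - mpt Q a) q = ord_at C q h"
      unfolding lin_equiv_def nonzero_rational_iff by blast
    interpret equivalent_points C P Q a h
      by unfold_locales (use assms h in simp_all)
    \<comment> \<open>An integer \<open>a \<ge> 2\<close> other than 2 and 3 is at least 4, so the
      two lemmas cover all cases.\<close>
    show ?thesis using True irreducible_small reducible_large assms(4) by fastforce
  qed
qed

end
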